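(* Let $\zeta\equiv\Phi$ or $\zeta\equiv1$. (i) For $s\ge0$: $\mathbb E[X^\zeta_s]=\mu s+\mu\int_0^s\int_0^u\Psi(r)\,dr\,du$ if $\zeta\equiv1$, and $\mathbb E[X^\zeta_s]=\mu\int_0^s\Psi(u)\,du$ if $\zeta\equiv\Phi$. (ii) For $0\le s\le t$: $$\mathbb E[X^\Phi_sX^\zeta_t]=\mathbb E[X^\Phi_s]\mathbb E[X^\zeta_t]+\mu\int_0^s\zeta(t-v)\Psi(s-v)\Big(1+\int_0^v\Psi(w)dw\Big)dv+\mu\int_0^t\int_0^{s\wedge u}\zeta(t-u)\Psi(u-v)\Psi(s-v)\Big(1+\int_0^v\Psi(v-w)dw\Big)dv\,du,$$ and $$\mathbb E[X^1_sX^\zeta_t]=\mathbb E[X^1_s]\mathbb E[X^\zeta_t]+\mu\int_0^s\zeta(t-u)\Big(1+\int_u^s\Psi(y-u)dy\Big)\Big(1+\int_0^u\Psi(w)dw\Big)du+\mu\int_0^t\int_0^{s\wedge u}\zeta(t-u)\Psi(u-v)\Big(1+\int_0^v\Psi(w)dw\Big)\Big(1+\int_v^s\Psi(y-v)dy\Big)dv\,du.$$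
   Context: Let $\mu>0$ and $\Phi:\mathbb{R}_+\to\mathbb{R}_+$ integrable with $\int_0^\infty\Phi<1$. Let $\Phi_1:=\Phi$, $\Phi_n(t):=\int_0^t\Phi(t-s)\Phi_{n-1}(s)ds$, and $\Psi:=\sum_{n\ge1}\Phi_n$ (convergent in $L^1(\mathbb{R}_+)$). Let $N$ be a Poisson random measure on $\mathbb{R}_+\times\mathbb{R}_+$ with intensity $dt\,d\theta$ (canonical process on the Poisson space). Let $\lambda$ be the unique solution of $\lambda_t=\mu+\int_{(0,t)\times\mathbb{R}_+}\Phi(t-s)\mathbf 1_{\{\theta\le\lambda_s\}}N(ds,d\theta)$, and for $\zeta\in\{\Phi,1\}$ ($1$ the constant function) set $X^\zeta_t:=\int_{(0,t)\times\mathbb{R}_+}\zeta(t-s)\mathbf 1_{\{\theta\le\lambda_s\}}N(ds,d\theta)$; thus $X^\Phi_t=\lambda_t-\mu$ and $X^1_t=H_t$, the Hawkes process with intensity $\lambda$. *)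

theory Defs
  imports "HOL-Probability.Probability"
begin

definition quadrant :: "(real \<times> real) set" where
  "quadrant = {0..} \<times> {0..}"

definition poisson_random_measure ::
  "'a measure \<Rightarrow> ('a \<Rightarrow> (real \<times> real) measure) \<Rightarrow> bool" where
  "poisson_random_measure M N \<longleftrightarrow>
     prob_space M \<and>
     (\<forall>\<omega>\<in>space M. sets (N \<omega>) = sets (borel :: (real \<times> real) measure)) \<and>
     (\<forall>A\<in>sets (borel :: (real \<times> real) measure).
         (\<lambda>\<omega>. emeasure (N \<omega>) A) \<in> borel_measurable M) \<and>
     (\<forall>A\<in>sets (borel :: (real \<times> real) measure).
         emeasure lborel (A \<inter> quadrant) < \<infinity> \<longrightarrow>
         (\<forall>k::nat. measure M {\<omega>\<in>space M. emeasure (N \<omega>) A = of_nat k}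
             = exp (- measure lborel (A \<inter> quadrant))
               * measure lborel (A \<inter> quadrant) ^ k / fact k)) \<and>
     (\<forall>(n::nat) (A :: nat \<Rightarrow> (real \<times> real) set).
         (\<forall>i<n. A i \<in> sets borel) \<longrightarrow> disjoint_family_on A {..<n} \<longrightarrow>
         prob_space.indep_vars M (\<lambda>_. borel) (\<lambda>i \<omega>. emeasure (N \<omega>) (A i)) {..<n})"

text \<open>Convolution powers: Phi_n 1 = Phi, Phi_n (n+1) t = int_0^t Phi(t-s) Phi_n n s ds
  (Phi_n 0 = 0 is a dummy, so that the sum over all n is the sum over n >= 1).\<close>
fun Phi_n :: "(real \<Rightarrow> real) \<Rightarrow> nat \<Rightarrow> real \<Rightarrow> ennreal" where
  "Phi_n \<Phi> 0 t = 0"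
| "Phi_n \<Phi> (Suc n) t =
     (if n = 0 then ennreal (\<Phi> t)
      else (\<integral>\<^sup>+ s\<in>{0..t}. ennreal (\<Phi> (t - s)) * Phi_n \<Phi> n s \<partial>lborel))"

definition Psi :: "(real \<Rightarrow> real) \<Rightarrow> real \<Rightarrow> ennreal" where
  "Psi \<Phi> t = (\<Sum>n. Phi_n \<Phi> n t)"

definition hawkesX ::
  "('a \<Rightarrow> (real \<times> real) measure) \<Rightarrow> (real \<Rightarrow> 'a \<Rightarrow> real) \<Rightarrow> (real \<Rightarrow> real)
     \<Rightarrow> real \<Rightarrow> 'a \<Rightarrow> ennreal" where
  "hawkesX N lam \<zeta> t \<omega> =
     (\<integral>\<^sup>+ p. indicator ({0<..<t} \<times> {0..}) p * ennreal (\<zeta> (t - fst p))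
              * indicator {q. snd q \<le> lam (fst q) \<omega>} p \<partial>(N \<omega>))"

end

theory Submission
  imports Defs
begin

text \<open>
  Everything is computed with nonnegative extended reals, so that no integrability of \<open>H\<^sub>t\<close> has to be
  established and no martingale is subtracted. Independence of the restrictions of \<open>N\<close> to the past
  and to the future gives the compensation formula \<open>E \<integral> f dN = E \<integral> f dt d\<theta>\<close> for predictable \<open>f \<ge> 0\<close>.
  Let \<open>\<lambda>\<^sup>0 = \<mu>\<close> and \<open>\<lambda>\<^sup>n\<^sup>+\<^sup>1\<^sub>t = \<mu> + \<integral> \<Phi>(t-s) 1{\<theta> \<le> \<lambda>\<^sup>n\<^sub>s} N(ds,d\<theta>)\<close> be the Picard iterates, and \<open>H\<^sup>n\<close> the
  process of the points below \<open>\<lambda>\<^sup>n\<close>. Splitting \<open>\<integral>f dH\<^sup>n \<integral>g dH\<^sup>m\<close> into the parts \<open>s < s'\<close>, \<open>s > s'\<close> and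
  \<open>s = s'\<close> (the last is \<open>\<integral>fg dH\<^sup>n\<^sup>\<and>\<^sup>m\<close>, since \<open>N\<close> a.s. has at most one point at a time) and applying the
  compensation formula to the later point replaces \<open>dH\<^sup>m\<close> by \<open>\<lambda>\<^sup>m ds\<close>, that is by an integral
  against \<open>H\<^sup>m\<^sup>-\<^sup>1\<close>. This recursion on \<open>n + m\<close> is solved by
  \<open>m\<^sub>n(f) m\<^sub>m(g) + \<Sum>\<^sub>i \<integral> (f + f * \<Psi>\<^sub>n\<^sub>-\<^sub>i)(g + g * \<Psi>\<^sub>m\<^sub>-\<^sub>i) \<mu>\<^sub>i\<close>, where \<open>\<mu>\<^sub>i\<close> is the mean intensity of the
  \<open>i\<close>-th generation and \<open>\<Psi>\<^sub>k\<close> the sum of the first \<open>k\<close> convolution powers of \<open>\<Phi>\<close>; the formulas follow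
  by monotone convergence. Finally any solution \<open>\<lambda>\<close> coincides a.s. with the limit of the iterates:
  as \<open>\<lambda>\<close> is finite, only finitely many points are accepted in bounded time, so there would be
  a first accepted point that the limit misses.
\<close>

section \<open>Poisson random measures\<close>

text \<open>The obstacle is that a solution \<open>lam\<close> is only given pathwise. It is
  measurable in \<omega> and in time separately, but nothing says that it depends on the past of
  \<open>N\<close> alone, so the compensation formula cannot be applied to it. The iterates are
  predictable by construction; all moments are computed for them, and pathwise uniqueness transfers
  the result. The closed form has a martingale origin. Give each point its own \<open>f\<close>
  value plus the mean \<open>f\<close> weight of its future descendants, that is f + f * Psi. The
  integral of f is then its mean plus a compensated Poisson integral of this weight, and the
  covariance of two such integrals is an integral against the mean intensity. In the n-th iterate a
  point of generation i has n - i generations of descendants left, whence the indices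
  \<open>n - i\<close> and \<open>m - i\<close>. Keeping both truncations gives an exact recursion
  between nonnegative quantities. The double integrals of the statement appear when one of the two
  weights is multiplied out.\<close>

lemma poisson_sums:
  fixes c :: real
  shows "(\<lambda>k. exp (- c) * c ^ k / fact k) sums 1"
    and "(\<lambda>k. real k * (exp (- c) * c ^ k / fact k)) sums c"
proof -
  have "(\<lambda>k. exp (- c) * (c ^ k /\<^sub>R fact k)) sums (exp (- c) * exp c)"
    by (intro sums_mult exp_converges)
  then show *: "(\<lambda>k. exp (- c) * c ^ k / fact k) sums 1"
    by (simp add: exp_minus_inverse field_simps)
  have eq: "real (Suc k) * (exp (- c) * c ^ Suc k / fact (Suc k)) = c * (exp (- c) * c ^ k / fact k)" for k
    by (simp add: field_simps del: of_nat_Suc)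
  then have "(\<lambda>k. real (Suc k) * (exp (- c) * c ^ Suc k / fact (Suc k))) sums (c * 1)"
    unfolding eq by (intro sums_mult *)
  then show "(\<lambda>k. real k * (exp (- c) * c ^ k / fact k)) sums c"
    by (subst (asm) sums_Suc_iff) simp
qed

text \<open>Time 0 is left out because \<open>hawkesX\<close> integrates over strictly positive
  times. The line at time 0 is Lebesgue null, so the intensity is the same as on the closed
  \<open>quadrant\<close>.\<close>

definition open_quadrant :: "(real \<times> real) set" where
  "open_quadrant = {0<..} \<times> {0..}"

text \<open>The boxes extend to minus infinity so that they exhaust the plane, while their intensity
  stays finite because only the quadrant carries mass. They localise every argument that has to
  subtract measures.\<close>

definition box_upto :: "nat \<Rightarrow> (real \<times> real) set" where
  "box_upto k = {..real k} \<times> {..real k}"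

definition quadrant_lebesgue :: "(real \<times> real) measure" where
  "quadrant_lebesgue = density lborel (indicator open_quadrant)"

lemma open_quadrant_sets[measurable]: "open_quadrant \<in> sets borel"
  unfolding open_quadrant_def by (simp add: borel_prod[symmetric])

lemma box_upto_sets[measurable]: "box_upto k \<in> sets borel"
  unfolding box_upto_def by (simp add: borel_prod[symmetric])

lemma quadrant_sets[measurable]: "quadrant \<in> sets borel"
  unfolding quadrant_def by (simp add: borel_prod[symmetric])

lemma box_upto_mono: "k \<le> l \<Longrightarrow> box_upto k \<subseteq> box_upto l"
  by (auto simp: box_upto_def)

lemma UN_box_upto: "(\<Union>k. box_upto k) = UNIV"
proof safe
  fix a b :: real
  obtain k where "max a b \<le> real k" using real_arch_simple by blast
  then show "(a, b) \<in> (\<Union>k. box_upto k)" by (auto simp: box_upto_def intro!: exI[of _ k])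
qed auto

lemma emeasure_lborel_Times:
  fixes A B :: "real set"
  assumes [measurable]: "A \<in> sets borel" "B \<in> sets borel"
  shows "emeasure lborel (A \<times> B) = emeasure lborel A * emeasure lborel B"
  unfolding lborel_prod[symmetric] by (rule lborel.emeasure_pair_measure_Times) auto

lemma sets_quadrant_lebesgue[simp, measurable_cong]: "sets quadrant_lebesgue = sets borel"
  by (simp add: quadrant_lebesgue_def)

lemma space_quadrant_lebesgue[simp]: "space quadrant_lebesgue = UNIV"
  by (simp add: quadrant_lebesgue_def)

lemma emeasure_quadrant_lebesgue:
  assumes [measurable]: "A \<in> sets borel"
  shows "emeasure quadrant_lebesgue A = emeasure lborel (A \<inter> open_quadrant)"
  unfolding quadrant_lebesgue_def
  by (simp add: emeasure_density indicator_inter_arith[symmetric] Int_commute)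

lemma emeasure_Int_quadrant:
  assumes [measurable]: "A \<in> sets borel"
  shows "emeasure lborel (A \<inter> quadrant) = emeasure quadrant_lebesgue A"
proof -
  have "emeasure lborel ({0::real} \<times> (UNIV::real set)) = 0"
    by (subst emeasure_lborel_Times) auto
  then have "AE x in lborel. x \<notin> {0::real} \<times> (UNIV::real set)"
    by (intro AE_not_in) (auto simp: null_sets_def borel_prod[symmetric])
  then have "emeasure lborel (A \<inter> quadrant) = emeasure lborel (A \<inter> open_quadrant)"
    using quadrant_sets open_quadrant_sets
    by (intro emeasure_eq_AE sets.Int) (auto simp: quadrant_def open_quadrant_def elim!: eventually_mono)
  then show ?thesis by (simp add: emeasure_quadrant_lebesgue)
qed

lemma emeasure_quadrant_lebesgue_box_upto: "emeasure quadrant_lebesgue (box_upto k) < \<infinity>"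
proof -
  have "box_upto k \<inter> open_quadrant = {0<..real k} \<times> {0..real k}"
    by (auto simp: box_upto_def open_quadrant_def)
  then show ?thesis
    by (simp add: emeasure_quadrant_lebesgue emeasure_lborel_Times ennreal_mult_less_top)
qed

locale poisson_prm =
  fixes M :: "'a measure" and N :: "'a \<Rightarrow> (real \<times> real) measure"
  assumes PRM: "poisson_random_measure M N"
begin

sublocale prob_space M using PRM by (simp add: poisson_random_measure_def)

lemma sets_N: "\<omega> \<in> space M \<Longrightarrow> sets (N \<omega>) = sets borel"
  using PRM by (simp add: poisson_random_measure_def)

lemma measurable_N[measurable]: "A \<in> sets borel \<Longrightarrow> (\<lambda>\<omega>. emeasure (N \<omega>) A) \<in> borel_measurable M"
  using PRM by (simp add: poisson_random_measure_def)

lemma prob_N: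
  assumes "A \<in> sets borel" "emeasure quadrant_lebesgue A = ennreal c" "0 \<le> c"
  shows "prob {\<omega>\<in>space M. emeasure (N \<omega>) A = of_nat k} = exp (- c) * c ^ k / fact k"
proof -
  have "emeasure lborel (A \<inter> quadrant) = ennreal c"
    using assms by (simp add: emeasure_Int_quadrant)
  moreover from this have "measure lborel (A \<inter> quadrant) = c"
    using assms by (simp add: measure_def)
  ultimately show ?thesis using PRM assms(1) unfolding poisson_random_measure_def by simp
qed

lemma indep_N:
  "(\<And>i. i < n \<Longrightarrow> A i \<in> sets borel) \<Longrightarrow> disjoint_family_on A {..<n} \<Longrightarrow>
     indep_vars (\<lambda>_. borel) (\<lambda>i \<omega>. emeasure (N \<omega>) (A i)) {..<n}" for n :: nat
  using PRM by (simp add: poisson_random_measure_def)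

text \<open>Only the probabilities of the values 0, 1, 2, ... are prescribed; as they add up to 1,
  every other value has probability zero.\<close>

lemma AE_N_nat:
  assumes [measurable]: "A \<in> sets borel" and fin: "emeasure quadrant_lebesgue A < \<infinity>"
  shows "AE \<omega> in M. \<exists>k::nat. emeasure (N \<omega>) A = of_nat k"
proof -
  obtain c where c: "emeasure quadrant_lebesgue A = ennreal c" "0 \<le> c"
    using fin by (metis enn2real_nonneg ennreal_enn2real infinity_ennreal_def)
  define E where "E k = {\<omega>\<in>space M. emeasure (N \<omega>) A = of_nat k}" for k :: nat
  have [measurable]: "E k \<in> events" for k unfolding E_def by measurable
  have d: "disjoint_family E"
    by (auto simp: disjoint_family_on_def E_def)
  have "(\<lambda>k. prob (E k)) sums prob (\<Union>k. E k)"
    by (intro finite_measure_UNION) (auto intro: d)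
  moreover have "(\<lambda>k. prob (E k)) sums 1"
    using poisson_sums(1)[of c] by (simp add: E_def prob_N[OF assms(1) c])
  ultimately have "prob (\<Union>k. E k) = 1" by (rule sums_unique2)
  then have "AE \<omega> in M. \<omega> \<in> (\<Union>k. E k)" by (rule AE_prob_1)
  then show ?thesis by (auto simp: E_def)
qed

lemma nn_integral_N:
  assumes [measurable]: "A \<in> sets borel" and fin: "emeasure quadrant_lebesgue A < \<infinity>"
  shows "(\<integral>\<^sup>+\<omega>. emeasure (N \<omega>) A \<partial>M) = emeasure quadrant_lebesgue A"
proof -
  obtain c where c: "emeasure quadrant_lebesgue A = ennreal c" "0 \<le> c"
    using fin by (metis enn2real_nonneg ennreal_enn2real infinity_ennreal_def)
  define E where "E k = {\<omega>\<in>space M. emeasure (N \<omega>) A = of_nat k}" for k :: nat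
  have [measurable]: "E k \<in> events" for k unfolding E_def by measurable
  have "(\<integral>\<^sup>+\<omega>. emeasure (N \<omega>) A \<partial>M) = (\<integral>\<^sup>+\<omega>. (\<Sum>k. of_nat k * indicator (E k) \<omega>) \<partial>M)"
  proof (rule nn_integral_cong_AE)
    show "AE \<omega> in M. emeasure (N \<omega>) A = (\<Sum>k. of_nat k * indicator (E k) \<omega>)"
      using AE_N_nat[OF assms] AE_space
    proof eventually_elim
      case (elim \<omega>)
      then obtain k :: nat where k: "emeasure (N \<omega>) A = of_nat k" by blast
      have "(\<Sum>j. of_nat j * indicator (E j) \<omega>) = (\<Sum>j\<in>{k}. of_nat j * indicator (E j) \<omega> :: ennreal)"
        using k elim by (intro suminf_finite) (auto simp: E_def indicator_def)
      then show ?case using k elim by (simp add: E_def)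
    qed
  qed
  also have "\<dots> = (\<Sum>k. of_nat k * emeasure M (E k))"
    by (subst nn_integral_suminf) (auto simp: nn_integral_cmult)
  also have "\<dots> = (\<Sum>k. ennreal (real k * (exp (- c) * c ^ k / fact k)))"
  proof (rule suminf_cong)
    fix k
    have "prob (E k) = exp (- c) * c ^ k / fact k" unfolding E_def by (rule prob_N[OF assms(1) c])
    then show "of_nat k * emeasure M (E k) = ennreal (real k * (exp (- c) * c ^ k / fact k))"
      using c(2) by (simp only: emeasure_eq_measure ennreal_of_nat_eq_real_of_nat) (simp add: ennreal_mult[symmetric])
  qed
  also have "\<dots> = ennreal c"
    using poisson_sums(2)[of c] c(2) by (intro sums_unique[symmetric]) (simp add: sums_ennreal)
  finally show ?thesis using c by simp
qed

text \<open>Independence is postulated for disjoint sets, whereas an event of the past may involve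
  overlapping sets \<open>A i\<close>. The remedy is to pass to the atoms of the algebra they
  generate: each count of an \<open>A i\<close> is a finite sum of atom counts, and the atoms
  together with \<open>B\<close> form a disjoint family.\<close>

lemma N_indep_mean:
  fixes n :: nat and C :: "nat \<Rightarrow> ennreal set"
  assumes A: "\<And>i. i < n \<Longrightarrow> A i \<in> sets borel" and C: "\<And>i. i < n \<Longrightarrow> C i \<in> sets borel"
    and AB: "\<And>i. i < n \<Longrightarrow> A i \<inter> B = {}"
    and B[measurable]: "B \<in> sets borel" and fin: "emeasure quadrant_lebesgue B < \<infinity>"
  defines "E \<equiv> {\<omega>\<in>space M. \<forall>i<n. emeasure (N \<omega>) (A i) \<in> C i}"
  shows "E \<in> events"
    and "(\<integral>\<^sup>+\<omega>. indicator E \<omega> * emeasure (N \<omega>) B \<partial>M) = emeasure M E * emeasure quadrant_lebesgue B"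
proof -
  show [measurable]: "E \<in> events" unfolding E_def using A C by measurable
  define m where "m = card (Pow {..<n})"
  obtain e where e: "bij_betw e {..<m} (Pow {..<n})"
    unfolding m_def using ex_bij_betw_nat_finite[of "Pow {..<n}"] by (auto simp: atLeast0LessThan)
  define atom where "atom S = (\<Inter>i\<in>S. A i) \<inter> (\<Inter>i\<in>{..<n}-S. - A i)" for S
  \<comment> \<open>Index \<open>m\<close> carries \<open>B\<close>. The atom of the empty index set
    is the complement of all \<open>A i\<close> and could meet \<open>B\<close>; it contributes to
    none of the \<open>A i\<close> and is replaced by the empty set.\<close>
  define A' where "A' j = (if j = m then B else if e j = {} then {} else atom (e j))" for j
  have atom[measurable]: "atom S \<in> sets borel" if "S \<subseteq> {..<n}" for S
    unfolding atom_def using that A finite_subset[OF that]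
    by (cases "S = {}"; cases "{..<n} - S = {}")
       (auto intro!: sets.Int sets.finite_INT sets.compl_sets simp: Compl_eq_Diff_UNIV)
  have A': "A' j \<in> sets borel" if "j < Suc m" for j
    using that e by (auto simp: A'_def bij_betw_def intro!: atom)
  have dj: "disjoint_family_on A' {..<Suc m}"
  proof -
    have 1: "atom S \<inter> atom T = {}" if "S \<subseteq> {..<n}" "T \<subseteq> {..<n}" "S \<noteq> T" for S T
      using that unfolding atom_def by blast
    have 2: "atom S \<inter> B = {}" if "S \<subseteq> {..<n}" "S \<noteq> {}" for S
      using that AB unfolding atom_def by blast
    show ?thesis unfolding disjoint_family_on_def
    proof safe
      fix i j x assume ij: "i < Suc m" "j < Suc m" "i \<noteq> j" and x: "x \<in> A' i" "x \<in> A' j"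
      have ei: "e k \<subseteq> {..<n}" if "k < m" for k using e that by (auto simp: bij_betw_def)
      have "e i \<noteq> e j" if "i < m" "j < m" using e that ij by (auto simp: bij_betw_def inj_on_def)
      then show "x \<in> {}" using ij x 1[of "e i" "e j"] 2[of "e i"] 2[of "e j"] ei[of i] ei[of j]
        by (auto simp: A'_def split: if_splits)
    qed
  qed
  have ind: "indep_vars (\<lambda>_. borel) (\<lambda>j \<omega>. emeasure (N \<omega>) (A' j)) {..<Suc m}"
    by (rule indep_N[OF A' dj])
  have sum: "emeasure (N \<omega>) (A i) = (\<Sum>j\<in>{j. j < m \<and> i \<in> e j}. emeasure (N \<omega>) (A' j))"
    if "i < n" "\<omega> \<in> space M" for i \<omega>
  proof -
    have "A i = (\<Union>j\<in>{j. j < m \<and> i \<in> e j}. A' j)"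
    proof safe
      fix x assume x: "x \<in> A i"
      define S where "S = {l. l < n \<and> x \<in> A l}"
      have "S \<in> Pow {..<n}" by (auto simp: S_def)
      then obtain j where j: "j < m" "e j = S" using e unfolding bij_betw_def by (metis imageE lessThan_iff)
      moreover have "i \<in> S" using x that by (auto simp: S_def)
      moreover have "x \<in> atom S" by (auto simp: atom_def S_def)
      ultimately show "x \<in> (\<Union>j\<in>{j. j < m \<and> i \<in> e j}. A' j)"
        by (intro UN_I[of j]) (auto simp: A'_def)
    next
      fix x j assume "j < m" "i \<in> e j" "x \<in> A' j"
      then show "x \<in> A i" by (auto simp: A'_def atom_def split: if_splits)
    qed
    also have "emeasure (N \<omega>) \<dots> = (\<Sum>j\<in>{j. j < m \<and> i \<in> e j}. emeasure (N \<omega>) (A' j))"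
      using A' that dj by (intro sum_emeasure[symmetric])
        (auto simp: sets_N disjoint_family_on_def)
    finally show ?thesis .
  qed
  \<comment> \<open>\<open>h\<close> expresses the indicator of \<open>E\<close> through the atom
    counts. Grouping the independent counts into the atoms (\<open>False\<close>) and
    \<open>B\<close> (\<open>True\<close>) then makes this indicator independent of the count of
    \<open>B\<close>.\<close>
  define h :: "(nat \<Rightarrow> ennreal) \<Rightarrow> ennreal" where
    "h x = indicator {x. \<forall>i<n. (\<Sum>j\<in>{j. j < m \<and> i \<in> e j}. x j) \<in> C i} x" for x
  define K where "K b = (if b then {m} else {..<m})" for b
  define Y where "Y b x = (if b then x m else h x)" for b and x :: "nat \<Rightarrow> ennreal"
  have "indep_vars (\<lambda>b. PiM (K b) (\<lambda>_. borel)) (\<lambda>b \<omega>. restrict (\<lambda>j. emeasure (N \<omega>) (A' j)) (K b)) UNIV"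
    by (intro indep_vars_restrict[OF ind]) (auto simp: K_def disjoint_family_on_def)
  then have ind2: "indep_vars (\<lambda>_. borel) (\<lambda>b \<omega>. Y b (restrict (\<lambda>j. emeasure (N \<omega>) (A' j)) (K b))) UNIV"
  proof (rule indep_vars_compose2)
    fix b
    show "Y b \<in> borel_measurable (PiM (K b) (\<lambda>_. borel))"
    proof (cases b)
      case True
      then show ?thesis by (simp add: Y_def[abs_def] K_def)
    next
      case False
      have "(\<lambda>x. \<Sum>j\<in>{j. j < m \<and> i \<in> e j}. x j) \<in> borel_measurable (PiM {..<m} (\<lambda>_. borel :: ennreal measure))" for i
        by (intro borel_measurable_sum measurable_component_singleton) auto
      then have "h \<in> borel_measurable (PiM {..<m} (\<lambda>_. borel))"
        unfolding h_def[abs_def] using C by measurable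
      then show ?thesis using False by (simp add: Y_def[abs_def] K_def)
    qed
  qed
  have Y1: "Y False (restrict (\<lambda>j. emeasure (N \<omega>) (A' j)) (K False)) = indicator E \<omega>" if "\<omega> \<in> space M" for \<omega>
  proof -
    have "(\<Sum>j\<in>{j. j < m \<and> i \<in> e j}. (restrict (\<lambda>j. emeasure (N \<omega>) (A' j)) {..<m}) j)
        = emeasure (N \<omega>) (A i)" if "i < n" for i
      using that \<open>\<omega> \<in> space M\<close> by (subst sum) (auto intro!: sum.cong)
    then show ?thesis using that by (simp add: Y_def h_def E_def K_def indicator_def)
  qed
  have Y2: "Y True (restrict (\<lambda>j. emeasure (N \<omega>) (A' j)) (K True)) = emeasure (N \<omega>) B" for \<omega>
    by (simp add: Y_def K_def A'_def)
  have "(\<integral>\<^sup>+\<omega>. indicator E \<omega> * emeasure (N \<omega>) B \<partial>M)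
      = (\<integral>\<^sup>+\<omega>. (\<Prod>b\<in>UNIV. Y b (restrict (\<lambda>j. emeasure (N \<omega>) (A' j)) (K b))) \<partial>M)"
    by (intro nn_integral_cong) (simp add: UNIV_bool Y1 Y2)
  also have "\<dots> = (\<Prod>b\<in>UNIV. \<integral>\<^sup>+\<omega>. Y b (restrict (\<lambda>j. emeasure (N \<omega>) (A' j)) (K b)) \<partial>M)"
    by (rule indep_vars_nn_integral[OF _ ind2]) auto
  also have "\<dots> = (\<integral>\<^sup>+\<omega>. indicator E \<omega> \<partial>M) * (\<integral>\<^sup>+\<omega>. emeasure (N \<omega>) B \<partial>M)"
    by (simp add: UNIV_bool Y1 Y2 cong: nn_integral_cong)
  finally show "(\<integral>\<^sup>+\<omega>. indicator E \<omega> * emeasure (N \<omega>) B \<partial>M) = emeasure M E * emeasure quadrant_lebesgue B"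
    by (simp add: nn_integral_N[OF B fin])
qed

end

lemma sets_borel_Times[measurable]:
  fixes A B :: "real set"
  shows "A \<in> sets borel \<Longrightarrow> B \<in> sets borel \<Longrightarrow> A \<times> B \<in> sets borel"
  by (simp add: borel_prod[symmetric])

section \<open>Predictable processes and the compensation formula\<close>

context poisson_prm
begin

definition locally_finite_at :: "'a \<Rightarrow> bool" where
  "locally_finite_at \<omega> \<longleftrightarrow> \<omega> \<in> space M \<and> (\<forall>k. emeasure (N \<omega>) (box_upto k \<inter> open_quadrant) < \<infinity>)"

text \<open>Replacing \<open>N\<close> by zero on the null set where it is not locally finite makes every \<open>NN \<omega>\<close>
  \<open>\<sigma>\<close>-finite, so that Fubini applies pathwise.\<close>

definition NN :: "'a \<Rightarrow> (real \<times> real) measure" where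
  "NN \<omega> = (if locally_finite_at \<omega> then density (N \<omega>) (indicator open_quadrant) else null_measure borel)"

lemma sets_NN[simp, measurable_cong]: "sets (NN \<omega>) = sets borel"
  by (simp add: NN_def locally_finite_at_def sets_N)

lemma space_NN[simp]: "space (NN \<omega>) = UNIV"
  using sets_eq_imp_space_eq[OF sets_NN] by simp

lemma emeasure_NN:
  assumes "A \<in> sets borel" "locally_finite_at \<omega>"
  shows "emeasure (NN \<omega>) A = emeasure (N \<omega>) (A \<inter> open_quadrant)"
proof -
  have [measurable_cong]: "sets (N \<omega>) = sets borel"
    using assms by (simp add: locally_finite_at_def sets_N)
  note [measurable] = assms(1)
  show ?thesis using assms(2)
    by (simp add: NN_def emeasure_density indicator_inter_arith[symmetric] Int_commute)
qed

lemma NN_box_upto: "emeasure (NN \<omega>) (box_upto k) < \<infinity>"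
  by (cases "locally_finite_at \<omega>") (simp_all add: emeasure_NN, auto simp: locally_finite_at_def NN_def)

lemma NN_box_upto_Int: "emeasure (NN \<omega>) (box_upto k \<inter> A) < \<infinity>"
  using le_less_trans[OF emeasure_mono NN_box_upto, of "box_upto k \<inter> A" k \<omega>] by simp

lemma sigma_finite_NN: "sigma_finite_measure (NN \<omega>)"
proof
  show "\<exists>A. countable A \<and> A \<subseteq> sets (NN \<omega>) \<and> \<Union>A = space (NN \<omega>) \<and> (\<forall>a\<in>A. emeasure (NN \<omega>) a \<noteq> \<infinity>)"
    using NN_box_upto by (intro exI[of _ "range box_upto"]) (auto simp: UN_box_upto less_top)
qed

lemma AE_NN_quadrant: "AE p in NN \<omega>. p \<in> open_quadrant"
proof -
  have "emeasure (NN \<omega>) (- open_quadrant) = 0"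
    by (cases "locally_finite_at \<omega>") (simp add: emeasure_NN, simp add: NN_def)
  then have "- open_quadrant \<in> null_sets (NN \<omega>)" by (auto simp: null_sets_def)
  from AE_not_in[OF this] show ?thesis by simp
qed

lemma AE_locally_finite: "AE \<omega> in M. locally_finite_at \<omega>"
proof -
  have "AE \<omega> in M. \<forall>k. emeasure (N \<omega>) (box_upto k \<inter> open_quadrant) < \<infinity>"
    unfolding AE_all_countable
  proof
    fix k
    have "emeasure quadrant_lebesgue (box_upto k \<inter> open_quadrant) < \<infinity>"
      by (rule le_less_trans[OF emeasure_mono emeasure_quadrant_lebesgue_box_upto[of k]]) auto
    then have "AE \<omega> in M. \<exists>j::nat. emeasure (N \<omega>) (box_upto k \<inter> open_quadrant) = of_nat j"
      by (intro AE_N_nat) auto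
    then show "AE \<omega> in M. emeasure (N \<omega>) (box_upto k \<inter> open_quadrant) < \<infinity>"
      by eventually_elim (auto simp: of_nat_less_top)
  qed
  with AE_space show ?thesis by eventually_elim (simp add: locally_finite_at_def)
qed

lemma measurable_locally_finite[measurable]: "Measurable.pred M locally_finite_at"
  unfolding locally_finite_at_def[abs_def] by measurable

lemma measurable_NN[measurable]:
  assumes [measurable]: "A \<in> sets borel"
  shows "(\<lambda>\<omega>. emeasure (NN \<omega>) A) \<in> borel_measurable M"
proof -
  have "emeasure (NN \<omega>) A = (if locally_finite_at \<omega> then emeasure (N \<omega>) (A \<inter> open_quadrant) else 0)" for \<omega>
    by (simp add: emeasure_NN) (simp add: NN_def)
  then show ?thesis by simp
qed

text \<open>A generating family closed under intersection instead of the whole sigma-algebra of the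
  past: finitely many counts are what \<open>N_indep_mean\<close> can handle, and the Dynkin
  argument in \<open>compensation_sets\<close> supplies the rest.\<close>

definition past :: "real \<Rightarrow> 'a set set" where
  "past a = {{\<omega>\<in>space M. \<forall>x\<in>I. emeasure (NN \<omega>) (fst x) \<in> snd x} | I.
     finite I \<and> (\<forall>x\<in>I. fst x \<in> sets borel \<and> fst x \<subseteq> {..a} \<times> UNIV \<and> (snd x :: ennreal set) \<in> sets borel)}"

lemma past_mono: "a \<le> b \<Longrightarrow> past a \<subseteq> past b"
  unfolding past_def by fastforce

lemma past_Int:
  assumes "E \<in> past a" "F \<in> past a" shows "E \<inter> F \<in> past a"
proof -
  from assms obtain I J where I: "finite I" "\<forall>x\<in>I. fst x \<in> sets borel \<and> fst x \<subseteq> {..a} \<times> UNIV \<and> (snd x :: ennreal set) \<in> sets borel"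
    "E = {\<omega>\<in>space M. \<forall>x\<in>I. emeasure (NN \<omega>) (fst x) \<in> snd x}"
   and J: "finite J" "\<forall>x\<in>J. fst x \<in> sets borel \<and> fst x \<subseteq> {..a} \<times> UNIV \<and> (snd x :: ennreal set) \<in> sets borel"
    "F = {\<omega>\<in>space M. \<forall>x\<in>J. emeasure (NN \<omega>) (fst x) \<in> snd x}"
    unfolding past_def by blast
  show ?thesis unfolding past_def
    by (rule CollectI, rule exI[of _ "I \<union> J"]) (use I J in auto)
qed

lemma space_in_past: "space M \<in> past a"
  unfolding past_def by (rule CollectI, rule exI[of _ "{}"]) auto

lemma NN_in_past:
  "A \<in> sets borel \<Longrightarrow> A \<subseteq> {..a} \<times> UNIV \<Longrightarrow> C \<in> sets borel \<Longrightarrow> {\<omega>\<in>space M. emeasure (NN \<omega>) A \<in> C} \<in> past a"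
  unfolding past_def by (rule CollectI, rule exI[of _ "{(A, C)}"]) auto

lemma past_events: "E \<in> past a \<Longrightarrow> E \<in> events"
proof -
  assume "E \<in> past a"
  then obtain I where I: "finite I" "\<And>x. x \<in> I \<Longrightarrow> fst x \<in> sets borel \<and> (snd x :: ennreal set) \<in> sets borel"
    "E = {\<omega>\<in>space M. \<forall>x\<in>I. emeasure (NN \<omega>) (fst x) \<in> snd x}"
    unfolding past_def by blast
  have "{\<omega>\<in>space M. emeasure (NN \<omega>) (fst x) \<in> snd x} \<in> events" if "x \<in> I" for x
    using measurable_sets[OF measurable_NN, of "fst x" "snd x"] I(2)[OF that]
    by (simp add: vimage_def Int_def conj_commute)
  then have "{\<omega>\<in>space M. \<forall>x\<in>I. emeasure (NN \<omega>) (fst x) \<in> snd x} \<in> events"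
    using I(1) by (intro sets.sets_Collect_finite_All) auto
  then show ?thesis using I(3) by simp
qed

text \<open>Off the null set where \<open>N\<close> is not locally finite this is
  \<open>N_indep_mean\<close>: \<open>B\<close> starts strictly after time \<open>a\<close>, hence
  avoids every set that an event of \<open>past a\<close> looks at.\<close>

lemma NN_past_mean:
  assumes E: "E \<in> past a" and [measurable]: "B \<in> sets borel" and Ba: "B \<subseteq> {a<..} \<times> UNIV"
    and fin: "emeasure quadrant_lebesgue B < \<infinity>"
  shows "(\<integral>\<^sup>+\<omega>. indicator E \<omega> * emeasure (NN \<omega>) B \<partial>M) = emeasure M E * emeasure quadrant_lebesgue B"
proof -
  from E obtain I where I: "finite I" "\<forall>x\<in>I. fst x \<in> sets borel \<and> fst x \<subseteq> {..a} \<times> UNIV \<and> (snd x :: ennreal set) \<in> sets borel"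
    and EI: "E = {\<omega>\<in>space M. \<forall>x\<in>I. emeasure (NN \<omega>) (fst x) \<in> snd x}"
    unfolding past_def by blast
  obtain xs where xs: "set xs = I" using finite_list[OF I(1)] by blast
  define A where "A i = fst (xs ! i) \<inter> open_quadrant" for i
  define C where "C i = snd (xs ! i)" for i
  define E' where "E' = {\<omega>\<in>space M. \<forall>i<length xs. emeasure (N \<omega>) (A i) \<in> C i}"
  have mem: "i < length xs \<Longrightarrow> xs ! i \<in> I" for i using xs by auto
  have 1: "\<And>i. i < length xs \<Longrightarrow> A i \<in> sets borel" "\<And>i. i < length xs \<Longrightarrow> C i \<in> sets borel"
    using I(2) mem by (auto simp: A_def C_def)
  have 2: "\<And>i. i < length xs \<Longrightarrow> A i \<inter> (B \<inter> open_quadrant) = {}"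
    using I(2) mem Ba unfolding A_def by fastforce
  have q: "emeasure quadrant_lebesgue (B \<inter> open_quadrant) = emeasure quadrant_lebesgue B"
    by (simp add: emeasure_quadrant_lebesgue Int_assoc)
  have lf: "\<omega> \<in> E \<longleftrightarrow> \<omega> \<in> E'" if "locally_finite_at \<omega>" "\<omega> \<in> space M" for \<omega>
  proof -
    have "(\<forall>x\<in>I. emeasure (NN \<omega>) (fst x) \<in> snd x) \<longleftrightarrow> (\<forall>x\<in>I. emeasure (N \<omega>) (fst x \<inter> open_quadrant) \<in> snd x)"
      using I(2) that by (auto simp: emeasure_NN)
    also have "\<dots> \<longleftrightarrow> (\<forall>i<length xs. emeasure (N \<omega>) (A i) \<in> C i)"
      unfolding xs[symmetric] A_def C_def by (simp add: all_set_conv_all_nth)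
    finally show ?thesis using that by (simp add: EI E'_def)
  qed
  have [measurable]: "E' \<in> events"
    unfolding E'_def by (rule N_indep_mean(1)[OF 1 2]) (use fin q in auto)
  have [measurable]: "E \<in> events" by (rule past_events[OF E])
  have "(\<integral>\<^sup>+\<omega>. indicator E \<omega> * emeasure (NN \<omega>) B \<partial>M)
      = (\<integral>\<^sup>+\<omega>. indicator E' \<omega> * emeasure (N \<omega>) (B \<inter> open_quadrant) \<partial>M)"
  proof (rule nn_integral_cong_AE)
    show "AE \<omega> in M. indicator E \<omega> * emeasure (NN \<omega>) B = indicator E' \<omega> * emeasure (N \<omega>) (B \<inter> open_quadrant)"
      using AE_locally_finite AE_space
      by eventually_elim (simp add: emeasure_NN lf indicator_def)
  qed
  also have "\<dots> = emeasure M E' * emeasure quadrant_lebesgue (B \<inter> open_quadrant)"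
    unfolding E'_def by (rule N_indep_mean(2)[OF 1 2]) (use fin q in auto)
  also have "emeasure M E' = emeasure M E"
    using AE_locally_finite AE_space by (intro emeasure_eq_AE) (auto simp: lf elim!: eventually_elim2)
  finally show ?thesis by (simp add: q)
qed

text \<open>Events known at time \<open>a\<close> times sets of points strictly later than
  \<open>a\<close>. The mark belongs to the point, so processes in time alone enter as functions of
  \<open>fst z\<close> and \<open>fst (snd z)\<close>.\<close>

definition predictable_gen :: "('a \<times> real \<times> real) set set" where
  "predictable_gen = {E \<times> B | a E B. E \<in> past a \<and> B \<in> sets borel \<and> B \<subseteq> {a<..} \<times> UNIV}"

definition predictable :: "('a \<times> real \<times> real) measure" where
  "predictable = sigma (space M \<times> UNIV) predictable_gen"

lemma predictable_gen_Pow: "predictable_gen \<subseteq> Pow (space M \<times> UNIV)"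
  using past_events sets.sets_into_space unfolding predictable_gen_def by fastforce

lemma space_predictable[simp]: "space predictable = space M \<times> UNIV"
  unfolding predictable_def using predictable_gen_Pow by (rule space_measure_of)

lemma sets_predictable: "sets predictable = sigma_sets (space M \<times> UNIV) predictable_gen"
  unfolding predictable_def using predictable_gen_Pow by (rule sets_measure_of)

lemma predictable_genI:
  "E \<in> past a \<Longrightarrow> B \<in> sets borel \<Longrightarrow> B \<subseteq> {a<..} \<times> UNIV \<Longrightarrow> E \<times> B \<in> sets predictable"
  unfolding sets_predictable predictable_gen_def by (intro sigma_sets.Basic) blast

lemma Int_stable_predictable_gen: "Int_stable predictable_gen"
proof (rule Int_stableI)
  fix X Y assume "X \<in> predictable_gen" "Y \<in> predictable_gen"
  then obtain a E B b F C where X: "X = E \<times> B" "E \<in> past a" "B \<in> sets borel" "B \<subseteq> {a<..} \<times> UNIV"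
    and Y: "Y = F \<times> C" "F \<in> past b" "C \<in> sets borel" "C \<subseteq> {b<..} \<times> UNIV"
    unfolding predictable_gen_def by blast
  have "E \<inter> F \<in> past (max a b)"
    using past_mono[of a "max a b"] past_mono[of b "max a b"] X(2) Y(2) by (intro past_Int) auto
  moreover have "B \<inter> C \<subseteq> {max a b<..} \<times> UNIV" using X(4) Y(4) by fastforce
  moreover have "X \<inter> Y = (E \<inter> F) \<times> (B \<inter> C)" using X(1) Y(1) by blast
  ultimately show "X \<inter> Y \<in> predictable_gen" using X(3) Y(3) unfolding predictable_gen_def by blast
qed

lemma Pair_predictable[measurable]:
  assumes "\<omega> \<in> space M" shows "Pair \<omega> \<in> borel \<rightarrow>\<^sub>M predictable"
  unfolding predictable_def
proof (rule measurable_measure_of[OF predictable_gen_Pow])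
  fix y assume "y \<in> predictable_gen"
  then obtain E B where "y = E \<times> B" "B \<in> sets borel" unfolding predictable_gen_def by blast
  moreover have "Pair \<omega> -` (E \<times> B) = (if \<omega> \<in> E then B else {})" by auto
  ultimately show "Pair \<omega> -` y \<inter> space borel \<in> sets borel" by auto
qed (use assms in auto)

lemma sets_predictable_subset: "sets predictable \<subseteq> sets (M \<Otimes>\<^sub>M borel)"
proof -
  have "predictable_gen \<subseteq> sets (M \<Otimes>\<^sub>M borel)"
    using past_events unfolding predictable_gen_def by auto
  then have "sigma_sets (space (M \<Otimes>\<^sub>M borel)) predictable_gen \<subseteq> sets (M \<Otimes>\<^sub>M borel)"
    by (rule sets.sigma_sets_subset)
  then show ?thesis by (simp add: sets_predictable space_pair_measure)
qed

lemma measurable_predictable_pair: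
  fixes f :: "_ \<Rightarrow> ennreal"
  assumes "f \<in> borel_measurable predictable" shows "f \<in> borel_measurable (M \<Otimes>\<^sub>M borel)"
  using borel_measurable_subalgebra[OF sets_predictable_subset _ assms] by (simp add: space_pair_measure)

text \<open>A deterministic set need not lie after any fixed time; cutting it at the times
  \<open>- real n\<close> exhibits it as a countable union of generators.\<close>

lemma snd_predictable[measurable]: "snd \<in> predictable \<rightarrow>\<^sub>M borel"
proof (rule measurableI)
  fix A :: "(real \<times> real) set" assume A: "A \<in> sets borel"
  have "snd -` A \<inter> space predictable = (\<Union>n::nat. space M \<times> (A \<inter> {- real n<..} \<times> UNIV))"
  proof (intro equalityI subsetI)
    fix z assume z: "z \<in> snd -` A \<inter> space predictable"
    obtain w x y where wxy: "z = (w, x, y)" by (cases z) auto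
    obtain n :: nat where "- x < real n" using reals_Archimedean2 by blast
    with z show "z \<in> (\<Union>n. space M \<times> (A \<inter> {- real n<..} \<times> UNIV))"
      by (auto simp: wxy intro!: exI[of _ n])
  qed auto
  also have "\<dots> \<in> sets predictable"
    using A by (intro sets.countable_UN) (auto intro!: predictable_genI space_in_past sets.Int)
  finally show "snd -` A \<inter> space predictable \<in> sets predictable" .
qed simp

lemma vimage_Pair_predictable[measurable]:
  "C \<in> sets predictable \<Longrightarrow> \<omega> \<in> space M \<Longrightarrow> Pair \<omega> -` C \<in> sets borel"
  using measurable_sets[OF Pair_predictable] by simp

text \<open>On generators this is independence. The restriction to \<open>box_upto k\<close> makes
  the Dynkin induction possible: complements require subtraction, and inside a box both measures are
  finite, pathwise and in mean.\<close>

lemma compensation_sets: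
  assumes "C \<in> sets predictable"
  shows "(\<lambda>\<omega>. emeasure (NN \<omega>) (box_upto k \<inter> Pair \<omega> -` C)) \<in> borel_measurable M \<and>
    (\<lambda>\<omega>. emeasure quadrant_lebesgue (box_upto k \<inter> Pair \<omega> -` C)) \<in> borel_measurable M \<and>
    (\<integral>\<^sup>+\<omega>. emeasure (NN \<omega>) (box_upto k \<inter> Pair \<omega> -` C) \<partial>M)
      = (\<integral>\<^sup>+\<omega>. emeasure quadrant_lebesgue (box_upto k \<inter> Pair \<omega> -` C) \<partial>M)"
  using assms unfolding sets_predictable
proof (induction rule: sigma_sets_induct_disjoint[OF Int_stable_predictable_gen predictable_gen_Pow, consumes 1])
  case (1 A)
  then obtain a E B where A: "A = E \<times> B" "E \<in> past a" "B \<in> sets borel" "B \<subseteq> {a<..} \<times> UNIV"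
    unfolding predictable_gen_def by blast
  have [measurable]: "B \<in> sets borel" "E \<in> events" using A past_events by auto
  have eq: "emeasure \<nu> (box_upto k \<inter> Pair \<omega> -` A) = indicator E \<omega> * emeasure \<nu> (box_upto k \<inter> B)" for \<nu> :: "(real \<times> real) measure" and \<omega>
  proof -
    have "box_upto k \<inter> Pair \<omega> -` A = (if \<omega> \<in> E then box_upto k \<inter> B else {})" by (auto simp: A(1))
    then show ?thesis by (simp add: indicator_def)
  qed
  have "emeasure quadrant_lebesgue (box_upto k \<inter> B) < \<infinity>"
    by (rule le_less_trans[OF emeasure_mono emeasure_quadrant_lebesgue_box_upto[of k]]) auto
  then have "(\<integral>\<^sup>+\<omega>. indicator E \<omega> * emeasure (NN \<omega>) (box_upto k \<inter> B) \<partial>M) = emeasure M E * emeasure quadrant_lebesgue (box_upto k \<inter> B)"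
    using A by (intro NN_past_mean) auto
  then show ?case unfolding eq by (simp add: nn_integral_multc)
next
  case 2
  then show ?case by simp
next
  case (3 A)
  then have A[measurable]: "A \<in> sets predictable" by (simp add: sets_predictable)
  let ?n = "\<lambda>\<omega>. emeasure (NN \<omega>) (box_upto k \<inter> Pair \<omega> -` A)"
  let ?q = "\<lambda>\<omega>. emeasure quadrant_lebesgue (box_upto k \<inter> Pair \<omega> -` A)"
  have qfin: "emeasure quadrant_lebesgue (box_upto k \<inter> S) \<noteq> \<infinity>" for S
    using le_less_trans[OF emeasure_mono emeasure_quadrant_lebesgue_box_upto[of k], of "box_upto k \<inter> S"] by auto
  have eq: "box_upto k \<inter> Pair \<omega> -` (space M \<times> UNIV - A) = box_upto k - (box_upto k \<inter> Pair \<omega> -` A)"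
    if "\<omega> \<in> space M" for \<omega>
    using that by auto
  have n: "emeasure (NN \<omega>) (box_upto k \<inter> Pair \<omega> -` (space M \<times> UNIV - A)) = emeasure (NN \<omega>) (box_upto k) - ?n \<omega>"
    if "\<omega> \<in> space M" for \<omega>
    unfolding eq[OF that] using NN_box_upto_Int[of \<omega> k "Pair \<omega> -` A"] that A by (intro emeasure_Diff) auto
  have q: "emeasure quadrant_lebesgue (box_upto k \<inter> Pair \<omega> -` (space M \<times> UNIV - A)) = emeasure quadrant_lebesgue (box_upto k) - ?q \<omega>"
    if "\<omega> \<in> space M" for \<omega>
    unfolding eq[OF that] using qfin that A by (intro emeasure_Diff) auto
  have [measurable]: "?n \<in> borel_measurable M" "?q \<in> borel_measurable M" and e: "integral\<^sup>N M ?n = integral\<^sup>N M ?q"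
    using 3 by auto
  have qle: "?q \<omega> \<le> emeasure quadrant_lebesgue (box_upto k)" for \<omega>
    by (intro emeasure_mono) auto
  \<comment> \<open>The complement is taken in the full box, whose own mean is therefore required.
    As all points have positive times, the box may be cut at time -1, where the certain event is a
    past event that \<open>NN_past_mean\<close> accepts.\<close>
  have tot: "(\<integral>\<^sup>+\<omega>. emeasure (NN \<omega>) (box_upto k) \<partial>M) = (\<integral>\<^sup>+\<omega>. emeasure quadrant_lebesgue (box_upto k) \<partial>M)"
  proof -
    have "emeasure quadrant_lebesgue (box_upto k \<inter> {- 1<..} \<times> UNIV) < \<infinity>" using qfin[of "{- 1<..} \<times> UNIV"] by (simp add: less_top)
    then have "(\<integral>\<^sup>+\<omega>. indicator (space M) \<omega> * emeasure (NN \<omega>) (box_upto k \<inter> {- 1<..} \<times> UNIV) \<partial>M)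
        = emeasure M (space M) * emeasure quadrant_lebesgue (box_upto k \<inter> {- 1<..} \<times> UNIV)"
      by (intro NN_past_mean[where a="-1"]) (auto intro: space_in_past)
    moreover have "emeasure (NN \<omega>) (box_upto k \<inter> {- 1<..} \<times> UNIV) = emeasure (NN \<omega>) (box_upto k)" for \<omega>
      using AE_NN_quadrant[of \<omega>]
      by (intro emeasure_eq_AE) (auto simp: open_quadrant_def elim!: eventually_mono)
    moreover have "box_upto k \<inter> {- 1<..} \<times> UNIV \<inter> open_quadrant = box_upto k \<inter> open_quadrant"
      by (auto simp: open_quadrant_def)
    ultimately show ?thesis
      by (simp add: emeasure_quadrant_lebesgue emeasure_space_1 cong: nn_integral_cong)
  qed
  have qint: "integral\<^sup>N M ?q \<noteq> \<infinity>"
  proof -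
    have "integral\<^sup>N M ?q \<le> (\<integral>\<^sup>+\<omega>. emeasure quadrant_lebesgue (box_upto k) \<partial>M)"
      by (intro nn_integral_mono qle)
    also have "\<dots> < \<infinity>" using emeasure_quadrant_lebesgue_box_upto[of k] by (simp add: emeasure_space_1)
    finally show ?thesis by simp
  qed
  have "(\<integral>\<^sup>+\<omega>. emeasure (NN \<omega>) (box_upto k) - ?n \<omega> \<partial>M) = (\<integral>\<^sup>+\<omega>. emeasure (NN \<omega>) (box_upto k) \<partial>M) - integral\<^sup>N M ?n"
    using qint e by (intro nn_integral_diff) (auto intro!: emeasure_mono)
  moreover have "(\<integral>\<^sup>+\<omega>. emeasure quadrant_lebesgue (box_upto k) - ?q \<omega> \<partial>M) = (\<integral>\<^sup>+\<omega>. emeasure quadrant_lebesgue (box_upto k) \<partial>M) - integral\<^sup>N M ?q"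
    using qint qle by (intro nn_integral_diff) auto
  ultimately show ?case
    using e tot by (simp add: n q cong: nn_integral_cong measurable_cong)
next
  case (4 A)
  then have A: "A i \<in> sets predictable" for i by (auto simp: sets_predictable)
  have eq: "box_upto k \<inter> Pair \<omega> -` (\<Union>i. A i) = (\<Union>i. box_upto k \<inter> Pair \<omega> -` A i)" for \<omega> by auto
  have d: "disjoint_family (\<lambda>i. box_upto k \<inter> Pair \<omega> -` A i)" for \<omega>
    using 4(1) unfolding disjoint_family_on_def by blast
  have n: "emeasure \<nu> (box_upto k \<inter> Pair \<omega> -` (\<Union>i. A i)) = (\<Sum>i. emeasure \<nu> (box_upto k \<inter> Pair \<omega> -` A i))"
    if "\<omega> \<in> space M" "sets \<nu> = sets borel" for \<omega> and \<nu> :: "(real \<times> real) measure"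
    unfolding eq using that A by (intro suminf_emeasure[symmetric] d) auto
  have m: "\<And>i. (\<lambda>\<omega>. emeasure (NN \<omega>) (box_upto k \<inter> Pair \<omega> -` A i)) \<in> borel_measurable M"
    "\<And>i. (\<lambda>\<omega>. emeasure quadrant_lebesgue (box_upto k \<inter> Pair \<omega> -` A i)) \<in> borel_measurable M"
    and e: "\<And>i. (\<integral>\<^sup>+\<omega>. emeasure (NN \<omega>) (box_upto k \<inter> Pair \<omega> -` A i) \<partial>M)
      = (\<integral>\<^sup>+\<omega>. emeasure quadrant_lebesgue (box_upto k \<inter> Pair \<omega> -` A i) \<partial>M)"
    using 4(3) by auto
  show ?case
    using m e by (simp add: n nn_integral_suminf cong: nn_integral_cong measurable_cong)
qed

lemma SUP_box_upto:
  fixes \<nu> :: "(real \<times> real) measure"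
  assumes "sets \<nu> = sets borel" "A \<in> sets borel"
  shows "emeasure \<nu> A = (SUP k. emeasure \<nu> (box_upto k \<inter> A))"
proof -
  have "(SUP k. emeasure \<nu> (box_upto k \<inter> A)) = emeasure \<nu> (\<Union>k. box_upto k \<inter> A)"
    using assms box_upto_mono by (intro SUP_emeasure_incseq) (auto simp: incseq_def)
  also have "(\<Union>k. box_upto k \<inter> A) = A" using UN_box_upto by auto
  finally show ?thesis ..
qed

lemma compensation:
  assumes "f \<in> borel_measurable predictable"
  shows "(\<lambda>\<omega>. \<integral>\<^sup>+p. f (\<omega>, p) \<partial>NN \<omega>) \<in> borel_measurable M"
    and "(\<integral>\<^sup>+\<omega>. \<integral>\<^sup>+p. f (\<omega>, p) \<partial>NN \<omega> \<partial>M) = (\<integral>\<^sup>+\<omega>. \<integral>\<^sup>+p. f (\<omega>, p) \<partial>quadrant_lebesgue \<partial>M)"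
proof -
  let ?n = "\<lambda>f \<omega>. \<integral>\<^sup>+p. f (\<omega>, p) \<partial>NN \<omega>"
  let ?q = "\<lambda>f \<omega>. \<integral>\<^sup>+p. f (\<omega>, p) \<partial>quadrant_lebesgue"
  have "?n f \<in> borel_measurable M \<and> ?q f \<in> borel_measurable M \<and> integral\<^sup>N M (?n f) = integral\<^sup>N M (?q f)"
    using assms
  proof induction
    case (cong f g)
    have "?n f \<omega> = ?n g \<omega>" "?q f \<omega> = ?q g \<omega>" if "\<omega> \<in> space M" for \<omega>
      using cong(3) that by (auto intro!: nn_integral_cong)
    then show ?case using cong(4) by (simp cong: measurable_cong nn_integral_cong)
  next
    case (set A)
    have n: "?n (indicator A) \<omega> = (SUP k. emeasure (NN \<omega>) (box_upto k \<inter> Pair \<omega> -` A))"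
       and q: "?q (indicator A) \<omega> = (SUP k. emeasure quadrant_lebesgue (box_upto k \<inter> Pair \<omega> -` A))"
       if "\<omega> \<in> space M" for \<omega>
    proof -
      have [measurable]: "Pair \<omega> -` A \<in> sets borel" using set that by simp
      have "(\<lambda>p. indicator A (\<omega>, p)) = (indicator (Pair \<omega> -` A) :: _ \<Rightarrow> ennreal)" by (auto simp: indicator_def)
      then show "?n (indicator A) \<omega> = (SUP k. emeasure (NN \<omega>) (box_upto k \<inter> Pair \<omega> -` A))"
       "?q (indicator A) \<omega> = (SUP k. emeasure quadrant_lebesgue (box_upto k \<inter> Pair \<omega> -` A))"
        by (simp_all add: SUP_box_upto[symmetric])
    qed
    have m: "\<And>k. (\<lambda>\<omega>. emeasure (NN \<omega>) (box_upto k \<inter> Pair \<omega> -` A)) \<in> borel_measurable M"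
      "\<And>k. (\<lambda>\<omega>. emeasure quadrant_lebesgue (box_upto k \<inter> Pair \<omega> -` A)) \<in> borel_measurable M"
      and e: "\<And>k. (\<integral>\<^sup>+\<omega>. emeasure (NN \<omega>) (box_upto k \<inter> Pair \<omega> -` A) \<partial>M)
      = (\<integral>\<^sup>+\<omega>. emeasure quadrant_lebesgue (box_upto k \<inter> Pair \<omega> -` A) \<partial>M)"
      using compensation_sets[OF set] by auto
    have "integral\<^sup>N M (?n (indicator A)) = (SUP k. \<integral>\<^sup>+\<omega>. emeasure (NN \<omega>) (box_upto k \<inter> Pair \<omega> -` A) \<partial>M)"
    proof -
      have "integral\<^sup>N M (?n (indicator A)) = (\<integral>\<^sup>+\<omega>. (SUP k. emeasure (NN \<omega>) (box_upto k \<inter> Pair \<omega> -` A)) \<partial>M)"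
        by (intro nn_integral_cong n)
      also have "\<dots> = (SUP k. \<integral>\<^sup>+\<omega>. emeasure (NN \<omega>) (box_upto k \<inter> Pair \<omega> -` A) \<partial>M)"
        by (intro nn_integral_monotone_convergence_SUP_AE m AE_I2 emeasure_mono Int_mono box_upto_mono)
          (use set in auto)
      finally show ?thesis .
    qed
    moreover have "integral\<^sup>N M (?q (indicator A)) = (SUP k. \<integral>\<^sup>+\<omega>. emeasure quadrant_lebesgue (box_upto k \<inter> Pair \<omega> -` A) \<partial>M)"
    proof -
      have "integral\<^sup>N M (?q (indicator A)) = (\<integral>\<^sup>+\<omega>. (SUP k. emeasure quadrant_lebesgue (box_upto k \<inter> Pair \<omega> -` A)) \<partial>M)"
        by (intro nn_integral_cong q)
      also have "\<dots> = (SUP k. \<integral>\<^sup>+\<omega>. emeasure quadrant_lebesgue (box_upto k \<inter> Pair \<omega> -` A) \<partial>M)"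
        by (intro nn_integral_monotone_convergence_SUP_AE m AE_I2 emeasure_mono Int_mono box_upto_mono)
          (use set in auto)
      finally show ?thesis .
    qed
    ultimately show ?case using m e by (simp add: n q cong: measurable_cong)
  next
    case (mult u c)
    have [measurable]: "(\<lambda>p. u (\<omega>, p)) \<in> borel_measurable borel" if "\<omega> \<in> space M" for \<omega>
      using mult(2) that by measurable
    have "?n (\<lambda>x. c * u x) \<omega> = c * ?n u \<omega>" "?q (\<lambda>x. c * u x) \<omega> = c * ?q u \<omega>" if "\<omega> \<in> space M" for \<omega>
      using that by (auto intro!: nn_integral_cmult)
    moreover have [measurable]: "?n u \<in> borel_measurable M" "?q u \<in> borel_measurable M" using mult by auto
    ultimately show ?case using mult by (simp add: nn_integral_cmult cong: measurable_cong nn_integral_cong)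
  next
    case (add u v)
    have uv: "u \<in> borel_measurable predictable" "v \<in> borel_measurable predictable" using add by auto
    then have [measurable]: "(\<lambda>p. u (\<omega>, p)) \<in> borel_measurable borel" "(\<lambda>p. v (\<omega>, p)) \<in> borel_measurable borel" if "\<omega> \<in> space M" for \<omega>
      using that by measurable
    have "?n (\<lambda>x. v x + u x) \<omega> = ?n v \<omega> + ?n u \<omega>" "?q (\<lambda>x. v x + u x) \<omega> = ?q v \<omega> + ?q u \<omega>" if "\<omega> \<in> space M" for \<omega>
      using that by (auto intro!: nn_integral_add)
    moreover have [measurable]: "?n u \<in> borel_measurable M" "?q u \<in> borel_measurable M"
      "?n v \<in> borel_measurable M" "?q v \<in> borel_measurable M" using add by auto
    ultimately show ?case using add by (simp add: nn_integral_add cong: measurable_cong nn_integral_cong)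
  next
    case (seq U)
    have [measurable]: "(\<lambda>p. U i (\<omega>, p)) \<in> borel_measurable borel" if "\<omega> \<in> space M" for \<omega> i
      using seq that by measurable
    have inc: "U i x \<le> U j x" if "i \<le> j" for i j x using seq that by (auto dest!: incseqD intro: le_funD)
    have n: "?n (SUP i. U i) \<omega> = (SUP i. ?n (U i) \<omega>)" and q: "?q (SUP i. U i) \<omega> = (SUP i. ?q (U i) \<omega>)" if "\<omega> \<in> space M" for \<omega>
      unfolding SUP_apply using that
      by (auto intro!: nn_integral_monotone_convergence_SUP simp: incseq_def le_fun_def inc)
    have m: "\<And>i. ?n (U i) \<in> borel_measurable M" "\<And>i. ?q (U i) \<in> borel_measurable M"
      and e: "\<And>i. integral\<^sup>N M (?n (U i)) = integral\<^sup>N M (?q (U i))"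
      using seq by auto
    have "integral\<^sup>N M (?n (SUP i. U i)) = (\<integral>\<^sup>+\<omega>. (SUP i. ?n (U i) \<omega>) \<partial>M)" by (intro nn_integral_cong n)
    also have "\<dots> = (SUP i. integral\<^sup>N M (?n (U i)))"
      by (intro nn_integral_monotone_convergence_SUP m) (auto simp: incseq_def le_fun_def intro!: nn_integral_mono inc)
    also have "\<dots> = (SUP i. integral\<^sup>N M (?q (U i)))" by (simp add: e)
    also have "\<dots> = (\<integral>\<^sup>+\<omega>. (SUP i. ?q (U i) \<omega>) \<partial>M)"
      by (intro nn_integral_monotone_convergence_SUP[symmetric] m) (auto simp: incseq_def le_fun_def intro!: nn_integral_mono inc)
    also have "\<dots> = integral\<^sup>N M (?q (SUP i. U i))" by (intro nn_integral_cong q[symmetric])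
    finally have "integral\<^sup>N M (?n (SUP i. U i)) = integral\<^sup>N M (?q (SUP i. U i))" .
    moreover have "?n (SUP i. U i) \<in> borel_measurable M"
      by (subst measurable_cong[OF n]) (use m in auto)
    moreover have "?q (SUP i. U i) \<in> borel_measurable M"
      by (subst measurable_cong[OF q]) (use m in auto)
    ultimately show ?case by blast
  qed
  then show "?n f \<in> borel_measurable M" "integral\<^sup>N M (?n f) = integral\<^sup>N M (?q f)" by auto
qed

end

section \<open>Predictability of integrals over strictly earlier points\<close>

lemma fst_snd_borel[measurable]:
  "fst \<in> (borel :: (real \<times> real) measure) \<rightarrow>\<^sub>M borel" "snd \<in> (borel :: (real \<times> real) measure) \<rightarrow>\<^sub>M borel"
  by (simp_all add: borel_prod[symmetric])

lemma Pair_borel[measurable (raw)]: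
  fixes f g :: "'b \<Rightarrow> real"
  assumes [measurable]: "f \<in> borel_measurable K" "g \<in> borel_measurable K"
  shows "(\<lambda>x. (f x, g x)) \<in> K \<rightarrow>\<^sub>M borel"
  unfolding borel_prod[symmetric] by measurable

lemma nn_integral_quadrant_lebesgue:
  fixes f :: "real \<times> real \<Rightarrow> ennreal"
  assumes [measurable]: "f \<in> borel_measurable borel"
  shows "(\<integral>\<^sup>+p. f p \<partial>quadrant_lebesgue) = (\<integral>\<^sup>+v\<in>{0<..}. (\<integral>\<^sup>+\<theta>\<in>{0..}. f (v, \<theta>) \<partial>lborel) \<partial>lborel)"
proof -
  have "(\<integral>\<^sup>+p. f p \<partial>quadrant_lebesgue) = (\<integral>\<^sup>+p. indicator open_quadrant p * f p \<partial>(lborel \<Otimes>\<^sub>M lborel))"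
    unfolding quadrant_lebesgue_def lborel_prod by (simp add: nn_integral_density)
  also have "\<dots> = (\<integral>\<^sup>+v. \<integral>\<^sup>+\<theta>. indicator open_quadrant (v, \<theta>) * f (v, \<theta>) \<partial>lborel \<partial>lborel)"
    by (subst lborel.nn_integral_fst[symmetric]) (auto simp: lborel_prod)
  also have "\<dots> = (\<integral>\<^sup>+v. \<integral>\<^sup>+\<theta>. indicator {0<..} v * (f (v, \<theta>) * indicator {0..} \<theta>) \<partial>lborel \<partial>lborel)"
    by (intro nn_integral_cong) (auto simp: open_quadrant_def indicator_def)
  also have "\<dots> = (\<integral>\<^sup>+v\<in>{0<..}. (\<integral>\<^sup>+\<theta>\<in>{0..}. f (v, \<theta>) \<partial>lborel) \<partial>lborel)"
    by (intro nn_integral_cong) (auto simp: nn_integral_cmult mult.commute)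
  finally show ?thesis .
qed

lemma lessThan_eq_UN_atMost: "{..<t} = (\<Union>n. {..t - inverse (real (Suc n))})"
proof safe
  fix x assume "x < t"
  then obtain n where "inverse (real (Suc n)) < t - x" using reals_Archimedean[of "t - x"] by auto
  then show "x \<in> (\<Union>n. {..t - inverse (real (Suc n))})" by (auto intro!: exI[of _ n])
next
  fix x n assume "x \<le> t - inverse (real (Suc n))"
  moreover have "0 < inverse (real (Suc n))" by simp
  ultimately show "x < t" by linarith
qed

lemma atMost_eq_INT_lessThan: "{..t} = (\<Inter>n. {..<t + inverse (real (Suc n))})"
proof (intro equalityI subsetI)
  fix x assume x: "x \<in> (\<Inter>n. {..<t + inverse (real (Suc n))})"
  show "x \<in> {..t}"
  proof (rule ccontr)
    assume "x \<notin> {..t}"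
    then obtain n where "inverse (real (Suc n)) < x - t" using reals_Archimedean[of "x - t"] by auto
    moreover have "x < t + inverse (real (Suc n))" using x by blast
    ultimately show False by simp
  qed
next
  fix x assume x: "x \<in> {..t}"
  have "x < t + inverse (real (Suc n))" for n
  proof -
    have "0 < inverse (real (Suc n))" by simp
    with x show ?thesis unfolding atMost_iff by linarith
  qed
  then show "x \<in> (\<Inter>n. {..<t + inverse (real (Suc n))})" by simp
qed

text \<open>This is how acceptance turns into intensity: integrating out the mark leaves the level
  \<open>l\<close>. The infinite case is included because the iterates are not known to be
  finite.\<close>

lemma emeasure_ennreal_le: "emeasure lborel ({0..} \<inter> {\<theta>. ennreal \<theta> \<le> l}) = l"
proof (cases l)
  case (real r)
  then have "{0..} \<inter> {\<theta>. ennreal \<theta> \<le> l} = {0..r}" by auto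
  then show ?thesis using real by simp
next
  case top
  then have *: "{0..} \<inter> {\<theta>. ennreal \<theta> \<le> l} = {0..}" by auto
  have "of_nat n \<le> emeasure lborel {0::real..}" for n :: nat
  proof -
    have "emeasure lborel {0..real n} \<le> emeasure lborel {0::real..}" by (intro emeasure_mono) auto
    then show ?thesis by (simp add: ennreal_of_nat_eq_real_of_nat)
  qed
  then have "(SUP n. of_nat n) \<le> emeasure lborel {0::real..}" by (intro SUP_least) auto
  then show ?thesis using top by (simp only: *) (simp add: ennreal_SUP_of_nat_eq_top top_unique)
qed

context poisson_prm
begin

text \<open>The count before \<open>t\<close> is left-continuous in \<open>t\<close>, hence a
  supremum over rationals \<open>r\<close> below \<open>t\<close> of counts up to \<open>r\<close>.
  Each of these is known at time \<open>r\<close> and used only after \<open>r\<close>, which is the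
  shape of a generator.\<close>

lemma NN_before_predictable:
  assumes [measurable]: "B \<in> sets borel"
  shows "(\<lambda>z. emeasure (NN (fst z)) (B \<inter> {..<fst (snd z)} \<times> UNIV)) \<in> borel_measurable predictable"
proof -
  have sup: "emeasure (NN \<omega>) (B \<inter> {..<t} \<times> UNIV)
    = (SUP r::rat. indicator {of_rat r<..} t * emeasure (NN \<omega>) (B \<inter> {..of_rat r} \<times> UNIV))" for \<omega> t
  proof (rule antisym)
    have "emeasure (NN \<omega>) (B \<inter> {..<t} \<times> UNIV) = emeasure (NN \<omega>) (\<Union>n. B \<inter> {..t - inverse (real (Suc n))} \<times> UNIV)"
      by (subst lessThan_eq_UN_atMost) (intro arg_cong[where f="emeasure (NN \<omega>)"], auto)
    also have "\<dots> = (SUP n. emeasure (NN \<omega>) (B \<inter> {..t - inverse (real (Suc n))} \<times> UNIV))"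
    proof (rule SUP_emeasure_incseq[symmetric])
      show "incseq (\<lambda>n. B \<inter> {..t - inverse (real (Suc n))} \<times> (UNIV :: real set))"
      proof (rule incseq_SucI)
        fix n
        have "inverse (real (Suc (Suc n))) \<le> inverse (real (Suc n))" by (intro le_imp_inverse_le) auto
        then have "{..t - inverse (real (Suc n))} \<subseteq> {..t - inverse (real (Suc (Suc n)))}" by auto
        then show "B \<inter> {..t - inverse (real (Suc n))} \<times> UNIV \<subseteq> B \<inter> {..t - inverse (real (Suc (Suc n)))} \<times> (UNIV :: real set)"
          by (intro Int_mono Sigma_mono order_refl)
      qed
    qed auto
    also have "\<dots> \<le> (SUP r::rat. indicator {of_rat r<..} t * emeasure (NN \<omega>) (B \<inter> {..of_rat r} \<times> UNIV))"
    proof (rule SUP_mono)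
      fix n
      have "t - inverse (real (Suc n)) < t" by simp
      then obtain r where "t - inverse (real (Suc n)) < of_rat r" "of_rat r < t"
        using of_rat_dense by blast
      then show "\<exists>r\<in>UNIV. emeasure (NN \<omega>) (B \<inter> {..t - inverse (real (Suc n))} \<times> UNIV)
          \<le> indicator {of_rat r<..} t * emeasure (NN \<omega>) (B \<inter> {..of_rat r} \<times> UNIV)"
        by (intro bexI[of _ r]) (auto intro!: emeasure_mono)
    qed
    finally show "emeasure (NN \<omega>) (B \<inter> {..<t} \<times> UNIV) \<le> \<dots>" .
  next
    show "(SUP r::rat. indicator {of_rat r<..} t * emeasure (NN \<omega>) (B \<inter> {..of_rat r} \<times> UNIV))
      \<le> emeasure (NN \<omega>) (B \<inter> {..<t} \<times> UNIV)"
      by (intro SUP_least) (auto simp: indicator_def intro!: emeasure_mono)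
  qed
  have [measurable]: "(\<lambda>z. indicator {q<..} (fst (snd z)) * emeasure (NN (fst z)) (B \<inter> {..q} \<times> UNIV))
      \<in> borel_measurable predictable" for q
  proof (rule borel_measurableI_greater)
    fix c :: ennreal
    have "{z \<in> space predictable. c < indicator {q<..} (fst (snd z)) * emeasure (NN (fst z)) (B \<inter> {..q} \<times> UNIV)}
      = {\<omega>\<in>space M. emeasure (NN \<omega>) (B \<inter> {..q} \<times> UNIV) \<in> {c<..}} \<times> ({q<..} \<times> UNIV)"
      by (auto simp: indicator_def split: if_splits)
    also have "\<dots> \<in> sets predictable"
      by (intro predictable_genI[where a=q] NN_in_past) auto
    finally show "{z \<in> space predictable. c < indicator {q<..} (fst (snd z)) * emeasure (NN (fst z)) (B \<inter> {..q} \<times> UNIV)}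
      \<in> sets predictable" .
  qed
  show ?thesis unfolding sup by measurable
qed

text \<open>The extra real coordinate is the time of evaluation: a kernel such as \<phi> (t - u)
  depends on the present time and on an earlier point. On a product of a Borel set and a generator
  these two dependences separate.\<close>

lemma sets_borel_predictable:
  "sets (borel \<Otimes>\<^sub>M predictable :: (real \<times> 'a \<times> real \<times> real) measure)
    = sigma_sets (UNIV \<times> (space M \<times> UNIV)) {D \<times> G | D G. D \<in> sets borel \<and> G \<in> predictable_gen}"
proof -
  have "sets (borel \<Otimes>\<^sub>M predictable :: (real \<times> 'a \<times> real \<times> real) measure)
    = sets (sigma (space borel \<times> space predictable) {D \<times> G | D G. D \<in> sets borel \<and> G \<in> predictable_gen})"
  proof (rule sets_pair_eq)
    let ?C = "range (\<lambda>n::nat. space M \<times> ({- real n<..} \<times> (UNIV :: real set)))"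
    show "?C \<subseteq> predictable_gen"
    proof (rule image_subsetI)
      fix n :: nat
      show "space M \<times> ({- real n<..} \<times> (UNIV :: real set)) \<in> predictable_gen"
        unfolding predictable_gen_def
        by (rule CollectI, rule exI[of _ "- real n"], rule exI[of _ "space M"], rule exI[of _ "{- real n<..} \<times> UNIV"])
          (simp add: space_in_past)
    qed
    show "\<Union> ?C = space predictable"
    proof (intro equalityI subsetI)
      fix z assume z: "z \<in> space predictable"
      obtain w x y where wxy: "z = (w, x, y)" by (cases z) auto
      obtain n :: nat where "- x < real n" using reals_Archimedean2 by blast
      with z show "z \<in> \<Union> ?C" by (auto simp: wxy intro!: exI[of _ n])
    qed auto
    show "sets borel = sigma_sets (space borel) (sets (borel :: real measure))" 
      by (metis sets.sigma_sets_eq)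
    show "{UNIV} \<subseteq> sets (borel :: real measure)" by simp
  qed (use predictable_gen_Pow in \<open>auto simp: sets_predictable\<close>)
  also have "\<dots> = sigma_sets (UNIV \<times> (space M \<times> UNIV)) {D \<times> G | D G. D \<in> sets borel \<and> G \<in> predictable_gen}"
    using predictable_gen_Pow by (subst sets_measure_of) auto
  finally show ?thesis .
qed

lemma triple_measurable:
  assumes "\<omega> \<in> space M"
  shows "(\<lambda>p. (t, \<omega>, p)) \<in> borel \<rightarrow>\<^sub>M (borel \<Otimes>\<^sub>M predictable)"
  using Pair_predictable[OF assms] by measurable

lemma before_predictable_sets:
  assumes "C \<in> sets (borel \<Otimes>\<^sub>M predictable)"
  shows "(\<lambda>z. emeasure (NN (fst z)) (box_upto k \<inter> ({..<fst (snd z)} \<times> UNIV) \<inter> {p. (fst (snd z), fst z, p) \<in> C}))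
    \<in> borel_measurable predictable"
proof -
  let ?G = "{D \<times> G | D G. D \<in> sets (borel :: real measure) \<and> G \<in> predictable_gen}"
  let ?S = "\<lambda>C z. box_upto k \<inter> ({..<fst (snd z)} \<times> UNIV) \<inter> {p. (fst (snd z), fst z, p) \<in> C}"
  have I: "Int_stable ?G"
  proof (rule Int_stableI)
    fix X Y assume "X \<in> ?G" "Y \<in> ?G"
    then obtain D G D' G' where "X = D \<times> G" "Y = D' \<times> G'" "D \<in> sets borel" "D' \<in> sets borel"
      "G \<in> predictable_gen" "G' \<in> predictable_gen" by blast
    then show "X \<inter> Y \<in> ?G"
      using Int_stableD[OF Int_stable_predictable_gen, of G G']
      by (intro CollectI exI[of _ "D \<inter> D'"] exI[of _ "G \<inter> G'"]) auto
  qed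
  have P: "?G \<subseteq> Pow (UNIV \<times> (space M \<times> UNIV))" using predictable_gen_Pow by auto
  have secm: "{p. (t, \<omega>, p) \<in> A} \<in> sets borel" if "A \<in> sets (borel \<Otimes>\<^sub>M predictable)" "\<omega> \<in> space M" for A t \<omega>
    using measurable_sets[OF triple_measurable that(1), OF that(2), of t] by (simp add: vimage_def)
  show ?thesis
    using assms unfolding sets_borel_predictable
  proof (induction rule: sigma_sets_induct_disjoint[OF I P, consumes 1])
    case (1 A)
    then obtain D a E B where A: "A = D \<times> (E \<times> B)" "D \<in> sets borel" "E \<in> past a" "B \<in> sets borel" "B \<subseteq> {a<..} \<times> UNIV"
      unfolding predictable_gen_def by blast
    note [measurable] = A(2,4) NN_before_predictable
    have [measurable]: "E \<times> ({a<..} \<times> UNIV) \<in> sets predictable" using A by (intro predictable_genI) auto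
    have eq: "emeasure (NN (fst z)) (?S A z) = indicator D (fst (snd z)) * (indicator (E \<times> ({a<..} \<times> UNIV)) z
      * emeasure (NN (fst z)) (box_upto k \<inter> B \<inter> {..<fst (snd z)} \<times> UNIV))" for z
    proof (cases "fst (snd z) \<in> D \<and> z \<in> E \<times> ({a<..} \<times> UNIV)")
      case True
      then have "?S A z = box_upto k \<inter> B \<inter> {..<fst (snd z)} \<times> UNIV" by (auto simp: A(1))
      then show ?thesis using True by simp
    next
      case False
      then have "?S A z = {}" using A(5) by (fastforce simp: A(1) mem_Times_iff)
      then show ?thesis using False by (auto simp: indicator_def)
    qed
    show ?case unfolding eq by measurable
  next
    case 2
    then show ?case by simp
  next
    case (3 A)
    then have A: "A \<in> sets (borel \<Otimes>\<^sub>M predictable)" by (simp add: sets_borel_predictable)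
    have eq: "emeasure (NN (fst z)) (?S (UNIV \<times> (space M \<times> UNIV) - A) z)
      = emeasure (NN (fst z)) (box_upto k \<inter> {..<fst (snd z)} \<times> UNIV) - emeasure (NN (fst z)) (?S A z)"
      if "z \<in> space predictable" for z
    proof -
      have "?S (UNIV \<times> (space M \<times> UNIV) - A) z = box_upto k \<inter> {..<fst (snd z)} \<times> UNIV - ?S A z"
        using that by auto
      moreover have "emeasure (NN (fst z)) \<dots> = emeasure (NN (fst z)) (box_upto k \<inter> {..<fst (snd z)} \<times> UNIV) - emeasure (NN (fst z)) (?S A z)"
        using secm[OF A, of "fst z"] that NN_box_upto_Int[of "fst z" k]
        by (intro emeasure_Diff) (auto simp: Int_assoc less_top)
      ultimately show ?thesis by simp
    qed
    show ?case
      by (subst measurable_cong[OF eq]) (use 3(2) NN_before_predictable[of "box_upto k"] in simp_all)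
  next
    case (4 A)
    then have A: "A i \<in> sets (borel \<Otimes>\<^sub>M predictable)" for i by (auto simp: sets_borel_predictable)
    have eq: "emeasure (NN (fst z)) (?S (\<Union>i. A i) z) = (\<Sum>i. emeasure (NN (fst z)) (?S (A i) z))"
      if "z \<in> space predictable" for z
    proof -
      have "?S (\<Union>i. A i) z = (\<Union>i. ?S (A i) z)" by auto
      moreover have "(\<Sum>i. emeasure (NN (fst z)) (?S (A i) z)) = emeasure (NN (fst z)) (\<Union>i. ?S (A i) z)"
      proof (rule suminf_emeasure)
        show "range (\<lambda>i. ?S (A i) z) \<subseteq> sets (NN (fst z))" using secm[OF A] that by auto
        show "disjoint_family (\<lambda>i. ?S (A i) z)" using 4(1) unfolding disjoint_family_on_def by blast
      qed
      ultimately show ?thesis by simp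
    qed
    show ?case by (subst measurable_cong[OF eq]) (use 4(3) in simp_all)
  qed
qed

text \<open>The stability property behind the Picard scheme: it passes predictability from one
  iterate to the next, and it makes the inner integral predictable when a product of two stochastic
  integrals is written as an iterated one.\<close>

lemma integral_before_predictable:
  assumes "f \<in> borel_measurable (borel \<Otimes>\<^sub>M predictable)"
  shows "(\<lambda>z. \<integral>\<^sup>+p. indicator {..<fst (snd z)} (fst p) * f (fst (snd z), fst z, p) \<partial>NN (fst z)) \<in> borel_measurable predictable"
  using assms
proof induction
  case (cong f g)
  have eq: "(\<integral>\<^sup>+p. indicator {..<fst (snd z)} (fst p) * f (fst (snd z), fst z, p) \<partial>NN (fst z))
    = (\<integral>\<^sup>+p. indicator {..<fst (snd z)} (fst p) * g (fst (snd z), fst z, p) \<partial>NN (fst z))" if "z \<in> space predictable" for z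
    using that cong(3) by (intro nn_integral_cong) (auto simp: space_pair_measure)
  show ?case by (subst measurable_cong[OF eq]) (use cong(4) in simp_all)
next
  case (set A)
  have eq: "(\<integral>\<^sup>+p. indicator {..<fst (snd z)} (fst p) * indicator A (fst (snd z), fst z, p) \<partial>NN (fst z))
    = (SUP k. emeasure (NN (fst z)) (box_upto k \<inter> ({..<fst (snd z)} \<times> UNIV) \<inter> {p. (fst (snd z), fst z, p) \<in> A}))"
    if "z \<in> space predictable" for z
  proof -
    let ?B = "({..<fst (snd z)} \<times> UNIV) \<inter> {p. (fst (snd z), fst z, p) \<in> A}"
    have "{p. (fst (snd z), fst z, p) \<in> A} \<in> sets borel"
      using measurable_sets[OF triple_measurable set, of "fst z" "fst (snd z)"] that by (auto simp: vimage_def)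
    then have [measurable]: "?B \<in> sets borel" by auto
    have "(\<lambda>p. indicator {..<fst (snd z)} (fst p) * indicator A (fst (snd z), fst z, p)) = (indicator ?B :: _ \<Rightarrow> ennreal)"
      by (auto simp: indicator_def)
    then show ?thesis by (simp add: SUP_box_upto[of _ ?B] Int_assoc)
  qed
  show ?case by (subst measurable_cong[OF eq]) (use before_predictable_sets[OF set] in simp_all)
next
  case (mult u c)
  have [measurable]: "u \<in> borel_measurable (borel \<Otimes>\<^sub>M predictable)" using mult by auto
  have eq: "(\<integral>\<^sup>+p. indicator {..<fst (snd z)} (fst p) * (c * u (fst (snd z), fst z, p)) \<partial>NN (fst z))
    = c * (\<integral>\<^sup>+p. indicator {..<fst (snd z)} (fst p) * u (fst (snd z), fst z, p) \<partial>NN (fst z))" if "z \<in> space predictable" for z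
  proof -
    note [measurable] = triple_measurable[of "fst z"]
    have "fst z \<in> space M" using that by auto
    then show ?thesis by (subst nn_integral_cmult[symmetric]) (auto simp: mult.left_commute)
  qed
  show ?case by (subst measurable_cong[OF eq]) (use mult in simp_all)
next
  case (add u v)
  have [measurable]: "u \<in> borel_measurable (borel \<Otimes>\<^sub>M predictable)" "v \<in> borel_measurable (borel \<Otimes>\<^sub>M predictable)" using add by auto
  have eq: "(\<integral>\<^sup>+p. indicator {..<fst (snd z)} (fst p) * (v (fst (snd z), fst z, p) + u (fst (snd z), fst z, p)) \<partial>NN (fst z))
    = (\<integral>\<^sup>+p. indicator {..<fst (snd z)} (fst p) * v (fst (snd z), fst z, p) \<partial>NN (fst z))
      + (\<integral>\<^sup>+p. indicator {..<fst (snd z)} (fst p) * u (fst (snd z), fst z, p) \<partial>NN (fst z))" if "z \<in> space predictable" for z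
  proof -
    note [measurable] = triple_measurable[of "fst z"]
    have "fst z \<in> space M" using that by auto
    then show ?thesis by (subst nn_integral_add[symmetric]) (auto simp: distrib_left)
  qed
  show ?case by (subst measurable_cong[OF eq]) (use add in simp_all)
next
  case (seq U)
  have U[measurable]: "U i \<in> borel_measurable (borel \<Otimes>\<^sub>M predictable)" for i using seq by auto
  have inc: "U i x \<le> U j x" if "i \<le> j" for i j x using seq that by (auto dest!: incseqD intro: le_funD)
  have eq: "(\<integral>\<^sup>+p. indicator {..<fst (snd z)} (fst p) * (SUP i. U i) (fst (snd z), fst z, p) \<partial>NN (fst z))
    = (SUP i. \<integral>\<^sup>+p. indicator {..<fst (snd z)} (fst p) * U i (fst (snd z), fst z, p) \<partial>NN (fst z))" if "z \<in> space predictable" for z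
  proof -
    note [measurable] = triple_measurable[of "fst z"]
    have [simp]: "fst z \<in> space M" using that by auto
    show ?thesis unfolding SUP_apply SUP_mult_left_ennreal
      by (intro nn_integral_monotone_convergence_SUP) (auto simp: incseq_def le_fun_def intro!: mult_left_mono inc)
  qed
  show ?case by (subst measurable_cong[OF eq]) (use seq in simp_all)
qed

end

section \<open>Integer values and simplicity\<close>

text \<open>A count is an integer off a null set that depends on the set counted, and only countably
  many null sets may be discarded; hence a countable generator closed under intersection.\<close>

lemma sets_borel_eq_rat_rectangles:
  "sets (borel :: (real \<times> real) measure)
    = sigma_sets UNIV {{..of_rat q} \<times> {..of_rat r} | q r :: rat. True}" (is "_ = sigma_sets UNIV ?R")
proof
  interpret R: sigma_algebra UNIV "sigma_sets UNIV ?R" by (rule sigma_algebra_sigma_sets) auto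
  have eq: "{..(a, b)} = (\<Inter>q\<in>{q::rat. a < of_rat q}. \<Inter>r\<in>{r::rat. b < of_rat r}. {..of_rat q} \<times> {..of_rat r})"
    for a b :: real
  proof (intro equalityI subsetI)
    fix x assume x: "x \<in> (\<Inter>q\<in>{q::rat. a < of_rat q}. \<Inter>r\<in>{r::rat. b < of_rat r}. {..real_of_rat q} \<times> {..real_of_rat r})"
    obtain r0 q0 :: rat where 0: "b < of_rat r0" "a < of_rat q0"
      using of_rat_dense[of b "b + 1"] of_rat_dense[of a "a + 1"] by auto
    have "fst x \<le> a"
    proof (rule ccontr)
      assume "\<not> fst x \<le> a"
      then obtain q where "a < of_rat q" "of_rat q < fst x" using of_rat_dense[of a "fst x"] by auto
      then show False using x 0 by fastforce
    qed
    moreover have "snd x \<le> b"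
    proof (rule ccontr)
      assume "\<not> snd x \<le> b"
      then obtain q where "b < of_rat q" "of_rat q < snd x" using of_rat_dense[of b "snd x"] by auto
      then show False using x 0 by fastforce
    qed
    ultimately show "x \<in> {..(a, b)}" by (simp add: less_eq_prod_def)
  qed (auto simp: less_eq_prod_def)
  have rect: "{..of_rat q} \<times> {..of_rat r} \<in> sigma_sets UNIV ?R" for q r :: rat
    by (rule sigma_sets.Basic, rule CollectI, rule exI[of _ q], rule exI[of _ r]) simp
  have atMost: "{..(a, b)} \<in> sigma_sets UNIV ?R" for a b :: real
    unfolding eq by (intro R.countable_INT'' sigma_sets_top countableI_type rect)
  have "range (\<lambda>a. {..a}) \<subseteq> sigma_sets UNIV ?R"
  proof (rule image_subsetI)
    fix a :: "real \<times> real"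
    show "{..a} \<in> sigma_sets UNIV ?R" using atMost[of "fst a" "snd a"] by simp
  qed
  then have "sigma_sets UNIV (range (\<lambda>a::real\<times>real. {..a})) \<subseteq> sigma_sets UNIV ?R"
    by (rule R.sigma_sets_subset)
  then show "sets borel \<subseteq> sigma_sets UNIV ?R" by (subst borel_eq_atMost) simp
  have "sigma_sets (space borel) ?R \<subseteq> sets borel" by (intro sets.sigma_sets_subset) auto
  then show "sigma_sets UNIV ?R \<subseteq> sets borel" by simp
qed

lemma SUP_of_nat_bounded:
  fixes S :: "nat \<Rightarrow> nat"
  assumes "\<And>n. S n \<le> K"
  shows "\<exists>j. (SUP n. of_nat (S n) :: ennreal) = of_nat j"
proof -
  have "range S \<subseteq> {..K}" by (simp add: image_subset_iff assms)
  then have f: "finite (range S)" by (rule finite_subset) simp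
  then have "Max (range S) \<in> range S" by (rule Max_in) simp
  then obtain m where m: "S m = Max (range S)" by (metis rangeE)
  have "(SUP n. of_nat (S n) :: ennreal) = of_nat (S m)"
  proof (rule antisym)
    show "(SUP n. of_nat (S n) :: ennreal) \<le> of_nat (S m)"
      using Max_ge[OF f] by (intro SUP_least) (simp add: m)
    show "of_nat (S m) \<le> (SUP n. of_nat (S n) :: ennreal)" by (intro SUP_upper) simp
  qed
  then show ?thesis by blast
qed

text \<open>A measure with values in \<open>{0, 1}\<close> is a point mass, or zero; only its product with itself matters here.\<close>

lemma nn_integral_pair_zero_one:
  fixes \<nu> :: "(real \<times> real) measure"
  assumes s[measurable_cong]: "sets \<nu> = sets borel"
    and z: "\<And>A. A \<in> sets borel \<Longrightarrow> emeasure \<nu> A = 0 \<or> emeasure \<nu> A = 1"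
    and h: "h \<in> borel_measurable (borel \<Otimes>\<^sub>M borel)"
  shows "(\<integral>\<^sup>+p. \<integral>\<^sup>+q. h (p, q) \<partial>\<nu> \<partial>\<nu>) = (\<integral>\<^sup>+p. h (p, p) \<partial>\<nu>)"
proof -
  have sp: "space \<nu> = UNIV" using sets_eq_imp_space_eq[OF s] by simp
  have "emeasure \<nu> UNIV \<noteq> \<infinity>" using z[of UNIV] by auto
  then interpret finite_measure \<nu> by (intro finite_measureI) (simp add: sp)
  have m[measurable]: "(\<lambda>p. (p, p)) \<in> \<nu> \<rightarrow>\<^sub>M \<nu> \<Otimes>\<^sub>M \<nu>" by measurable
  have "\<nu> \<Otimes>\<^sub>M \<nu> = distr \<nu> (\<nu> \<Otimes>\<^sub>M \<nu>) (\<lambda>p. (p, p))"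
  proof (rule pair_measure_eqI)
    fix A B assume "A \<in> sets \<nu>" "B \<in> sets \<nu>"
    then have [measurable]: "A \<in> sets borel" "B \<in> sets borel" by (auto simp: s)
    have "emeasure \<nu> A * emeasure \<nu> B = emeasure \<nu> (A \<inter> B)"
    proof (cases "emeasure \<nu> B = 0")
      case True
      then show ?thesis using emeasure_mono[of "A \<inter> B" B \<nu>] by (simp add: s)
    next
      case False
      then have B: "emeasure \<nu> B = 1" using z[of B] by auto
      have "emeasure \<nu> UNIV = emeasure \<nu> B + emeasure \<nu> (- B)"
        using plus_emeasure[of B \<nu> "- B"] by (simp add: s)
      moreover have "emeasure \<nu> UNIV = 1"
        using z[of UNIV] B emeasure_mono[of B UNIV \<nu>] by (auto simp: s)
      ultimately have "emeasure \<nu> (- B) = 0" using B z[of "- B"] by auto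
      then have "emeasure \<nu> (A - B) = 0" using emeasure_mono[of "A - B" "- B" \<nu>] by (auto simp: s)
      then have "emeasure \<nu> A = emeasure \<nu> (A \<inter> B)"
        using plus_emeasure[of "A \<inter> B" \<nu> "A - B"] by (simp add: s Int_Diff_Un Int_Diff_disjoint)
      then show ?thesis by (simp add: B)
    qed
    moreover have "(\<lambda>p. (p, p)) -` (A \<times> B) = A \<inter> B" by auto
    ultimately show "emeasure \<nu> A * emeasure \<nu> B = emeasure (distr \<nu> (\<nu> \<Otimes>\<^sub>M \<nu>) (\<lambda>p. (p, p))) (A \<times> B)"
      by (subst emeasure_distr[OF m]) (auto simp: s sp)
  qed (auto intro: sigma_finite_measure_axioms)
  note eq = this
  have [measurable]: "h \<in> borel_measurable (\<nu> \<Otimes>\<^sub>M \<nu>)" 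
    using h by (simp cong: measurable_cong_sets add: s)
  have "(\<integral>\<^sup>+p. \<integral>\<^sup>+q. h (p, q) \<partial>\<nu> \<partial>\<nu>) = integral\<^sup>N (\<nu> \<Otimes>\<^sub>M \<nu>) h"
    by (rule nn_integral_fst) measurable
  also have "\<dots> = integral\<^sup>N (distr \<nu> (\<nu> \<Otimes>\<^sub>M \<nu>) (\<lambda>p. (p, p))) h" using eq by metis
  also have "\<dots> = (\<integral>\<^sup>+p. h (p, p) \<partial>\<nu>)" by (rule nn_integral_distr[OF m]) measurable
  finally show ?thesis .
qed

context poisson_prm
begin

definition integer_valued_at :: "'a \<Rightarrow> bool" where
  "integer_valued_at \<omega> \<longleftrightarrow> (\<forall>k. \<forall>A\<in>sets borel. \<exists>j::nat. emeasure (NN \<omega>) (box_upto k \<inter> A) = of_nat j)"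

text \<open>Almost surely all rational rectangles have integer counts simultaneously. For such a
  path the sets with an integer count inside a fixed box are closed under complements and disjoint
  unions, so they comprise all Borel sets.\<close>

lemma AE_integer_valued: "AE \<omega> in M. integer_valued_at \<omega>"
proof -
  have "AE \<omega> in M. \<forall>k. \<forall>q r :: rat. \<exists>j::nat. emeasure (N \<omega>) (box_upto k \<inter> {..of_rat q} \<times> {..of_rat r} \<inter> open_quadrant) = of_nat j"
    unfolding AE_all_countable
  proof (intro allI AE_N_nat)
    fix k and q r :: rat
    show "emeasure quadrant_lebesgue (box_upto k \<inter> {..of_rat q} \<times> {..of_rat r} \<inter> open_quadrant) < \<infinity>"
      by (rule le_less_trans[OF emeasure_mono emeasure_quadrant_lebesgue_box_upto[of k]]) auto
  qed auto
  then show ?thesis using AE_locally_finite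
  proof eventually_elim
    case (elim \<omega>)
    let ?R = "{{..of_rat q} \<times> {..of_rat r} | q r :: rat. True} :: (real \<times> real) set set"
    show ?case unfolding integer_valued_at_def
    proof (intro allI ballI)
      fix k A assume A: "A \<in> sets (borel :: (real \<times> real) measure)"
      let ?\<nu> = "\<lambda>A. emeasure (NN \<omega>) (box_upto k \<inter> A)"
      have R: "\<exists>j::nat. ?\<nu> ({..of_rat q} \<times> {..of_rat r}) = of_nat j" for q r :: rat
      proof -
        have "?\<nu> ({..of_rat q} \<times> {..of_rat r}) = emeasure (N \<omega>) (box_upto k \<inter> {..of_rat q} \<times> {..of_rat r} \<inter> open_quadrant)"
          by (rule emeasure_NN[OF _ elim(2)]) measurable
        then show ?thesis using elim(1) by presburger
      qed
      \<comment> \<open>The box acts as a rational rectangle. Its finite total \<open>K\<close> is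
        what complements are subtracted from and what bounds the partial sums over disjoint
        sets.\<close>
      have "box_upto k \<inter> {..of_rat (of_nat k)} \<times> {..of_rat (of_nat k)} = box_upto k"
        by (auto simp: box_upto_def)
      then obtain K :: nat where K: "emeasure (NN \<omega>) (box_upto k) = of_nat K" using R[of "of_nat k" "of_nat k"] by auto
      have I: "Int_stable ?R"
      proof (rule Int_stableI)
        fix a b assume "a \<in> ?R" "b \<in> ?R"
        then obtain q r q' r' :: rat where "a = {..of_rat q} \<times> {..of_rat r}" "b = {..of_rat q'} \<times> {..of_rat r'}" by blast
        moreover have "real_of_rat (min x y) = min (of_rat x) (of_rat y)" for x y
          by (simp add: min_def of_rat_less_eq)
        ultimately have "a \<inter> b = {..of_rat (min q q')} \<times> {..of_rat (min r r')}"
          by (simp add: Times_Int_Times)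
        then show "a \<inter> b \<in> ?R" by blast
      qed
      have P: "?R \<subseteq> Pow UNIV" by simp
      from A show "\<exists>j::nat. ?\<nu> A = of_nat j" unfolding sets_borel_eq_rat_rectangles
      proof (induction rule: sigma_sets_induct_disjoint[OF I P, consumes 1])
        case (1 A)
        then show ?case using R by auto
      next
        case 2
        then show ?case by (intro exI[of _ 0]) simp
      next
        case (3 A)
        then have [measurable]: "A \<in> sets borel" by (simp add: sets_borel_eq_rat_rectangles)
        obtain b where b: "?\<nu> A = of_nat b" using 3 by auto
        have "?\<nu> A \<le> of_nat K" unfolding K[symmetric] by (intro emeasure_mono) auto
        then have "b \<le> K" using b by simp
        have "box_upto k \<inter> (UNIV - A) = box_upto k - (box_upto k \<inter> A)" by auto
        then have "?\<nu> (UNIV - A) = emeasure (NN \<omega>) (box_upto k) - ?\<nu> A"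
          using b by (simp add: emeasure_Diff)
        also have "\<dots> = of_nat (K - b)"
          unfolding K b using \<open>b \<le> K\<close>
          by (simp add: ennreal_of_nat_eq_real_of_nat ennreal_minus of_nat_diff)
        finally show ?case by blast
      next
        case (4 A)
        then have [measurable]: "A i \<in> sets borel" for i by (auto simp: sets_borel_eq_rat_rectangles)
        obtain c where c: "\<And>i. ?\<nu> (A i) = of_nat (c i)" using 4(3) by metis
        have d: "disjoint_family (\<lambda>i. box_upto k \<inter> A i)"
          using 4(1) unfolding disjoint_family_on_def by blast
        have bd: "(\<Sum>i<n. c i) \<le> K" for n
        proof -
          have "of_nat (\<Sum>i<n. c i) = (\<Sum>i<n. ?\<nu> (A i))" by (simp add: c)
          also have "\<dots> = emeasure (NN \<omega>) (\<Union>i<n. box_upto k \<inter> A i)"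
            using d by (intro sum_emeasure) (auto simp: disjoint_family_on_def)
          also have "\<dots> \<le> of_nat K" unfolding K[symmetric] by (intro emeasure_mono) auto
          finally show ?thesis by (simp only: of_nat_le_iff)
        qed
        have "box_upto k \<inter> (\<Union>i. A i) = (\<Union>i. box_upto k \<inter> A i)" by auto
        then have "?\<nu> (\<Union>i. A i) = (\<Sum>i. ?\<nu> (A i))"
          using d by (simp add: suminf_emeasure image_subset_iff)
        also have "\<dots> = (SUP n. of_nat (\<Sum>i<n. c i))"
          by (simp add: c suminf_eq_SUP)
        finally show ?case using SUP_of_nat_bounded[of "\<lambda>n. \<Sum>i<n. c i", OF bd] by simp
      qed
    qed
  qed
qed

section \<open>No two points at the same time\<close>

definition strip :: "nat \<Rightarrow> nat \<Rightarrow> nat \<Rightarrow> (real \<times> real) set" where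
  "strip k r i = {real k * real i / real r <.. real k * (real i + 1) / real r} \<times> {0..real k}"

lemma strip_sets[measurable]: "strip k r i \<in> sets borel"
  unfolding strip_def by measurable

lemma strip_subset: "i < r \<Longrightarrow> strip k r i \<subseteq> box_upto k \<inter> open_quadrant"
proof -
  assume i: "i < r"
  have "real k * (real i + 1) / real r \<le> real k" 
  proof -
    have "real k * (real i + 1) \<le> real k * real r" using i by (intro mult_left_mono) auto
    then show ?thesis using i by (simp add: field_simps)
  qed
  moreover have "0 \<le> real k * real i / real r" by simp
  note le_less_trans[OF this]
  ultimately show ?thesis unfolding strip_def box_upto_def open_quadrant_def by auto
qed

lemma emeasure_strip: "i < r \<Longrightarrow> emeasure quadrant_lebesgue (strip k r i) = ennreal (real k ^ 2 / real r)"
proof -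
  assume i: "i < r"
  have "strip k r i \<inter> open_quadrant = strip k r i" using strip_subset[OF i, of k] by auto
  then have "emeasure quadrant_lebesgue (strip k r i) = ennreal (real k / real r) * ennreal (real k)"
    using i by (simp add: emeasure_quadrant_lebesgue) (simp add: strip_def emeasure_lborel_Times field_simps)
  then show ?thesis by (simp add: ennreal_mult[symmetric] power2_eq_square)
qed

lemma UN_strip:
  assumes "0 < r" shows "(\<Union>i<r. strip k r i) = box_upto k \<inter> open_quadrant"
proof (intro equalityI subsetI)
  fix p assume "p \<in> (\<Union>i<r. strip k r i)"
  then show "p \<in> box_upto k \<inter> open_quadrant" using strip_subset by blast
next
  fix p assume p: "p \<in> box_upto k \<inter> open_quadrant"
  obtain s \<theta> where s: "p = (s, \<theta>)" by (cases p)
  have b: "0 < s" "s \<le> real k" "0 \<le> \<theta>" "\<theta> \<le> real k" using p by (auto simp: s box_upto_def open_quadrant_def)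
  then have k: "0 < real k" by linarith
  \<comment> \<open>The strips are open on the left and closed on the right, so the index is one
    less than a ceiling.\<close>
  define c where "c = \<lceil>s * real r / real k\<rceil>"
  have pos: "0 < s * real r / real k" using b k assms by simp
  have c0: "0 < c" unfolding c_def using pos by simp
  have c1: "s * real r / real k \<le> c" "c < s * real r / real k + 1" unfolding c_def by linarith+
  have "s * real r / real k \<le> real r" using b k assms by (simp add: field_simps)
  then have cr: "c \<le> int r" unfolding c_def by (simp add: ceiling_le_iff)
  define i where "i = nat (c - 1)"
  have i: "real i = of_int c - 1" using c0 by (simp add: i_def)
  have "i < r" using c0 cr by (simp add: i_def)
  moreover have "real k * real i / real r < s"
  proof -
    have "real i < s * real r / real k" using c1(2) i by simp
    then show ?thesis using k assms by (simp add: field_simps)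
  qed
  moreover have "s \<le> real k * (real i + 1) / real r"
    using c1(1) k assms by (simp add: i field_simps)
  ultimately show "p \<in> (\<Union>i<r. strip k r i)" using b by (auto simp: s strip_def)
qed

lemma strip_fst_disjoint:
  assumes "p \<in> strip k r i" "q \<in> strip k r j" "fst p = fst q" "0 < r" shows "i = j"
proof -
  have l: "a \<le> b" if "real k * real a / real r < x" "x \<le> real k * (real b + 1) / real r" for a b x
  proof -
    have "real k * real a < real k * (real b + 1)"
      using less_le_trans[OF that] assms(4) by (simp add: divide_less_cancel)
    then have "real a < real b + 1" by (simp add: mult_less_cancel_left)
    then show ?thesis by linarith
  qed
  show ?thesis using l[of i "fst p" j] l[of j "fst p" i] assms by (auto simp: strip_def)
qed

text \<open>Removing the probabilities of 0 and 1 leaves 1 - exp (- c) (1 + c), and exp (- c) is at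
  least 1 - c. The quadratic order is what matters: it beats the number of strips.\<close>

lemma prob_ge_2:
  assumes [measurable]: "A \<in> sets borel" and A: "emeasure quadrant_lebesgue A = ennreal c" "0 \<le> c"
  shows "prob {\<omega>\<in>space M. \<not> emeasure (N \<omega>) A \<le> 1} \<le> c ^ 2"
proof -
  define E where "E k = {\<omega>\<in>space M. emeasure (N \<omega>) A = of_nat k}" for k :: nat
  have [measurable]: "E k \<in> events" for k unfolding E_def by measurable
  have "prob {\<omega>\<in>space M. \<not> emeasure (N \<omega>) A \<le> 1} \<le> prob (space M - (E 0 \<union> E 1))"
    by (intro finite_measure_mono) (auto simp: E_def)
  also have "\<dots> = 1 - prob (E 0 \<union> E 1)" by (subst prob_compl) auto
  also have "prob (E 0 \<union> E 1) = prob (E 0) + prob (E 1)"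
    by (intro finite_measure_Union) (auto simp: E_def)
  also have "prob (E 0) = exp (- c)" using prob_N[OF assms, of 0] by (simp add: E_def)
  also have "prob (E 1) = exp (- c) * c" using prob_N[OF assms, of 1] by (simp add: E_def)
  also have "1 - (exp (- c) + exp (- c) * c) = 1 - exp (- c) * (1 + c)" by (simp add: algebra_simps)
  also have "\<dots> \<le> 1 - (1 - c) * (1 + c)"
    using exp_ge_add_one_self[of "- c"] A(2) by (intro diff_left_mono mult_right_mono) auto
  also have "\<dots> = c ^ 2" by (simp add: power2_eq_square algebra_simps)
  finally show ?thesis .
qed

text \<open>Each of the r strips has intensity k^2/r, so by \<open>prob_ge_2\<close> some strip
  holds two points with probability at most r times (k^2/r)^2, that is k^4/r, which tends to
  0.\<close>

lemma AE_strips: "AE \<omega> in M. \<forall>k. \<exists>r>0. \<forall>i<r. emeasure (NN \<omega>) (strip k r i) \<le> 1"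
proof -
  have "AE \<omega> in M. \<exists>r>0. \<forall>i<r. emeasure (N \<omega>) (strip k r i) \<le> 1" for k
  proof -
    define B where "B r = {\<omega>\<in>space M. \<exists>i<r. \<not> emeasure (N \<omega>) (strip k r i) \<le> 1}" for r
    have [measurable]: "B r \<in> events" for r unfolding B_def by measurable
    have bnd: "prob (B r) \<le> real k ^ 4 / real r" if "0 < r" for r
    proof -
      have "B r = (\<Union>i<r. {\<omega>\<in>space M. \<not> emeasure (N \<omega>) (strip k r i) \<le> 1})" by (auto simp: B_def)
      also have "prob \<dots> \<le> (\<Sum>i<r. prob {\<omega>\<in>space M. \<not> emeasure (N \<omega>) (strip k r i) \<le> 1})"
        by (intro finite_measure_subadditive_finite) auto
      also have "\<dots> \<le> (\<Sum>i<r. (real k ^ 2 / real r) ^ 2)"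
        by (intro sum_mono prob_ge_2) (auto simp: emeasure_strip)
      also have "\<dots> = real k ^ 4 / real r" using that by (simp add: power2_eq_square field_simps) (simp add: eval_nat_numeral)
      finally show ?thesis .
    qed
    define Z where "Z = (\<Inter>r\<in>{0<..}. B r)"
    have [measurable]: "Z \<in> events" unfolding Z_def by (intro sets.countable_INT') auto
    have "prob Z \<le> 0"
    proof (rule field_le_epsilon)
      fix e :: real assume e: "0 < e"
      obtain r :: nat where r: "real k ^ 4 / e < real r" using reals_Archimedean2 by blast
      moreover have "0 \<le> real k ^ 4 / e" using e by simp
      ultimately have r0: "0 < r" by (metis le_less_trans of_nat_0_less_iff)
      have "prob Z \<le> prob (B r)" using r0 by (intro finite_measure_mono) (auto simp: Z_def)
      also have "\<dots> \<le> real k ^ 4 / real r" by (rule bnd[OF r0])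
      also have "\<dots> \<le> e" using r e r0 by (simp add: field_simps)
      finally show "prob Z \<le> 0 + e" by simp
    qed
    then have "prob Z = 0" by (simp add: measure_le_0_iff)
    then have "Z \<in> null_sets M" by (auto simp: null_sets_def emeasure_eq_measure)
    from AE_not_in[OF this] AE_space show ?thesis
      by eventually_elim (auto simp: Z_def B_def)
  qed
  then have "AE \<omega> in M. \<forall>k. \<exists>r>0. \<forall>i<r. emeasure (N \<omega>) (strip k r i) \<le> 1"
    by (simp add: AE_all_countable)
  then show ?thesis using AE_locally_finite
  proof eventually_elim
    case (elim \<omega>)
    have "emeasure (NN \<omega>) (strip k r i) = emeasure (N \<omega>) (strip k r i)" if "i < r" for k r i
      using strip_subset[OF that, of k] elim by (simp add: emeasure_NN Int_absorb2)
    then show ?case using elim(1) by metis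
  qed
qed

text \<open>Simplicity in the form in which it is used: in a double integral the part with equal
  times reduces to a single integral. This avoids enumerating the atoms of the random
  measure.\<close>

definition simple_at :: "'a \<Rightarrow> bool" where
  "simple_at \<omega> \<longleftrightarrow> (\<forall>h\<in>borel_measurable (borel \<Otimes>\<^sub>M (borel :: (real \<times> real) measure)).
     (\<integral>\<^sup>+p. \<integral>\<^sup>+q. (if fst p = fst q then h (p, q) else 0) \<partial>NN \<omega> \<partial>NN \<omega>) = (\<integral>\<^sup>+p. h (p, p) \<partial>NN \<omega>))"

text \<open>Restricted to a strip with at most one point, the integer-valued measure takes only the
  values 0 and 1, so \<open>nn_integral_pair_zero_one\<close> applies. Points with equal times share
  a strip, hence the strips exhaust the diagonal part; monotone convergence in the box removes the
  localisation.\<close>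

lemma AE_simple: "AE \<omega> in M. simple_at \<omega>"
  using AE_integer_valued AE_strips
proof eventually_elim
  case (elim \<omega>)
  interpret sigma_finite_measure "NN \<omega>" by (rule sigma_finite_NN)
  show ?case unfolding simple_at_def
  proof
    fix h :: "(real \<times> real) \<times> (real \<times> real) \<Rightarrow> ennreal" assume h[measurable]: "h \<in> borel_measurable (borel \<Otimes>\<^sub>M borel)"
    define h' where "h' x = (if fst (fst x) = fst (snd x) then h x else 0)" for x
    have h'm[measurable]: "h' \<in> borel_measurable (borel \<Otimes>\<^sub>M borel)" unfolding h'_def by measurable
    define b where "b k p = (indicator (box_upto k \<inter> open_quadrant) p :: ennreal)" for k p
    have [measurable]: "b k \<in> borel_measurable borel" for k unfolding b_def by measurable
    have box: "(\<integral>\<^sup>+p. \<integral>\<^sup>+q. b k p * b k q * h' (p, q) \<partial>NN \<omega> \<partial>NN \<omega>) = (\<integral>\<^sup>+p. b k p * h (p, p) \<partial>NN \<omega>)" for k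
    proof -
      obtain r where r: "0 < r" and le: "\<And>i. i < r \<Longrightarrow> emeasure (NN \<omega>) (strip k r i) \<le> 1" using elim(2) by blast
      have split: "b k p * b k q * h' (p, q) = (\<Sum>i<r. indicator (strip k r i) p * indicator (strip k r i) q * h' (p, q))" for p q
      proof (cases "p \<in> box_upto k \<inter> open_quadrant \<and> q \<in> box_upto k \<inter> open_quadrant \<and> fst p = fst q")
        case True
        then have "p \<in> (\<Union>i<r. strip k r i)" "q \<in> (\<Union>i<r. strip k r i)" unfolding UN_strip[OF r] by auto
        then obtain i j where i: "i < r" "p \<in> strip k r i" and j: "j < r" "q \<in> strip k r j" by auto
        have ij: "i = j" using True by (intro strip_fst_disjoint[OF i(2) j(2) _ r]) simp
        have "(\<Sum>l<r. indicator (strip k r l) p * indicator (strip k r l) q * h' (p, q))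
          = (\<Sum>l<r. if l = i then h' (p, q) else 0)"
        proof (intro sum.cong refl)
          fix l
          show "indicator (strip k r l) p * indicator (strip k r l) q * h' (p, q) = (if l = i then h' (p, q) else 0)"
          proof (cases "l = i")
            case True
            then show ?thesis using i(2) j(2) ij by simp
          next
            case False
            have "p \<notin> strip k r l" using strip_fst_disjoint[OF i(2) _ refl r, of l] False by metis
            then show ?thesis using False by simp
          qed
        qed
        then show ?thesis using True i by (simp add: b_def)
      next
        case False
        show ?thesis
        proof (cases "fst p = fst q")
          case True
          have "indicator (strip k r l) p * indicator (strip k r l) q * h' (p, q) = 0" if "l \<in> {..<r}" for l
            using strip_subset[of l r k] that False True by (auto simp: indicator_def)
          then have "(\<Sum>i<r. indicator (strip k r i) p * indicator (strip k r i) q * h' (p, q)) = 0"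
            by (intro sum.neutral ballI)
          moreover have "b k p * b k q * h' (p, q) = 0" using False True by (auto simp: b_def indicator_def)
          ultimately show ?thesis by (simp only:)
        qed (simp add: h'_def)
      qed
      have one: "(\<integral>\<^sup>+p. \<integral>\<^sup>+q. indicator (strip k r i) p * indicator (strip k r i) q * h' (p, q) \<partial>NN \<omega> \<partial>NN \<omega>)
        = (\<integral>\<^sup>+p. indicator (strip k r i) p * h (p, p) \<partial>NN \<omega>)" if i: "i < r" for i
      proof -
        define \<nu> where "\<nu> = density (NN \<omega>) (indicator (strip k r i))"
        have s[measurable_cong]: "sets \<nu> = sets borel" by (simp add: \<nu>_def)
        have 01: "emeasure \<nu> A = 0 \<or> emeasure \<nu> A = 1" if [measurable]: "A \<in> sets borel" for A
        proof -
          have "emeasure \<nu> A = emeasure (NN \<omega>) (strip k r i \<inter> A)"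
            unfolding \<nu>_def by (simp add: emeasure_density indicator_inter_arith[symmetric])
          moreover have "strip k r i \<inter> A = box_upto k \<inter> (strip k r i \<inter> A)"
            using strip_subset[OF i, of k] by blast
          moreover have "strip k r i \<inter> A \<in> sets borel" by measurable
          then obtain j :: nat where "emeasure (NN \<omega>) (box_upto k \<inter> (strip k r i \<inter> A)) = of_nat j"
            using elim(1) unfolding integer_valued_at_def by blast
          moreover have "emeasure (NN \<omega>) (strip k r i \<inter> A) \<le> 1"
            using le[OF i] by (rule order_trans[OF emeasure_mono, rotated 2]) auto
          ultimately have "emeasure \<nu> A = of_nat j" "of_nat j \<le> (1::ennreal)" by auto
          moreover from this(2) have "j \<le> 1" by (metis of_nat_1 of_nat_le_iff)
          ultimately show ?thesis by (cases j) auto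
        qed
        have "(\<integral>\<^sup>+p. \<integral>\<^sup>+q. indicator (strip k r i) p * indicator (strip k r i) q * h' (p, q) \<partial>NN \<omega> \<partial>NN \<omega>)
          = (\<integral>\<^sup>+p. indicator (strip k r i) p * (\<integral>\<^sup>+q. indicator (strip k r i) q * h' (p, q) \<partial>NN \<omega>) \<partial>NN \<omega>)"
          by (subst nn_integral_cmult[symmetric]) (auto simp: mult.assoc)
        also have "\<dots> = (\<integral>\<^sup>+p. \<integral>\<^sup>+q. h' (p, q) \<partial>\<nu> \<partial>\<nu>)"
          unfolding \<nu>_def by (subst nn_integral_density, measurable)+
        also have "\<dots> = (\<integral>\<^sup>+p. h' (p, p) \<partial>\<nu>)" by (rule nn_integral_pair_zero_one[OF s 01 h'm])
        also have "\<dots> = (\<integral>\<^sup>+p. indicator (strip k r i) p * h (p, p) \<partial>NN \<omega>)"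
          unfolding \<nu>_def by (subst nn_integral_density, measurable) (simp add: h'_def)
        finally show ?thesis .
      qed
      have "(\<integral>\<^sup>+p. \<integral>\<^sup>+q. b k p * b k q * h' (p, q) \<partial>NN \<omega> \<partial>NN \<omega>)
        = (\<Sum>i<r. \<integral>\<^sup>+p. \<integral>\<^sup>+q. indicator (strip k r i) p * indicator (strip k r i) q * h' (p, q) \<partial>NN \<omega> \<partial>NN \<omega>)"
        unfolding split by (subst nn_integral_sum, measurable)+
      also have "\<dots> = (\<Sum>i<r. \<integral>\<^sup>+p. indicator (strip k r i) p * h (p, p) \<partial>NN \<omega>)"
        by (intro sum.cong one) auto
      also have "\<dots> = (\<integral>\<^sup>+p. (\<Sum>i<r. indicator (strip k r i) p * h (p, p)) \<partial>NN \<omega>)"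
        by (subst nn_integral_sum) auto
      also have "\<dots> = (\<integral>\<^sup>+p. b k p * h (p, p) \<partial>NN \<omega>)"
      proof (intro nn_integral_cong)
        fix p
        have "(\<Sum>i<r. indicator (strip k r i) p :: ennreal) = indicator (\<Union>i<r. strip k r i) p"
        proof (rule indicator_UN_disjoint[symmetric])
          show "disjoint_family_on (strip k r) {..<r}"
            using strip_fst_disjoint[OF _ _ refl r] by (auto simp: disjoint_family_on_def)
        qed simp
        then show "(\<Sum>i<r. indicator (strip k r i) p * h (p, p)) = b k p * h (p, p)"
          unfolding sum_distrib_right[symmetric] b_def UN_strip[OF r, of k] by simp
      qed
      finally show ?thesis .
    qed
    have bm: "b k p \<le> b l p" if "k \<le> l" for k l p
      using box_upto_mono[OF that] by (auto simp: b_def indicator_def)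
    have bsup: "(SUP k. b k p) = 1" if "p \<in> open_quadrant" for p
    proof (rule antisym)
      obtain k where "p \<in> box_upto k" using UN_box_upto by blast
      then show "1 \<le> (SUP k. b k p)" using that by (intro SUP_upper2[of k]) (auto simp: b_def)
      show "(SUP k. b k p) \<le> 1" by (intro SUP_least) (auto simp: b_def indicator_def)
    qed
    have q: "AE p in NN \<omega>. p \<in> open_quadrant" by (rule AE_NN_quadrant)
    have "(\<integral>\<^sup>+p. \<integral>\<^sup>+q. h' (p, q) \<partial>NN \<omega> \<partial>NN \<omega>) = (SUP k. \<integral>\<^sup>+p. \<integral>\<^sup>+q. b k p * b k q * h' (p, q) \<partial>NN \<omega> \<partial>NN \<omega>)"
    proof -
      have sup2: "(SUP k. b k p * b k q * x) = x" if "p \<in> open_quadrant" "q \<in> open_quadrant" for p q x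
      proof (rule antisym)
        obtain k where k: "p \<in> box_upto k" using UN_box_upto by blast
        obtain l where l: "q \<in> box_upto l" using UN_box_upto by blast
        have "p \<in> box_upto (max k l)" "q \<in> box_upto (max k l)"
          using k l box_upto_mono[of k "max k l"] box_upto_mono[of l "max k l"] by auto
        then show "x \<le> (SUP k. b k p * b k q * x)" using that
          by (intro SUP_upper2[of "max k l"]) (auto simp: b_def)
        show "(SUP k. b k p * b k q * x) \<le> x" by (intro SUP_least) (auto simp: b_def indicator_def)
      qed
      have "(\<integral>\<^sup>+p. \<integral>\<^sup>+q. h' (p, q) \<partial>NN \<omega> \<partial>NN \<omega>) = (\<integral>\<^sup>+p. \<integral>\<^sup>+q. (SUP k. b k p * b k q * h' (p, q)) \<partial>NN \<omega> \<partial>NN \<omega>)"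
      proof (intro nn_integral_cong_AE)
        show "AE p in NN \<omega>. (\<integral>\<^sup>+q. h' (p, q) \<partial>NN \<omega>) = (\<integral>\<^sup>+q. (SUP k. b k p * b k q * h' (p, q)) \<partial>NN \<omega>)"
          using q
        proof eventually_elim
          case (elim p)
          show ?case using q by (intro nn_integral_cong_AE) (auto simp: sup2 elim elim!: eventually_mono)
        qed
      qed
      also have "\<dots> = (\<integral>\<^sup>+p. (SUP k. \<integral>\<^sup>+q. b k p * b k q * h' (p, q) \<partial>NN \<omega>) \<partial>NN \<omega>)"
        by (intro nn_integral_cong nn_integral_monotone_convergence_SUP)
          (auto simp: incseq_def le_fun_def intro!: mult_mono bm)
      also have "\<dots> = (SUP k. \<integral>\<^sup>+p. \<integral>\<^sup>+q. b k p * b k q * h' (p, q) \<partial>NN \<omega> \<partial>NN \<omega>)"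
        by (intro nn_integral_monotone_convergence_SUP)
          (auto simp: incseq_def le_fun_def intro!: nn_integral_mono mult_mono bm)
      finally show ?thesis .
    qed
    also have "\<dots> = (SUP k. \<integral>\<^sup>+p. b k p * h (p, p) \<partial>NN \<omega>)" by (simp add: box)
    also have "\<dots> = (\<integral>\<^sup>+p. (SUP k. b k p * h (p, p)) \<partial>NN \<omega>)"
      by (intro nn_integral_monotone_convergence_SUP[symmetric])
        (auto simp: incseq_def le_fun_def intro!: mult_mono bm)
    also have "\<dots> = (\<integral>\<^sup>+p. h (p, p) \<partial>NN \<omega>)"
    proof (intro nn_integral_cong_AE)
      show "AE p in NN \<omega>. (SUP k. b k p * h (p, p)) = h (p, p)"
        using q by eventually_elim (simp add: SUP_mult_right_ennreal[symmetric] bsup)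
    qed
    finally show "(\<integral>\<^sup>+p. \<integral>\<^sup>+q. (if fst p = fst q then h (p, q) else 0) \<partial>NN \<omega> \<partial>NN \<omega>) = (\<integral>\<^sup>+p. h (p, p) \<partial>NN \<omega>)"
      by (simp add: h'_def)
  qed
qed

end

section \<open>Picard iterates\<close>

lemma measurable_indicator_lessThan[measurable (raw)]:
  fixes f g :: "'b \<Rightarrow> real"
  assumes [measurable]: "f \<in> borel_measurable K" "g \<in> borel_measurable K"
  shows "(\<lambda>x. indicator {..<g x} (f x) :: ennreal) \<in> borel_measurable K"
  unfolding indicator_def lessThan_iff by measurable

text \<open>All convolutions start at time 0. Building this cut-off into the measure keeps the
  kernels free of indicators in Fubini and convergence arguments.\<close>

definition pos_lebesgue :: "real measure" where
  "pos_lebesgue = density lborel (indicator {0<..})"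

abbreviation nn_integral_pos :: "(real \<Rightarrow> ennreal) \<Rightarrow> ennreal" (binder "\<integral>\<^sub>0" 10) where
  "nn_integral_pos f \<equiv> integral\<^sup>N pos_lebesgue f"

lemma sets_pos_lebesgue[simp, measurable_cong]: "sets pos_lebesgue = sets borel"
  by (simp add: pos_lebesgue_def)

lemma space_pos_lebesgue[simp]: "space pos_lebesgue = UNIV"
  by (simp add: pos_lebesgue_def)

lemma nn_integral_pos_lebesgue:
  "f \<in> borel_measurable borel \<Longrightarrow> (\<integral>\<^sub>0x. f x) = (\<integral>\<^sup>+x. indicator {0<..} x * f x \<partial>lborel)"
  unfolding pos_lebesgue_def by (subst nn_integral_density) auto

lemma AE_pos_lebesgue: "AE x in pos_lebesgue. 0 < x"
  unfolding pos_lebesgue_def by (subst AE_density) (auto simp: indicator_def)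

interpretation pos_lebesgue: sigma_finite_measure pos_lebesgue
  unfolding pos_lebesgue_def
  by (subst sigma_finite_measure.sigma_finite_iff_density_finite[OF lborel.sigma_finite_measure_axioms]) (auto simp: indicator_def)

lemma nn_integral_quadrant_pos_lebesgue:
  fixes f :: "real \<times> real \<Rightarrow> ennreal"
  assumes [measurable]: "f \<in> borel_measurable borel"
  shows "(\<integral>\<^sup>+p. f p \<partial>quadrant_lebesgue) = (\<integral>\<^sub>0v. (\<integral>\<^sup>+\<theta>. f (v, \<theta>) * indicator {0..} \<theta> \<partial>lborel))"
  by (simp add: nn_integral_quadrant_lebesgue nn_integral_pos_lebesgue mult.commute)

lemma nn_integral_swap_pos_lebesgue:
  fixes h :: "real \<Rightarrow> real \<Rightarrow> ennreal"
  assumes [measurable]: "case_prod h \<in> borel_measurable (borel \<Otimes>\<^sub>M borel)"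
  shows "(\<integral>\<^sub>0u. (\<integral>\<^sub>0v. h u v)) = (\<integral>\<^sub>0v. (\<integral>\<^sub>0u. h u v))"
proof -
  interpret pair_sigma_finite pos_lebesgue pos_lebesgue ..
  show ?thesis by (rule Fubini'[symmetric]) simp
qed

lemma AE_pos_lebesgue_neq: "AE u in pos_lebesgue. u \<noteq> v"
proof -
  have "AE u in lborel. u \<noteq> v" by (rule AE_lborel_singleton)
  then show ?thesis unfolding pos_lebesgue_def by (subst AE_density) (auto elim: eventually_mono)
qed

section \<open>Products of integrals split by time order\<close>

lemma nn_integral_product_triangles:
  fixes F G :: "real \<Rightarrow> ennreal"
  assumes [measurable]: "F \<in> borel_measurable borel" "G \<in> borel_measurable borel"
  shows "(\<integral>\<^sub>0u. F u) * (\<integral>\<^sub>0v. G v) =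
    (\<integral>\<^sub>0v. G v * (\<integral>\<^sub>0u. indicator {..<v} u * F u))
    + (\<integral>\<^sub>0u. F u * (\<integral>\<^sub>0v. indicator {..<u} v * G v))"
proof -
  have "(\<integral>\<^sub>0u. F u) * (\<integral>\<^sub>0v. G v)
    = (\<integral>\<^sub>0v. (\<integral>\<^sub>0u. F u * G v))"
    by (simp add: nn_integral_multc nn_integral_cmult)
  also have "\<dots> = (\<integral>\<^sub>0v. (\<integral>\<^sub>0u. G v * (indicator {..<v} u * F u) + F u * (indicator {..<u} v * G v)))"
  proof (rule nn_integral_cong)
    fix v
    show "(\<integral>\<^sub>0u. F u * G v)
      = (\<integral>\<^sub>0u. G v * (indicator {..<v} u * F u) + F u * (indicator {..<u} v * G v))"
      using AE_pos_lebesgue_neq[of v]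
      by (intro nn_integral_cong_AE) (auto elim!: eventually_mono simp: indicator_def mult.commute)
  qed
  also have "\<dots> = (\<integral>\<^sub>0v. (\<integral>\<^sub>0u. G v * (indicator {..<v} u * F u)))
     + (\<integral>\<^sub>0v. (\<integral>\<^sub>0u. F u * (indicator {..<u} v * G v)))"
  proof -
    have add: "(\<integral>\<^sub>0v. (\<integral>\<^sub>0u. A v u + B v u))
      = (\<integral>\<^sub>0v. (\<integral>\<^sub>0u. A v u)) + (\<integral>\<^sub>0v. (\<integral>\<^sub>0u. B v u))"
      if [measurable]: "case_prod A \<in> borel_measurable (borel \<Otimes>\<^sub>M borel)" "case_prod B \<in> borel_measurable (borel \<Otimes>\<^sub>M borel)"
      for A B :: "real \<Rightarrow> real \<Rightarrow> ennreal"
      by (simp add: nn_integral_add)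
    show ?thesis by (rule add) (simp_all add: case_prod_beta')
  qed
  also have "(\<integral>\<^sub>0v. (\<integral>\<^sub>0u. F u * (indicator {..<u} v * G v)))
      = (\<integral>\<^sub>0u. (\<integral>\<^sub>0v. F u * (indicator {..<u} v * G v)))"
    by (rule nn_integral_swap_pos_lebesgue) measurable
  finally show ?thesis by (simp add: nn_integral_cmult)
qed

context poisson_prm
begin

text \<open>For Lebesgue measure, in \<open>nn_integral_product_triangles\<close>, the diagonal is
  null; here it contributes the third term, which \<open>simple_at\<close> evaluates.\<close>

lemma product_split:
  fixes F G :: "real \<times> real \<Rightarrow> ennreal"
  assumes "simple_at \<omega>" and [measurable]: "F \<in> borel_measurable borel" "G \<in> borel_measurable borel"
  shows "(\<integral>\<^sup>+p. F p \<partial>NN \<omega>) * (\<integral>\<^sup>+q. G q \<partial>NN \<omega>) =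
    (\<integral>\<^sup>+q. G q * (\<integral>\<^sup>+p. indicator {..<fst q} (fst p) * F p \<partial>NN \<omega>) \<partial>NN \<omega>)
    + (\<integral>\<^sup>+p. F p * (\<integral>\<^sup>+q. indicator {..<fst p} (fst q) * G q \<partial>NN \<omega>) \<partial>NN \<omega>)
    + (\<integral>\<^sup>+p. F p * G p \<partial>NN \<omega>)"
proof -
  interpret sigma_finite_measure "NN \<omega>" by (rule sigma_finite_NN)
  interpret P: pair_sigma_finite "NN \<omega>" "NN \<omega>" ..
  define K where "K x = F (fst x) * G (snd x)" for x
  have Km[measurable]: "K \<in> borel_measurable (borel \<Otimes>\<^sub>M borel)" unfolding K_def[abs_def] by measurable
  have "(\<integral>\<^sup>+p. F p \<partial>NN \<omega>) * (\<integral>\<^sup>+q. G q \<partial>NN \<omega>) = (\<integral>\<^sup>+p. \<integral>\<^sup>+q. F p * G q \<partial>NN \<omega> \<partial>NN \<omega>)"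
    by (simp add: nn_integral_multc nn_integral_cmult)
  also have "\<dots> = (\<integral>\<^sup>+p. \<integral>\<^sup>+q. G q * (indicator {..<fst q} (fst p) * F p) + F p * (indicator {..<fst p} (fst q) * G q)
      + (if fst p = fst q then K (p, q) else 0) \<partial>NN \<omega> \<partial>NN \<omega>)"
    by (intro nn_integral_cong) (auto simp: indicator_def mult.commute K_def)
  also have "\<dots> = (\<integral>\<^sup>+p. \<integral>\<^sup>+q. G q * (indicator {..<fst q} (fst p) * F p) \<partial>NN \<omega> \<partial>NN \<omega>)
      + (\<integral>\<^sup>+p. \<integral>\<^sup>+q. F p * (indicator {..<fst p} (fst q) * G q) \<partial>NN \<omega> \<partial>NN \<omega>)
      + (\<integral>\<^sup>+p. \<integral>\<^sup>+q. (if fst p = fst q then K (p, q) else 0) \<partial>NN \<omega> \<partial>NN \<omega>)"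
  proof -
    have add: "(\<integral>\<^sup>+p. \<integral>\<^sup>+q. A p q + B p q + C p q \<partial>NN \<omega> \<partial>NN \<omega>)
      = (\<integral>\<^sup>+p. \<integral>\<^sup>+q. A p q \<partial>NN \<omega> \<partial>NN \<omega>) + (\<integral>\<^sup>+p. \<integral>\<^sup>+q. B p q \<partial>NN \<omega> \<partial>NN \<omega>)
        + (\<integral>\<^sup>+p. \<integral>\<^sup>+q. C p q \<partial>NN \<omega> \<partial>NN \<omega>)"
      if [measurable]: "case_prod A \<in> borel_measurable (borel \<Otimes>\<^sub>M borel)" "case_prod B \<in> borel_measurable (borel \<Otimes>\<^sub>M borel)"
        "case_prod C \<in> borel_measurable (borel \<Otimes>\<^sub>M borel)" for A B C :: "real \<times> real \<Rightarrow> real \<times> real \<Rightarrow> ennreal"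
      by (simp add: nn_integral_add)
    show ?thesis by (rule add) (simp_all add: case_prod_beta')
  qed
  also have "(\<integral>\<^sup>+p. \<integral>\<^sup>+q. (if fst p = fst q then K (p, q) else 0) \<partial>NN \<omega> \<partial>NN \<omega>)
      = (\<integral>\<^sup>+p. K (p, p) \<partial>NN \<omega>)"
  proof -
    show ?thesis using assms(1) Km unfolding simple_at_def by (rule bspec)
  qed
  also have "(\<integral>\<^sup>+p. \<integral>\<^sup>+q. G q * (indicator {..<fst q} (fst p) * F p) \<partial>NN \<omega> \<partial>NN \<omega>)
     = (\<integral>\<^sup>+q. \<integral>\<^sup>+p. G q * (indicator {..<fst q} (fst p) * F p) \<partial>NN \<omega> \<partial>NN \<omega>)"
    by (rule P.Fubini'[symmetric]) measurable
  finally show ?thesis by (simp add: nn_integral_cmult K_def)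
qed

end

text \<open>Since the kernel vanishes at nonpositive arguments, integrating \<phi> (t - u) covers
  exactly the strictly earlier points, without a separate cut-off at \<open>t\<close>.\<close>

locale hawkes_iteration = poisson_prm M N for M :: "'a measure" and N +
  fixes \<mu> :: ennreal and \<phi> :: "real \<Rightarrow> ennreal"
  assumes phi_measurable[measurable]: "\<phi> \<in> borel_measurable borel"
    and phi_nonpos: "x \<le> 0 \<Longrightarrow> \<phi> x = 0"
begin

primrec intensity :: "nat \<Rightarrow> 'a \<Rightarrow> real \<Rightarrow> ennreal" where
  "intensity 0 \<omega> t = \<mu>"
| "intensity (Suc n) \<omega> t = \<mu> + (\<integral>\<^sup>+p. \<phi> (t - fst p) * indicator {p. ennreal (snd p) \<le> intensity n \<omega> (fst p)} p \<partial>NN \<omega>)"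

definition accepted :: "nat \<Rightarrow> 'a \<Rightarrow> (real \<times> real) set" where
  "accepted n \<omega> = {p. ennreal (snd p) \<le> intensity n \<omega> (fst p)}"

definition stochint :: "nat \<Rightarrow> (real \<Rightarrow> ennreal) \<Rightarrow> 'a \<Rightarrow> ennreal" where
  "stochint n f \<omega> = (\<integral>\<^sup>+p. f (fst p) * indicator (accepted n \<omega>) p \<partial>NN \<omega>)"

lemma intensity_Suc: "intensity (Suc n) \<omega> t = \<mu> + stochint n (\<lambda>u. \<phi> (t - u)) \<omega>"
  by (simp add: stochint_def accepted_def)

lemma accepted_measurable_aux:
  assumes [measurable]: "(\<lambda>z. intensity n (fst z) (fst (snd z))) \<in> borel_measurable predictable"
  shows "(\<lambda>z. indicator (accepted n (fst z)) (snd z) :: ennreal) \<in> borel_measurable predictable"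
proof -
  have "(\<lambda>z. indicator (accepted n (fst z)) (snd z)) = (\<lambda>z. indicator {z. ennreal (snd (snd z)) \<le> intensity n (fst z) (fst (snd z))} z :: ennreal)"
    by (auto simp: accepted_def indicator_def)
  also have "\<dots> \<in> borel_measurable predictable" by measurable
  finally show ?thesis .
qed

lemma stochint_before_measurable_aux:
  assumes [measurable]: "case_prod g \<in> borel_measurable (borel \<Otimes>\<^sub>M borel)"
    "(\<lambda>z. indicator (accepted n (fst z)) (snd z) :: ennreal) \<in> borel_measurable predictable"
  shows "(\<lambda>z. stochint n (\<lambda>u. indicator {..<fst (snd z)} u * g (fst (snd z)) u) (fst z)) \<in> borel_measurable predictable"
proof -
  have "(\<lambda>x. case_prod g (fst x, fst (snd (snd x))) * indicator (accepted n (fst (snd x))) (snd (snd x)))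
      \<in> borel_measurable (borel \<Otimes>\<^sub>M predictable)"
    by measurable
  from integral_before_predictable[OF this] show ?thesis by (simp add: stochint_def mult.assoc)
qed

text \<open>Points at or after \<open>t\<close> do not affect the intensity at \<open>t\<close>, so
  a cut-off at \<open>t\<close> may be inserted; after that the previous results carry
  predictability to the next iterate.\<close>

lemma intensity_measurable[measurable]: "(\<lambda>z. intensity n (fst z) (fst (snd z))) \<in> borel_measurable predictable"
proof (induction n)
  case 0
  then show ?case by simp
next
  case (Suc n)
  have "stochint n (\<lambda>u. indicator {..<t} u * \<phi> (t - u)) \<omega> = stochint n (\<lambda>u. \<phi> (t - u)) \<omega>" for t \<omega>
    unfolding stochint_def by (intro nn_integral_cong) (auto simp: indicator_def phi_nonpos)
  moreover have "(\<lambda>z. stochint n (\<lambda>u. indicator {..<fst (snd z)} u * (\<lambda>t u. \<phi> (t - u)) (fst (snd z)) u) (fst z)) \<in> borel_measurable predictable"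
    by (intro stochint_before_measurable_aux accepted_measurable_aux Suc) measurable
  ultimately show ?case unfolding intensity_Suc by simp
qed

lemma accepted_measurable[measurable]:
  "(\<lambda>z. indicator (accepted n (fst z)) (snd z) :: ennreal) \<in> borel_measurable predictable"
  by (rule accepted_measurable_aux) measurable

lemmas stochint_before_measurable = stochint_before_measurable_aux[OF _ accepted_measurable]

lemma intensity_path_measurable[measurable]:
  assumes "\<omega> \<in> space M" shows "intensity n \<omega> \<in> borel_measurable borel"
proof -
  have "(\<lambda>t. (\<omega>, t, 0)) \<in> borel \<rightarrow>\<^sub>M predictable"
    using Pair_predictable[OF assms] by measurable
  from measurable_compose[OF this intensity_measurable] show ?thesis by simp
qed

lemma accepted_sets[measurable]:
  assumes "\<omega> \<in> space M" shows "accepted n \<omega> \<in> sets borel"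
proof -
  note [measurable] = intensity_path_measurable[OF assms]
  have "{p \<in> space borel. ennreal (snd p) \<le> intensity n \<omega> (fst p)} \<in> sets borel" by measurable
  then show ?thesis by (simp add: accepted_def)
qed

lemma predictable_imp_pair_measurable:
  fixes Z :: "'a \<Rightarrow> real \<Rightarrow> ennreal"
  assumes "(\<lambda>z. Z (fst z) (fst (snd z))) \<in> borel_measurable predictable"
  shows "case_prod Z \<in> borel_measurable (M \<Otimes>\<^sub>M borel)"
proof -
  have [measurable]: "(\<lambda>x. (snd x :: real, 0::real)) \<in> M \<Otimes>\<^sub>M borel \<rightarrow>\<^sub>M borel" by (rule Pair_borel) measurable
  have "(\<lambda>x. (fst x, (snd x :: real, 0::real))) \<in> M \<Otimes>\<^sub>M borel \<rightarrow>\<^sub>M M \<Otimes>\<^sub>M borel" by measurable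
  from measurable_compose[OF this measurable_predictable_pair[OF assms]] show ?thesis
    by (simp add: case_prod_beta')
qed

lemma intensity_pair_measurable[measurable]: "case_prod (intensity n) \<in> borel_measurable (M \<Otimes>\<^sub>M borel)"
  by (rule predictable_imp_pair_measurable) measurable

text \<open>Compensation first, then integration over the mark, which produces the level
  \<open>intensity n \<omega> v\<close>. \<open>Z\<close> is allowed to be random because second
  moments use it with a stochastic integral over the strict past.\<close>

lemma integral_accepted:
  fixes Z :: "'a \<Rightarrow> real \<Rightarrow> ennreal"
  assumes Z[measurable]: "(\<lambda>z. Z (fst z) (fst (snd z))) \<in> borel_measurable predictable"
  shows "(\<integral>\<^sup>+\<omega>. \<integral>\<^sup>+p. Z \<omega> (fst p) * indicator (accepted n \<omega>) p \<partial>NN \<omega> \<partial>M)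
    = (\<integral>\<^sub>0v. \<integral>\<^sup>+\<omega>. Z \<omega> v * intensity n \<omega> v \<partial>M)"
proof -
  have Zm[measurable]: "case_prod Z \<in> borel_measurable (M \<Otimes>\<^sub>M borel)"
    by (rule predictable_imp_pair_measurable) fact
  interpret P: pair_sigma_finite M pos_lebesgue ..
  have "(\<integral>\<^sup>+\<omega>. \<integral>\<^sup>+p. Z \<omega> (fst p) * indicator (accepted n \<omega>) p \<partial>NN \<omega> \<partial>M)
    = (\<integral>\<^sup>+\<omega>. \<integral>\<^sup>+p. Z \<omega> (fst p) * indicator (accepted n \<omega>) p \<partial>quadrant_lebesgue \<partial>M)"
  proof -
    have "(\<lambda>z. Z (fst z) (fst (snd z)) * indicator (accepted n (fst z)) (snd z)) \<in> borel_measurable predictable"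
      by measurable
    from compensation(2)[OF this] show ?thesis by simp
  qed
  also have "\<dots> = (\<integral>\<^sup>+\<omega>. (\<integral>\<^sub>0v. Z \<omega> v * intensity n \<omega> v) \<partial>M)"
  proof (intro nn_integral_cong)
    fix \<omega> assume w: "\<omega> \<in> space M"
    have [measurable]: "Z \<omega> \<in> borel_measurable borel"
      using measurable_compose[OF measurable_Pair1'[OF w] Zm] by simp
    note [measurable] = accepted_sets[OF w]
    have "(\<integral>\<^sup>+p. Z \<omega> (fst p) * indicator (accepted n \<omega>) p \<partial>quadrant_lebesgue)
      = (\<integral>\<^sub>0v. (\<integral>\<^sup>+\<theta>. Z \<omega> v * indicator ({0..} \<inter> {\<theta>. ennreal \<theta> \<le> intensity n \<omega> v}) \<theta> \<partial>lborel))"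
      by (subst nn_integral_quadrant_pos_lebesgue, measurable)
        (intro nn_integral_cong, auto simp: accepted_def indicator_def)
    also have "\<dots> = (\<integral>\<^sub>0v. Z \<omega> v * intensity n \<omega> v)"
      by (subst nn_integral_cmult_indicator) (auto simp: emeasure_ennreal_le)
    finally show "(\<integral>\<^sup>+p. Z \<omega> (fst p) * indicator (accepted n \<omega>) p \<partial>quadrant_lebesgue) = (\<integral>\<^sub>0v. Z \<omega> v * intensity n \<omega> v)" .
  qed
  also have "\<dots> = (\<integral>\<^sub>0v. \<integral>\<^sup>+\<omega>. Z \<omega> v * intensity n \<omega> v \<partial>M)"
  proof (rule P.Fubini'[symmetric])
    have "case_prod (\<lambda>\<omega> v. Z \<omega> v * intensity n \<omega> v) = (\<lambda>x. case_prod Z x * case_prod (intensity n) x)" by auto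
    then show "case_prod (\<lambda>\<omega> v. Z \<omega> v * intensity n \<omega> v) \<in> borel_measurable (M \<Otimes>\<^sub>M pos_lebesgue)" by simp
  qed
  finally show ?thesis .
qed

text \<open>\<open>gen_mean n\<close> is the mean intensity of the \<open>n\<close>-th generation of points, \<open>resolvent n\<close> the sum of the
  first \<open>n\<close> convolution powers of \<open>\<phi>\<close>.\<close>

primrec gen_mean :: "nat \<Rightarrow> real \<Rightarrow> ennreal" where
  "gen_mean 0 t = \<mu>"
| "gen_mean (Suc n) t = (\<integral>\<^sub>0s. \<phi> (t - s) * gen_mean n s)"

primrec resolvent :: "nat \<Rightarrow> real \<Rightarrow> ennreal" where
  "resolvent 0 t = 0"
| "resolvent (Suc n) t = \<phi> t + (\<integral>\<^sub>0s. \<phi> (t - s) * resolvent n s)"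

lemma gen_mean_measurable[measurable]: "gen_mean n \<in> borel_measurable borel"
proof (induction n)
  case (Suc n)
  note [measurable] = Suc
  show ?case unfolding gen_mean.simps[abs_def] by measurable
qed (simp add: gen_mean.simps[abs_def])

lemma resolvent_measurable[measurable]: "resolvent n \<in> borel_measurable borel"
proof (induction n)
  case (Suc n)
  note [measurable] = Suc
  show ?case unfolding resolvent.simps[abs_def] by measurable
qed (simp add: resolvent.simps[abs_def])

lemma resolvent_nonpos: "x \<le> 0 \<Longrightarrow> resolvent n x = 0"
proof (induction n)
  case (Suc n)
  have "(\<integral>\<^sub>0s. \<phi> (x - s) * resolvent n s) = (\<integral>\<^sub>0s. 0)"
    using AE_pos_lebesgue Suc.prems
    by (intro nn_integral_cong_AE) (auto elim!: eventually_mono intro!: phi_nonpos)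
  then show ?case using Suc.prems by (simp add: phi_nonpos)
qed simp

lemma stochint_rv[measurable]:
  assumes [measurable]: "f \<in> borel_measurable borel"
  shows "stochint n f \<in> borel_measurable M"
proof -
  have "(\<lambda>z. f (fst (snd z)) * indicator (accepted n (fst z)) (snd z)) \<in> borel_measurable predictable"
    by measurable
  from compensation(1)[OF this] show ?thesis by (simp add: stochint_def[abs_def])
qed

lemma nn_integral_stochint:
  assumes [measurable]: "f \<in> borel_measurable borel"
  shows "(\<integral>\<^sup>+\<omega>. stochint n f \<omega> \<partial>M) = (\<integral>\<^sub>0v. f v * (\<integral>\<^sup>+\<omega>. intensity n \<omega> v \<partial>M))"
proof -
  have "(\<integral>\<^sup>+\<omega>. stochint n f \<omega> \<partial>M) = (\<integral>\<^sub>0v. \<integral>\<^sup>+\<omega>. f v * intensity n \<omega> v \<partial>M)"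
    unfolding stochint_def by (rule integral_accepted) measurable
  then show ?thesis by (simp add: nn_integral_cmult)
qed

lemma nn_integral_intensity: "(\<integral>\<^sup>+\<omega>. intensity n \<omega> t \<partial>M) = (\<Sum>i\<le>n. gen_mean i t)"
proof (induction n arbitrary: t)
  case 0
  then show ?case by (simp add: emeasure_space_1)
next
  case (Suc n)
  have "(\<integral>\<^sup>+\<omega>. intensity (Suc n) \<omega> t \<partial>M) = \<mu> + (\<integral>\<^sup>+\<omega>. stochint n (\<lambda>u. \<phi> (t - u)) \<omega> \<partial>M)"
    unfolding intensity_Suc by (subst nn_integral_add) (auto simp: emeasure_space_1)
  also have "(\<integral>\<^sup>+\<omega>. stochint n (\<lambda>u. \<phi> (t - u)) \<omega> \<partial>M) = (\<Sum>i\<le>n. gen_mean (Suc i) t)"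
    by (simp add: nn_integral_stochint Suc sum_distrib_left nn_integral_sum)
  also have "\<mu> + \<dots> = (\<Sum>i\<le>Suc n. gen_mean i t)"
    by (subst sum.atMost_Suc_shift) simp
  finally show ?case .
qed

definition mean_intensity :: "nat \<Rightarrow> real \<Rightarrow> ennreal" where
  "mean_intensity n t = (\<Sum>i\<le>n. gen_mean i t)"

definition mean_stochint :: "nat \<Rightarrow> (real \<Rightarrow> ennreal) \<Rightarrow> ennreal" where
  "mean_stochint n f = (\<integral>\<^sub>0v. f v * mean_intensity n v)"

lemma mean_intensity_measurable[measurable]: "mean_intensity n \<in> borel_measurable borel"
  unfolding mean_intensity_def[abs_def] by measurable

lemma nn_integral_stochint_eq:
  "f \<in> borel_measurable borel \<Longrightarrow> (\<integral>\<^sup>+\<omega>. stochint n f \<omega> \<partial>M) = mean_stochint n f"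
  by (simp add: nn_integral_stochint nn_integral_intensity mean_stochint_def mean_intensity_def)

lemma mean_intensity_0: "mean_intensity 0 t = \<mu>"
  by (simp add: mean_intensity_def)

lemma mean_intensity_Suc: "mean_intensity (Suc n) t = \<mu> + mean_stochint n (\<lambda>u. \<phi> (t - u))"
proof -
  have "mean_intensity (Suc n) t = \<mu> + (\<Sum>i\<le>n. gen_mean (Suc i) t)"
    unfolding mean_intensity_def by (subst sum.atMost_Suc_shift) simp
  also have "(\<Sum>i\<le>n. gen_mean (Suc i) t) = mean_stochint n (\<lambda>u. \<phi> (t - u))"
    by (simp add: mean_stochint_def mean_intensity_def sum_distrib_left nn_integral_sum)
  finally show ?thesis .
qed

lemma intensity_mono: "n \<le> m \<Longrightarrow> intensity n \<omega> t \<le> intensity m \<omega> t"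
proof -
  have "intensity n \<omega> t \<le> intensity (Suc n) \<omega> t" for n t
  proof (induction n arbitrary: t)
    case (Suc n)
    have "accepted n \<omega> \<subseteq> accepted (Suc n) \<omega>"
      using Suc unfolding accepted_def by (auto intro: order_trans)
    then show ?case unfolding intensity_Suc stochint_def
      by (intro add_left_mono nn_integral_mono mult_left_mono) (auto simp: indicator_def)
  qed simp
  then show "n \<le> m \<Longrightarrow> intensity n \<omega> t \<le> intensity m \<omega> t" by (rule lift_Suc_mono_le)
qed

lemma accepted_mono: "n \<le> m \<Longrightarrow> accepted n \<omega> \<subseteq> accepted m \<omega>"
  unfolding accepted_def using intensity_mono by (auto intro: order_trans)

lemma accepted_Int: "accepted n \<omega> \<inter> accepted m \<omega> = accepted (min n m) \<omega>"
  using accepted_mono[of n m \<omega>] accepted_mono[of m n \<omega>] by (cases "n \<le> m") (auto simp: min_def)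

text \<open>The contribution to the second moment of the pairs whose point below \<open>intensity n\<close> comes first.\<close>

definition half_moment :: "nat \<Rightarrow> nat \<Rightarrow> (real \<Rightarrow> ennreal) \<Rightarrow> (real \<Rightarrow> ennreal) \<Rightarrow> ennreal" where
  "half_moment n m f g = (\<integral>\<^sub>0v. g v * (\<integral>\<^sup>+\<omega>. stochint n (\<lambda>u. indicator {..<v} u * f u) \<omega> * intensity m \<omega> v \<partial>M))"

section \<open>Second moments of the iterates\<close>

lemma second_moment_split:
  assumes [measurable]: "f \<in> borel_measurable borel" "g \<in> borel_measurable borel"
  shows "(\<integral>\<^sup>+\<omega>. stochint n f \<omega> * stochint m g \<omega> \<partial>M)
    = half_moment n m f g + half_moment m n g f + (\<integral>\<^sub>0v. f v * g v * mean_intensity (min n m) v)"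
proof -
  \<comment> \<open>The outer point \<open>q\<close> is the later one. The inner integral sees only
    times before it, so the integrand is predictable and \<open>integral_accepted\<close> evaluates
    the mean.\<close>
  define X where "X n m f g \<omega> = (\<integral>\<^sup>+q. g (fst q) * stochint n (\<lambda>u. indicator {..<fst q} u * f u) \<omega> * indicator (accepted m \<omega>) q \<partial>NN \<omega>)"
    for n m and f g :: "real \<Rightarrow> ennreal" and \<omega>
  have pm: "(\<lambda>z. g (fst (snd z)) * stochint n (\<lambda>u. indicator {..<fst (snd z)} u * f u) (fst z)) \<in> borel_measurable predictable"
    if [measurable]: "f \<in> borel_measurable borel" "g \<in> borel_measurable borel" for f g n
  proof -
    have [measurable]: "(\<lambda>z. stochint n (\<lambda>u. indicator {..<fst (snd z)} u * f u) (fst z)) \<in> borel_measurable predictable"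
      using stochint_before_measurable[of "\<lambda>t. f" n] by (simp add: case_prod_beta')
    show ?thesis by measurable
  qed
  have Xm: "X n m f g \<in> borel_measurable M" if "f \<in> borel_measurable borel" "g \<in> borel_measurable borel" for f g n m
  proof -
    note [measurable] = pm[OF that]
    have "(\<lambda>z. g (fst (snd z)) * stochint n (\<lambda>u. indicator {..<fst (snd z)} u * f u) (fst z) * indicator (accepted m (fst z)) (snd z))
      \<in> borel_measurable predictable" by measurable
    from compensation(1)[OF this] show ?thesis by (simp add: X_def[abs_def])
  qed
  have Xi: "(\<integral>\<^sup>+\<omega>. X n m f g \<omega> \<partial>M) = half_moment n m f g"
    if [measurable]: "f \<in> borel_measurable borel" "g \<in> borel_measurable borel" for f g n m
  proof -
    have "(\<integral>\<^sup>+\<omega>. X n m f g \<omega> \<partial>M)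
      = (\<integral>\<^sub>0v. \<integral>\<^sup>+\<omega>. g v * stochint n (\<lambda>u. indicator {..<v} u * f u) \<omega> * intensity m \<omega> v \<partial>M)"
      unfolding X_def by (rule integral_accepted) (rule pm, fact+)
    also have "\<dots> = half_moment n m f g"
      unfolding half_moment_def by (simp add: mult.assoc nn_integral_cmult)
    finally show ?thesis .
  qed
  have "(\<integral>\<^sup>+\<omega>. stochint n f \<omega> * stochint m g \<omega> \<partial>M)
    = (\<integral>\<^sup>+\<omega>. X n m f g \<omega> + X m n g f \<omega> + stochint (min n m) (\<lambda>v. f v * g v) \<omega> \<partial>M)"
  proof (rule nn_integral_cong_AE)
    show "AE \<omega> in M. stochint n f \<omega> * stochint m g \<omega> = X n m f g \<omega> + X m n g f \<omega> + stochint (min n m) (\<lambda>v. f v * g v) \<omega>"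
      using AE_simple AE_space
    proof eventually_elim
      case (elim \<omega>)
      note [measurable] = accepted_sets[OF elim(2)]
      show ?case unfolding stochint_def X_def accepted_Int[symmetric]
        by (subst product_split[OF elim(1)]) (auto simp: indicator_inter_arith ac_simps intro!: arg_cong2[where f="(+)"] nn_integral_cong)
    qed
  qed
  also have "\<dots> = half_moment n m f g + half_moment m n g f + (\<integral>\<^sub>0v. f v * g v * mean_intensity (min n m) v)"
  proof -
    have [measurable]: "X n m f g \<in> borel_measurable M" "X m n g f \<in> borel_measurable M"
      by (rule Xm, fact, fact)+
    show ?thesis
      by (subst nn_integral_add, measurable)+ (simp add: Xi nn_integral_stochint_eq mean_stochint_def)
  qed
  finally show ?thesis .
qed

text \<open>The recursion of \<open>resolvent\<close> with its origin moved from 0 to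
  \<open>w\<close>. The substitution u = w + s turns u > 0 into s > - w, and
  \<open>resolvent\<close> vanishes for s up to 0, which restores the range s > 0.\<close>

lemma resolvent_convolution:
  assumes "0 < w"
  shows "\<phi> (v - w) + (\<integral>\<^sub>0u. \<phi> (v - u) * resolvent k (u - w)) = resolvent (Suc k) (v - w)"
proof -
  have "(\<integral>\<^sub>0u. \<phi> (v - u) * resolvent k (u - w))
    = (\<integral>\<^sup>+u. indicator {0<..} u * (\<phi> (v - u) * resolvent k (u - w)) \<partial>lborel)"
    by (rule nn_integral_pos_lebesgue) measurable
  also have "\<dots> = (\<integral>\<^sup>+s. indicator {0<..} (w + 1 * s) * (\<phi> (v - (w + 1 * s)) * resolvent k (w + 1 * s - w)) \<partial>lborel)"
    by (subst nn_integral_real_affine[where c=1 and t=w]) auto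
  also have "\<dots> = (\<integral>\<^sup>+s. indicator {0<..} s * (\<phi> (v - w - s) * resolvent k s) \<partial>lborel)"
    using assms by (intro nn_integral_cong) (auto simp: indicator_def resolvent_nonpos algebra_simps)
  also have "\<dots> = (\<integral>\<^sub>0s. \<phi> (v - w - s) * resolvent k s)"
    by (rule nn_integral_pos_lebesgue[symmetric]) measurable
  finally show ?thesis by simp
qed

text \<open>Each factor is the mean weight of a point at \<open>w\<close> together with
  \<open>a\<close> or \<open>b\<close> generations of its descendants; \<open>gen_mean i\<close>
  averages the product over the points of generation \<open>i\<close>.\<close>

definition covariance_kernel :: "nat \<Rightarrow> nat \<Rightarrow> (real \<Rightarrow> ennreal) \<Rightarrow> (real \<Rightarrow> ennreal) \<Rightarrow> nat \<Rightarrow> ennreal" where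
  "covariance_kernel a b f g i = (\<integral>\<^sub>0w. gen_mean i w
     * ((f w + (\<integral>\<^sub>0u. f u * resolvent a (u - w))) * (g w + (\<integral>\<^sub>0v. g v * resolvent b (v - w)))))"

text \<open>What \<open>covariance_kernel\<close> becomes when f is cut off at \<open>v\<close> and
  g is \<phi> (v - u): by \<open>resolvent_convolution\<close> the second factor is then a
  resolvent, with index \<open>b\<close> one larger than before. For b = 0 it is zero, in accordance
  with a constant intensity.\<close>

definition half_kernel :: "nat \<Rightarrow> nat \<Rightarrow> (real \<Rightarrow> ennreal) \<Rightarrow> nat \<Rightarrow> real \<Rightarrow> ennreal" where
  "half_kernel a b f i v = (\<integral>\<^sub>0w. gen_mean i w
     * (resolvent b (v - w) * (f w + (\<integral>\<^sub>0u. indicator {..<v} u * f u * resolvent a (u - w)))))"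

lemma half_kernel_measurable[measurable]:
  assumes [measurable]: "f \<in> borel_measurable borel"
  shows "half_kernel a b f i \<in> borel_measurable borel"
  unfolding half_kernel_def[abs_def] by measurable

text \<open>The later point has been replaced by \<open>intensity m\<close>, which for m = Suc k is
  \<mu> plus a stochastic integral of index \<open>k\<close>; hence the induction hypothesis with
  the second index lowered by one. For m = 0 the intensity is deterministic and there is no
  covariance.\<close>

lemma half_moment_formula:
  assumes [measurable]: "f \<in> borel_measurable borel" "g \<in> borel_measurable borel"
    and IH: "\<And>k f g. m = Suc k \<Longrightarrow> f \<in> borel_measurable borel \<Longrightarrow> g \<in> borel_measurable borel \<Longrightarrow>
      (\<integral>\<^sup>+\<omega>. stochint n f \<omega> * stochint k g \<omega> \<partial>M)
        = mean_stochint n f * mean_stochint k g + (\<Sum>i\<le>min n k. covariance_kernel (n - i) (k - i) f g i)"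
  shows "half_moment n m f g = (\<integral>\<^sub>0v. g v * (mean_intensity m v * mean_stochint n (\<lambda>u. indicator {..<v} u * f u)))
    + (\<Sum>i\<le>min n m. \<integral>\<^sub>0v. g v * half_kernel (n - i) (m - i) f i v)"
proof -
  have *: "(\<integral>\<^sup>+\<omega>. stochint n (\<lambda>u. indicator {..<v} u * f u) \<omega> * intensity m \<omega> v \<partial>M)
    = mean_intensity m v * mean_stochint n (\<lambda>u. indicator {..<v} u * f u)
      + (\<Sum>i\<le>min n m. half_kernel (n - i) (m - i) f i v)" for v
  proof (cases m)
    case 0
    then show ?thesis
      by (simp add: nn_integral_cmult nn_integral_stochint_eq mean_intensity_0 half_kernel_def mult.commute)
  next
    case (Suc k)
    let ?f = "\<lambda>u. indicator {..<v} u * f u"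
    let ?g = "\<lambda>u. \<phi> (v - u)"
    have "(\<integral>\<^sup>+\<omega>. stochint n ?f \<omega> * intensity m \<omega> v \<partial>M)
      = \<mu> * mean_stochint n ?f + (\<integral>\<^sup>+\<omega>. stochint n ?f \<omega> * stochint k ?g \<omega> \<partial>M)"
      unfolding Suc intensity_Suc
      by (simp add: distrib_left distrib_right nn_integral_add nn_integral_cmult nn_integral_stochint_eq mult.commute)
    also have "\<dots> = mean_intensity m v * mean_stochint n ?f + (\<Sum>i\<le>min n k. covariance_kernel (n - i) (k - i) ?f ?g i)"
      unfolding Suc mean_intensity_Suc by (subst IH[OF Suc]) (auto simp: distrib_left distrib_right ac_simps)
    also have "(\<Sum>i\<le>min n k. covariance_kernel (n - i) (k - i) ?f ?g i) = (\<Sum>i\<le>min n k. half_kernel (n - i) (m - i) f i v)"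
    proof (intro sum.cong refl)
      fix i assume "i \<in> {..min n k}"
      then have i: "m - i = Suc (k - i)" using Suc by auto
      show "covariance_kernel (n - i) (k - i) ?f ?g i = half_kernel (n - i) (m - i) f i v"
        unfolding covariance_kernel_def half_kernel_def
      proof (intro nn_integral_cong_AE)
        show "AE w in pos_lebesgue. gen_mean i w * ((indicator {..<v} w * f w + (\<integral>\<^sub>0u. indicator {..<v} u * f u * resolvent (n - i) (u - w)))
           * (\<phi> (v - w) + (\<integral>\<^sub>0va. \<phi> (v - va) * resolvent (k - i) (va - w))))
          = gen_mean i w * (resolvent (m - i) (v - w) * (f w + (\<integral>\<^sub>0u. indicator {..<v} u * f u * resolvent (n - i) (u - w))))"
          using AE_pos_lebesgue
        proof eventually_elim
          case (elim w)
          \<comment> \<open>From \<open>v\<close> on the factor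
            \<open>resolvent (m - i) (v - w)\<close> vanishes, which is why the cut-off on
            \<open>f w\<close> may be dropped.\<close>
          then show ?case
            unfolding resolvent_convolution[OF elim] i
            by (cases "w < v") (simp_all add: resolvent_nonpos mult.commute del: resolvent.simps)
        qed
      qed
    qed
    \<comment> \<open>The range grows by at most the index i = m, where \<open>resolvent 0\<close>
      makes the kernel zero.\<close>
    also have "\<dots> = (\<Sum>i\<le>min n m. half_kernel (n - i) (m - i) f i v)"
      using Suc by (intro sum.mono_neutral_left) (auto simp: half_kernel_def not_le min_def split: if_splits)
    finally show ?thesis .
  qed
  have [measurable]: "(\<lambda>v. mean_stochint n (\<lambda>u. indicator {..<v} u * f u)) \<in> borel_measurable borel"
    unfolding mean_stochint_def by measurable
  show ?thesis unfolding half_moment_def *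
    by (simp add: distrib_left nn_integral_add sum_distrib_left nn_integral_sum)
qed

text \<open>Multiplying out the two factors and cutting the product of the two integrals along u < v
  and v < u sorts the terms by which point comes last, parallel to
  \<open>second_moment_split\<close>.\<close>

lemma covariance_kernel_split:
  assumes [measurable]: "f \<in> borel_measurable borel" "g \<in> borel_measurable borel"
  shows "covariance_kernel a b f g i = (\<integral>\<^sub>0v. g v * half_kernel a b f i v)
    + (\<integral>\<^sub>0u. f u * half_kernel b a g i u) + (\<integral>\<^sub>0w. f w * g w * gen_mean i w)"
proof -
  have half: "(\<integral>\<^sub>0v. g v * half_kernel a b f i v) =
    (\<integral>\<^sub>0w. gen_mean i w * (f w * (\<integral>\<^sub>0v. g v * resolvent b (v - w))
      + (\<integral>\<^sub>0v. g v * resolvent b (v - w) * (\<integral>\<^sub>0u. indicator {..<v} u * (f u * resolvent a (u - w))))))"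
    if [measurable]: "f \<in> borel_measurable borel" "g \<in> borel_measurable borel" for f g a b
  proof -
    have "(\<integral>\<^sub>0v. g v * half_kernel a b f i v) = (\<integral>\<^sub>0v. (\<integral>\<^sub>0w. g v * (gen_mean i w
     * (resolvent b (v - w) * (f w + (\<integral>\<^sub>0u. indicator {..<v} u * f u * resolvent a (u - w)))))))"
      unfolding half_kernel_def by (intro nn_integral_cong nn_integral_cmult[symmetric]) measurable
    also have "\<dots> = (\<integral>\<^sub>0w. (\<integral>\<^sub>0v. g v * (gen_mean i w
     * (resolvent b (v - w) * (f w + (\<integral>\<^sub>0u. indicator {..<v} u * f u * resolvent a (u - w)))))))"
      by (rule nn_integral_swap_pos_lebesgue) measurable
    also have "\<dots> = (\<integral>\<^sub>0w. gen_mean i w * (f w * (\<integral>\<^sub>0v. g v * resolvent b (v - w))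
      + (\<integral>\<^sub>0v. g v * resolvent b (v - w) * (\<integral>\<^sub>0u. indicator {..<v} u * (f u * resolvent a (u - w))))))"
    proof (rule nn_integral_cong)
      fix w
      have "(\<integral>\<^sub>0v. g v * (gen_mean i w
       * (resolvent b (v - w) * (f w + (\<integral>\<^sub>0u. indicator {..<v} u * f u * resolvent a (u - w))))))
       = (\<integral>\<^sub>0v. gen_mean i w * (f w * (g v * resolvent b (v - w))
          + g v * resolvent b (v - w) * (\<integral>\<^sub>0u. indicator {..<v} u * (f u * resolvent a (u - w)))))"
        by (intro nn_integral_cong) (simp add: distrib_left distrib_right ac_simps)
      also have "\<dots> = gen_mean i w * (f w * (\<integral>\<^sub>0v. g v * resolvent b (v - w))
      + (\<integral>\<^sub>0v. g v * resolvent b (v - w) * (\<integral>\<^sub>0u. indicator {..<v} u * (f u * resolvent a (u - w)))))"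
        by (subst nn_integral_cmult, measurable) (simp add: nn_integral_add nn_integral_cmult)
      finally show "(\<integral>\<^sub>0v. g v * (gen_mean i w
       * (resolvent b (v - w) * (f w + (\<integral>\<^sub>0u. indicator {..<v} u * f u * resolvent a (u - w)))))) = \<dots>" .
    qed
    finally show ?thesis .
  qed
  have "covariance_kernel a b f g i = (\<integral>\<^sub>0w.
    gen_mean i w * (f w * (\<integral>\<^sub>0v. g v * resolvent b (v - w))
      + (\<integral>\<^sub>0v. g v * resolvent b (v - w) * (\<integral>\<^sub>0u. indicator {..<v} u * (f u * resolvent a (u - w)))))
    + gen_mean i w * (g w * (\<integral>\<^sub>0u. f u * resolvent a (u - w))
      + (\<integral>\<^sub>0u. f u * resolvent a (u - w) * (\<integral>\<^sub>0v. indicator {..<u} v * (g v * resolvent b (v - w)))))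
    + f w * g w * gen_mean i w)"
    unfolding covariance_kernel_def
  proof (rule nn_integral_cong)
    fix w
    have t: "(\<integral>\<^sub>0u. f u * resolvent a (u - w)) * (\<integral>\<^sub>0v. g v * resolvent b (v - w))
      = (\<integral>\<^sub>0v. g v * resolvent b (v - w) * (\<integral>\<^sub>0u. indicator {..<v} u * (f u * resolvent a (u - w))))
       + (\<integral>\<^sub>0u. f u * resolvent a (u - w) * (\<integral>\<^sub>0v. indicator {..<u} v * (g v * resolvent b (v - w))))"
      (is "?F * ?G = ?A + ?B")
      by (rule nn_integral_product_triangles) measurable
    have "gen_mean i w * ((f w + ?F) * (g w + ?G)) = gen_mean i w * (f w * g w + f w * ?G + g w * ?F + ?F * ?G)"
      by (simp add: distrib_left distrib_right ac_simps)
    also have "\<dots> = gen_mean i w * (f w * ?G + ?A) + gen_mean i w * (g w * ?F + ?B) + f w * g w * gen_mean i w"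
      unfolding t by (simp add: distrib_left distrib_right ac_simps)
    finally show "gen_mean i w * ((f w + ?F) * (g w + ?G)) = \<dots>" .
  qed
  also have "\<dots> = (\<integral>\<^sub>0v. g v * half_kernel a b f i v)
    + (\<integral>\<^sub>0u. f u * half_kernel b a g i u) + (\<integral>\<^sub>0w. f w * g w * gen_mean i w)"
    unfolding half[OF assms] half[OF assms(2,1)] by (subst nn_integral_add, measurable)+
  finally show ?thesis .
qed

text \<open>Induction on n + m, because the two half moments lower different indices. The product of
  the means and the covariance sum are cut by time order in the same way as the left side, so the
  two sides agree part by part.\<close>

lemma second_moment_iterates:
  assumes "f \<in> borel_measurable borel" "g \<in> borel_measurable borel"
  shows "(\<integral>\<^sup>+\<omega>. stochint n f \<omega> * stochint m g \<omega> \<partial>M)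
    = mean_stochint n f * mean_stochint m g + (\<Sum>i\<le>min n m. covariance_kernel (n - i) (m - i) f g i)"
  using assms
proof (induction "n + m" arbitrary: n m f g rule: less_induct)
  case less
  note [measurable] = less.prems
  have 1: "half_moment n m f g = (\<integral>\<^sub>0v. g v * (mean_intensity m v * mean_stochint n (\<lambda>u. indicator {..<v} u * f u)))
    + (\<Sum>i\<le>min n m. \<integral>\<^sub>0v. g v * half_kernel (n - i) (m - i) f i v)"
    by (rule half_moment_formula) (use less in auto)
  have 2: "half_moment m n g f = (\<integral>\<^sub>0v. f v * (mean_intensity n v * mean_stochint m (\<lambda>u. indicator {..<v} u * g u)))
    + (\<Sum>i\<le>min m n. \<integral>\<^sub>0v. f v * half_kernel (m - i) (n - i) g i v)"
    by (rule half_moment_formula) (use less in auto)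
  have 3: "mean_stochint n f * mean_stochint m g
    = (\<integral>\<^sub>0v. g v * (mean_intensity m v * mean_stochint n (\<lambda>u. indicator {..<v} u * f u)))
     + (\<integral>\<^sub>0v. f v * (mean_intensity n v * mean_stochint m (\<lambda>u. indicator {..<v} u * g u)))"
    unfolding mean_stochint_def
    by (subst nn_integral_product_triangles) (auto simp: mult.assoc)
  have 4: "(\<integral>\<^sub>0v. f v * g v * mean_intensity (min n m) v)
    = (\<Sum>i\<le>min n m. \<integral>\<^sub>0w. f w * g w * gen_mean i w)"
    unfolding mean_intensity_def by (simp add: sum_distrib_left nn_integral_sum)
  have 5: "(\<Sum>i\<le>min n m. covariance_kernel (n - i) (m - i) f g i)
    = (\<Sum>i\<le>min n m. \<integral>\<^sub>0v. g v * half_kernel (n - i) (m - i) f i v)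
      + (\<Sum>i\<le>min m n. \<integral>\<^sub>0v. f v * half_kernel (m - i) (n - i) g i v)
      + (\<Sum>i\<le>min n m. \<integral>\<^sub>0w. f w * g w * gen_mean i w)"
    by (simp add: covariance_kernel_split sum.distrib min.commute)
  show ?case
    unfolding second_moment_split[OF less.prems] 1 2 3 4 5 by (simp add: ac_simps)
qed

end

section \<open>The limit of the iterates\<close>

lemma SUP_mult_incseq:
  fixes f g :: "nat \<Rightarrow> ennreal"
  assumes "incseq f" "incseq g"
  shows "(SUP n. f n * g n) = (SUP n. f n) * (SUP n. g n)"
proof (rule antisym)
  show "(SUP n. f n * g n) \<le> (SUP n. f n) * (SUP n. g n)"
    by (intro SUP_least mult_mono SUP_upper) auto
  have "(SUP n. f n) * (SUP n. g n) = (SUP i. f i * (SUP j. g j))"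
    by (simp only: SUP_mult_right_ennreal)
  also have "\<dots> = (SUP i. SUP j. f i * g j)"
    by (simp only: SUP_mult_left_ennreal)
  also have "\<dots> \<le> (SUP n. f n * g n)"
  proof (intro SUP_least)
    fix i j
    show "f i * g j \<le> (SUP n. f n * g n)"
      using assms by (intro SUP_upper2[of "max i j"] mult_mono) (auto simp: incseq_def)
  qed
  finally show "(SUP n. f n) * (SUP n. g n) \<le> (SUP n. f n * g n)" .
qed

context hawkes_iteration
begin

text \<open>A union rather than a comparison with \<open>intensity_lim\<close>: a mark equal to an
  unattained supremum is accepted by no iterate. The discrepancy lies on the graph of
  \<open>intensity_lim\<close>, which \<open>AE_graph_null\<close> shows to carry no points.\<close>

definition accepted_lim :: "'a \<Rightarrow> (real \<times> real) set" where
  "accepted_lim \<omega> = (\<Union>n. accepted n \<omega>)"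

definition intensity_lim :: "'a \<Rightarrow> real \<Rightarrow> ennreal" where
  "intensity_lim \<omega> t = (SUP n. intensity n \<omega> t)"

definition stochint_lim :: "(real \<Rightarrow> ennreal) \<Rightarrow> 'a \<Rightarrow> ennreal" where
  "stochint_lim f \<omega> = (\<integral>\<^sup>+p. f (fst p) * indicator (accepted_lim \<omega>) p \<partial>NN \<omega>)"

definition resolvent_lim :: "real \<Rightarrow> ennreal" where
  "resolvent_lim t = (SUP n. resolvent n t)"

definition mean_intensity_lim :: "real \<Rightarrow> ennreal" where
  "mean_intensity_lim t = (\<Sum>i. gen_mean i t)"

lemma accepted_lim_sets[measurable]: "\<omega> \<in> space M \<Longrightarrow> accepted_lim \<omega> \<in> sets borel"
  unfolding accepted_lim_def by measurable

lemma resolvent_lim_measurable[measurable]: "resolvent_lim \<in> borel_measurable borel"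
  unfolding resolvent_lim_def[abs_def] by measurable

lemma mean_intensity_lim_measurable[measurable]: "mean_intensity_lim \<in> borel_measurable borel"
  unfolding mean_intensity_lim_def[abs_def] by measurable

lemma indicator_accepted_mono: "n \<le> m \<Longrightarrow> indicator (accepted n \<omega>) p \<le> (indicator (accepted m \<omega>) p :: ennreal)"
  using accepted_mono[of n m \<omega>] by (auto simp: indicator_def)

lemma incseq_stochint: "incseq (\<lambda>n. stochint n f \<omega>)"
  unfolding incseq_def stochint_def
  by (auto intro!: nn_integral_mono mult_left_mono indicator_accepted_mono)

lemma stochint_lim_SUP:
  assumes "\<omega> \<in> space M" and [measurable]: "f \<in> borel_measurable borel"
  shows "stochint_lim f \<omega> = (SUP n. stochint n f \<omega>)"
proof -
  note [measurable] = accepted_sets[OF assms(1)]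
  have ind: "indicator (accepted_lim \<omega>) p = (SUP n. indicator (accepted n \<omega>) p :: ennreal)" for p
  proof (cases "p \<in> accepted_lim \<omega>")
    case True
    then obtain n where "p \<in> accepted n \<omega>" by (auto simp: accepted_lim_def)
    then have "1 \<le> (SUP n. indicator (accepted n \<omega>) p :: ennreal)" by (intro SUP_upper2[of n]) auto
    moreover have "(SUP n. indicator (accepted n \<omega>) p :: ennreal) \<le> 1" by (intro SUP_least) (simp add: indicator_def)
    ultimately have "(SUP n. indicator (accepted n \<omega>) p :: ennreal) = 1" by (rule antisym[rotated])
    then show ?thesis using True by simp
  next
    case False
    then have "indicator (accepted n \<omega>) p = (0 :: ennreal)" for n by (simp add: accepted_lim_def)
    then show ?thesis using False by simp
  qed
  have "stochint_lim f \<omega> = (\<integral>\<^sup>+p. (SUP n. f (fst p) * indicator (accepted n \<omega>) p) \<partial>NN \<omega>)"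
    unfolding stochint_lim_def ind by (simp add: SUP_mult_left_ennreal)
  also have "\<dots> = (SUP n. stochint n f \<omega>)"
    unfolding stochint_def
  proof (rule nn_integral_monotone_convergence_SUP)
    show "incseq (\<lambda>n p. f (fst p) * indicator (accepted n \<omega>) p)"
      by (auto simp: incseq_def le_fun_def intro!: mult_left_mono indicator_accepted_mono)
  qed measurable
  finally show ?thesis .
qed

lemma stochint_lim_rv[measurable]:
  assumes [measurable]: "f \<in> borel_measurable borel" shows "stochint_lim f \<in> borel_measurable M"
proof -
  have "(\<lambda>\<omega>. SUP n. stochint n f \<omega>) \<in> borel_measurable M" by measurable
  then show ?thesis by (simp add: stochint_lim_SUP cong: measurable_cong)
qed

lemma intensity_lim_eq:
  assumes "\<omega> \<in> space M"
  shows "intensity_lim \<omega> t = \<mu> + stochint_lim (\<lambda>u. \<phi> (t - u)) \<omega>"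
proof -
  have "intensity_lim \<omega> t = (SUP n. intensity (Suc n) \<omega> t)"
    unfolding intensity_lim_def
  proof (rule antisym)
    show "(SUP n. intensity n \<omega> t) \<le> (SUP n. intensity (Suc n) \<omega> t)"
      by (intro SUP_mono) (metis UNIV_I intensity_mono le_Suc_eq order_refl)
    show "(SUP n. intensity (Suc n) \<omega> t) \<le> (SUP n. intensity n \<omega> t)"
      by (intro SUP_least SUP_upper) simp
  qed
  also have "\<dots> = \<mu> + (SUP n. stochint n (\<lambda>u. \<phi> (t - u)) \<omega>)"
    unfolding intensity_Suc by (rule ennreal_SUP_add_right[symmetric]) simp
  finally show ?thesis using assms by (simp add: stochint_lim_SUP)
qed

lemma intensity_lim_measurable[measurable]:
  "(\<lambda>z. intensity_lim (fst z) (fst (snd z))) \<in> borel_measurable predictable"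
  unfolding intensity_lim_def by measurable

lemma incseq_mean_intensity: "incseq (\<lambda>n. mean_intensity n t)"
  unfolding mean_intensity_def incseq_def by (auto intro!: sum_mono2)

lemma mean_intensity_lim_SUP: "mean_intensity_lim t = (SUP n. mean_intensity n t)"
proof -
  have "mean_intensity_lim t = (SUP n. \<Sum>i<n. gen_mean i t)"
    unfolding mean_intensity_lim_def by (rule suminf_eq_SUP)
  also have "\<dots> = (SUP n. mean_intensity n t)"
  proof (rule antisym)
    show "(SUP n. \<Sum>i<n. gen_mean i t) \<le> (SUP n. mean_intensity n t)"
      unfolding mean_intensity_def by (intro SUP_mono') (auto intro!: sum_mono2)
    show "(SUP n. mean_intensity n t) \<le> (SUP n. \<Sum>i<n. gen_mean i t)"
      unfolding mean_intensity_def lessThan_Suc_atMost[symmetric] by (intro SUP_least SUP_upper) simp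
  qed
  finally show ?thesis .
qed

lemma incseq_mean_stochint: "incseq (\<lambda>n. mean_stochint n f)"
  using incseq_mean_intensity unfolding mean_stochint_def incseq_def
  by (auto intro!: nn_integral_mono mult_left_mono)

lemma mean_stochint_SUP:
  assumes [measurable]: "f \<in> borel_measurable borel"
  shows "(SUP n. mean_stochint n f) = (\<integral>\<^sub>0v. f v * mean_intensity_lim v)"
proof -
  have "(\<integral>\<^sub>0v. f v * mean_intensity_lim v) = (\<integral>\<^sub>0v. (SUP n. f v * mean_intensity n v))"
    by (simp add: mean_intensity_lim_SUP SUP_mult_left_ennreal)
  also have "\<dots> = (SUP n. mean_stochint n f)"
    unfolding mean_stochint_def using incseq_mean_intensity
    by (intro nn_integral_monotone_convergence_SUP) (auto simp: incseq_def le_fun_def intro!: mult_left_mono)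
  finally show ?thesis ..
qed

lemma nn_integral_stochint_lim:
  assumes [measurable]: "f \<in> borel_measurable borel"
  shows "(\<integral>\<^sup>+\<omega>. stochint_lim f \<omega> \<partial>M) = (\<integral>\<^sub>0v. f v * mean_intensity_lim v)"
proof -
  have "(\<integral>\<^sup>+\<omega>. stochint_lim f \<omega> \<partial>M) = (\<integral>\<^sup>+\<omega>. (SUP n. stochint n f \<omega>) \<partial>M)"
    by (intro nn_integral_cong stochint_lim_SUP) auto
  also have "\<dots> = (SUP n. mean_stochint n f)"
    using incseq_stochint
    by (subst nn_integral_monotone_convergence_SUP) (auto simp: nn_integral_stochint_eq incseq_def le_fun_def)
  finally show ?thesis by (simp add: mean_stochint_SUP)
qed

lemma resolvent_mono: "n \<le> m \<Longrightarrow> resolvent n t \<le> resolvent m t"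
proof -
  have "resolvent n t \<le> resolvent (Suc n) t" for n t
  proof (induction n arbitrary: t)
    case (Suc n)
    then show ?case unfolding resolvent.simps(2)[of n] resolvent.simps(2)[of "Suc n"]
      by (intro add_left_mono nn_integral_mono mult_left_mono) auto
  qed simp
  then show "n \<le> m \<Longrightarrow> resolvent n t \<le> resolvent m t" by (rule lift_Suc_mono_le)
qed

lemma resolvent_lim_nonpos: "x \<le> 0 \<Longrightarrow> resolvent_lim x = 0"
  by (simp add: resolvent_lim_def resolvent_nonpos)

definition covariance_kernel_lim :: "(real \<Rightarrow> ennreal) \<Rightarrow> (real \<Rightarrow> ennreal) \<Rightarrow> nat \<Rightarrow> ennreal" where
  "covariance_kernel_lim f g i = (\<integral>\<^sub>0w. gen_mean i w
     * ((f w + (\<integral>\<^sub>0u. f u * resolvent_lim (u - w))) * (g w + (\<integral>\<^sub>0v. g v * resolvent_lim (v - w)))))"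

lemma incseq_resolvent_integral: "incseq (\<lambda>n. f w + (\<integral>\<^sub>0u. f u * resolvent n (u - w)))"
  unfolding incseq_def by (auto intro!: add_left_mono nn_integral_mono mult_left_mono resolvent_mono)

lemma resolvent_integral_SUP:
  assumes [measurable]: "f \<in> borel_measurable borel"
  shows "(SUP n. f w + (\<integral>\<^sub>0u. f u * resolvent n (u - w))) = f w + (\<integral>\<^sub>0u. f u * resolvent_lim (u - w))"
proof -
  have "(\<integral>\<^sub>0u. f u * resolvent_lim (u - w)) = (\<integral>\<^sub>0u. (SUP n. f u * resolvent n (u - w)))"
    by (simp add: resolvent_lim_def SUP_mult_left_ennreal)
  also have "\<dots> = (SUP n. \<integral>\<^sub>0u. f u * resolvent n (u - w))"
    by (intro nn_integral_monotone_convergence_SUP) (auto simp: incseq_def le_fun_def intro!: mult_left_mono resolvent_mono)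
  finally show ?thesis by (simp add: ennreal_SUP_add_right)
qed

lemma incseq_covariance_kernel: "incseq (\<lambda>n. covariance_kernel n n f g i)"
  using incseq_resolvent_integral unfolding covariance_kernel_def incseq_def
  by (auto intro!: nn_integral_mono mult_left_mono mult_mono)

lemma covariance_kernel_SUP:
  assumes [measurable]: "f \<in> borel_measurable borel" "g \<in> borel_measurable borel"
  shows "(SUP n. covariance_kernel n n f g i) = covariance_kernel_lim f g i"
proof -
  have "covariance_kernel_lim f g i = (\<integral>\<^sub>0w. (SUP n. gen_mean i w
     * ((f w + (\<integral>\<^sub>0u. f u * resolvent n (u - w))) * (g w + (\<integral>\<^sub>0v. g v * resolvent n (v - w))))))"
    unfolding covariance_kernel_lim_def
    by (simp add: SUP_mult_left_ennreal[symmetric] SUP_mult_incseq incseq_resolvent_integral resolvent_integral_SUP)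
  also have "\<dots> = (SUP n. covariance_kernel n n f g i)"
    unfolding covariance_kernel_def
  proof (rule nn_integral_monotone_convergence_SUP)
    show "incseq (\<lambda>n w. gen_mean i w * ((f w + (\<integral>\<^sub>0u. f u * resolvent n (u - w))) * (g w + (\<integral>\<^sub>0v. g v * resolvent n (v - w)))))"
      using incseq_resolvent_integral unfolding incseq_def le_fun_def
      by (auto intro!: mult_left_mono mult_mono)
  qed measurable
  finally show ?thesis ..
qed

lemma second_moment_lim:
  assumes [measurable]: "f \<in> borel_measurable borel" "g \<in> borel_measurable borel"
  shows "(\<integral>\<^sup>+\<omega>. stochint_lim f \<omega> * stochint_lim g \<omega> \<partial>M)
    = (\<integral>\<^sup>+\<omega>. stochint_lim f \<omega> \<partial>M) * (\<integral>\<^sup>+\<omega>. stochint_lim g \<omega> \<partial>M)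
      + (\<integral>\<^sub>0w. mean_intensity_lim w * ((f w + (\<integral>\<^sub>0u. f u * resolvent_lim (u - w)))
          * (g w + (\<integral>\<^sub>0v. g v * resolvent_lim (v - w)))))"
proof -
  \<comment> \<open>Padding with zeros turns a sum over a range growing with n into a fixed series
    whose terms increase in n, so supremum and series can be exchanged. For fixed \<open>i\<close>
    the shift \<open>n - i\<close> is invisible in the limit.\<close>
  define c where "c n i = (if i \<le> n then covariance_kernel (n - i) (n - i) f g i else 0)" for n i
  have cinc: "incseq (\<lambda>n. c n i)" for i
    using incseq_covariance_kernel[of f g i] unfolding incseq_def c_def by (auto simp: diff_le_mono)
  have csup: "(SUP n. c n i) = covariance_kernel_lim f g i" for i
  proof -
    have "(SUP n. c n i) = (SUP n. covariance_kernel n n f g i)"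
    proof (rule antisym)
      show "(SUP n. c n i) \<le> (SUP n. covariance_kernel n n f g i)"
        unfolding c_def by (intro SUP_least) (auto intro: SUP_upper)
      show "(SUP n. covariance_kernel n n f g i) \<le> (SUP n. c n i)"
      proof (rule SUP_least)
        fix n
        show "covariance_kernel n n f g i \<le> (SUP n. c n i)"
          by (rule SUP_upper2[of "n + i"]) (auto simp: c_def)
      qed
    qed
    then show ?thesis by (simp add: covariance_kernel_SUP)
  qed
  have csum: "(\<Sum>i\<le>n. covariance_kernel (n - i) (n - i) f g i) = (\<Sum>i. c n i)" for n
  proof -
    have "(\<Sum>i. c n i) = (\<Sum>i\<le>n. c n i)" by (rule suminf_finite) (auto simp: c_def)
    then show ?thesis by (simp add: c_def)
  qed
  have "(\<integral>\<^sup>+\<omega>. stochint_lim f \<omega> * stochint_lim g \<omega> \<partial>M) = (\<integral>\<^sup>+\<omega>. (SUP n. stochint n f \<omega> * stochint n g \<omega>) \<partial>M)"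
    by (intro nn_integral_cong) (simp add: stochint_lim_SUP SUP_mult_incseq incseq_stochint)
  also have "\<dots> = (SUP n. \<integral>\<^sup>+\<omega>. stochint n f \<omega> * stochint n g \<omega> \<partial>M)"
    using incseq_stochint unfolding incseq_def
    by (intro nn_integral_monotone_convergence_SUP) (auto simp: incseq_def le_fun_def intro!: mult_mono)
  also have "\<dots> = (SUP n. mean_stochint n f * mean_stochint n g + (\<Sum>i. c n i))"
    by (simp add: second_moment_iterates csum)
  also have "\<dots> = (SUP n. mean_stochint n f * mean_stochint n g) + (SUP n. \<Sum>i. c n i)"
  proof (rule ennreal_SUP_add)
    show "incseq (\<lambda>n. mean_stochint n f * mean_stochint n g)"
      using incseq_mean_stochint unfolding incseq_def by (auto intro!: mult_mono)
    show "incseq (\<lambda>n. \<Sum>i. c n i)"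
      using cinc unfolding incseq_def by (auto intro!: suminf_le)
  qed
  also have "(SUP n. \<Sum>i. c n i) = (\<Sum>i. covariance_kernel_lim f g i)"
    by (subst ennreal_suminf_SUP_eq[symmetric]) (auto simp: csup cinc)
  also have "(SUP n. mean_stochint n f * mean_stochint n g)
      = (\<integral>\<^sup>+\<omega>. stochint_lim f \<omega> \<partial>M) * (\<integral>\<^sup>+\<omega>. stochint_lim g \<omega> \<partial>M)"
    by (simp add: SUP_mult_incseq incseq_mean_stochint mean_stochint_SUP nn_integral_stochint_lim)
  also have "(\<Sum>i. covariance_kernel_lim f g i) = (\<integral>\<^sub>0w. (\<Sum>i. gen_mean i w * ((f w + (\<integral>\<^sub>0u. f u * resolvent_lim (u - w)))
          * (g w + (\<integral>\<^sub>0v. g v * resolvent_lim (v - w))))))"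
    unfolding covariance_kernel_lim_def by (rule nn_integral_suminf[symmetric]) measurable
  finally show ?thesis by (simp add: mean_intensity_lim_def ennreal_suminf_multc)
qed

end

section \<open>Pathwise uniqueness\<close>

lemma sigma_finite_quadrant_lebesgue: "sigma_finite_measure quadrant_lebesgue"
  unfolding quadrant_lebesgue_def
  by (subst sigma_finite_measure.sigma_finite_iff_density_finite[OF lborel.sigma_finite_measure_axioms])
    (auto simp: indicator_def)

lemma nn_integral_shift: 
  fixes f :: "real \<Rightarrow> ennreal"
  assumes [measurable]: "f \<in> borel_measurable borel"
  shows "(\<integral>\<^sup>+t. f (t - s) \<partial>lborel) = (\<integral>\<^sup>+t. f t \<partial>lborel)"
  by (subst nn_integral_real_affine[where c=1 and t=s]) auto

text \<open>The sets with x at most n and \<phi> at least 1/(n + 1) exhaust the set where \<phi> is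
  nonzero, so they cannot all be null. The bound \<open>b\<close> confines the effect of a point to
  a bounded window of time.\<close>

lemma not_AE_zero_obtains:
  fixes \<phi> :: "real \<Rightarrow> ennreal"
  assumes [measurable]: "\<phi> \<in> borel_measurable borel" and nz: "\<not> (AE x in lborel. \<phi> x = 0)"
  obtains b c where "0 < c" "emeasure lborel {x. x \<le> b \<and> ennreal c \<le> \<phi> x} \<noteq> 0"
proof (rule ccontr)
  assume no: "\<not> thesis"
  define K where "K n = {x. x \<le> real n \<and> ennreal (inverse (real (Suc n))) \<le> \<phi> x}" for n
  have Km[measurable]: "K n \<in> sets borel" for n
  proof -
    have "{x \<in> space borel. x \<le> real n \<and> ennreal (inverse (real (Suc n))) \<le> \<phi> x} \<in> sets borel" by measurable
    then show ?thesis by (simp add: K_def)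
  qed
  have "emeasure lborel (K n) = 0" for n
    using no that[of "inverse (real (Suc n))" "real n"] unfolding K_def by force
  then have "emeasure lborel (\<Union>n. K n) = 0" by (intro emeasure_UN_eq_0) auto
  then have "(\<Union>n. K n) \<in> null_sets lborel" by (auto simp: null_sets_def)
  from AE_not_in[OF this] have "AE x in lborel. \<phi> x = 0"
  proof eventually_elim
    case (elim x)
    show ?case
    proof (rule ccontr)
      assume "\<phi> x \<noteq> 0"
      obtain r where r: "0 < r" "ennreal r \<le> \<phi> x"
      proof (cases "\<phi> x")
        case (real r)
        then show ?thesis using \<open>\<phi> x \<noteq> 0\<close> that[of r] by (cases "r = 0") auto
      qed (use that[of 1] in auto)
      obtain n where n: "inverse (real (Suc n)) < r" using reals_Archimedean[OF r(1)] by blast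
      obtain m :: nat where m: "x < real m" using reals_Archimedean2 by blast
      have "inverse (real (Suc (max n m))) \<le> inverse (real (Suc n))" by (intro le_imp_inverse_le) auto
      then have "ennreal (inverse (real (Suc (max n m)))) \<le> \<phi> x"
        using n r(2) by (intro order_trans[OF _ r(2)] ennreal_leI) linarith
      moreover have "x \<le> real (max n m)" using m by simp
      ultimately have "x \<in> K (max n m)" by (simp add: K_def)
      then show False using elim by blast
    qed
  qed
  then show False using nz by simp
qed

context hawkes_iteration
begin

text \<open>The last clause treats a kernel that is zero almost everywhere but perhaps not
  identically. Finiteness of \<open>lam\<close> then gives no bound on the number of accepted
  points; instead, almost surely no two points have a gap at which \<phi> is nonzero.\<close>

definition regular_at :: "'a \<Rightarrow> bool" where
  "regular_at \<omega> \<longleftrightarrow> \<omega> \<in> space M \<and> integer_valued_at \<omega>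
    \<and> emeasure (NN \<omega>) {p. ennreal (snd p) = intensity_lim \<omega> (fst p)} = 0
    \<and> ((AE x in lborel. \<phi> x = 0) \<longrightarrow> (AE q in NN \<omega>. emeasure (NN \<omega>) {p. fst p < fst q \<and> \<phi> (fst q - fst p) \<noteq> 0} = 0))"

lemma intensity_lim_path_measurable[measurable]:
  assumes "\<omega> \<in> space M" shows "intensity_lim \<omega> \<in> borel_measurable borel"
  unfolding intensity_lim_def[abs_def] using assms by measurable

text \<open>At each time the graph contains at most one mark, so it is Lebesgue null; as
  \<open>intensity_lim\<close> is predictable, compensation transfers this to the random
  measure.\<close>

lemma AE_graph_null: "AE \<omega> in M. emeasure (NN \<omega>) {p. ennreal (snd p) = intensity_lim \<omega> (fst p)} = 0"
proof -
  define f where "f z = (indicator {z. ennreal (snd (snd z)) = intensity_lim (fst z) (fst (snd z))} z :: ennreal)" for z :: "'a \<times> real \<times> real"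
  have fm[measurable]: "f \<in> borel_measurable predictable" unfolding f_def by measurable
  have "(\<integral>\<^sup>+\<omega>. \<integral>\<^sup>+p. f (\<omega>, p) \<partial>NN \<omega> \<partial>M) = (\<integral>\<^sup>+\<omega>. \<integral>\<^sup>+p. f (\<omega>, p) \<partial>quadrant_lebesgue \<partial>M)"
    by (rule compensation(2)[OF fm])
  also have "\<dots> = (\<integral>\<^sup>+\<omega>. 0 \<partial>M)"
  proof (rule nn_integral_cong)
    fix \<omega> assume w: "\<omega> \<in> space M"
    have [measurable]: "(\<lambda>p. f (\<omega>, p)) \<in> borel_measurable borel"
      using measurable_compose[OF Pair_predictable[OF w] fm] by simp
    have z: "(\<integral>\<^sup>+\<theta>. f (\<omega>, (v, \<theta>)) * indicator {0..} \<theta> \<partial>lborel) = 0" for v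
    proof -
      have "AE \<theta> in lborel. \<theta> \<noteq> enn2real (intensity_lim \<omega> v)" by (rule AE_lborel_singleton)
      then have "AE \<theta> in lborel. f (\<omega>, (v, \<theta>)) * indicator {0..} \<theta> = 0"
      proof eventually_elim
        case (elim \<theta>)
        show ?case
        proof (cases "0 \<le> \<theta> \<and> ennreal \<theta> = intensity_lim \<omega> v")
          case True
          then have "enn2real (intensity_lim \<omega> v) = \<theta>" by (metis enn2real_ennreal)
          then show ?thesis using elim by simp
        qed (auto simp: f_def indicator_def)
      qed
      then have "(\<integral>\<^sup>+\<theta>. f (\<omega>, (v, \<theta>)) * indicator {0..} \<theta> \<partial>lborel) = (\<integral>\<^sup>+(\<theta>::real). 0 \<partial>lborel)"
        by (rule nn_integral_cong_AE)
      then show ?thesis by simp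
    qed
    show "(\<integral>\<^sup>+p. f (\<omega>, p) \<partial>quadrant_lebesgue) = 0"
      by (subst nn_integral_quadrant_pos_lebesgue, measurable) (simp add: z)
  qed
  finally have "(\<integral>\<^sup>+\<omega>. \<integral>\<^sup>+p. f (\<omega>, p) \<partial>NN \<omega> \<partial>M) = 0" by simp
  then have "AE \<omega> in M. (\<integral>\<^sup>+p. f (\<omega>, p) \<partial>NN \<omega>) = 0"
    by (subst (asm) nn_integral_0_iff_AE) (auto intro: compensation(1)[OF fm])
  then show ?thesis using AE_space
  proof eventually_elim
    case (elim \<omega>)
    note [measurable] = intensity_lim_path_measurable[OF elim(2)]
    have "{p \<in> space borel. ennreal (snd p) = intensity_lim \<omega> (fst p)} \<in> sets borel" by measurable
    then have [measurable]: "{p. ennreal (snd p) = intensity_lim \<omega> (fst p)} \<in> sets borel" by simp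
    have "(\<lambda>p. f (\<omega>, p)) = indicator {p. ennreal (snd p) = intensity_lim \<omega> (fst p)}"
      by (auto simp: f_def indicator_def)
    then show ?case using elim by simp
  qed
qed

text \<open>Compensation is used twice. For fixed \<open>q\<close> the mean number of earlier points
  at a gap with nonzero \<phi> is an integral over a null set of times; since this number is
  predictable in \<open>q\<close>, its integral over the random points \<open>q\<close> has mean
  zero as well.\<close>

lemma AE_no_null_offspring:
  assumes z: "AE x in lborel. \<phi> x = 0"
  shows "AE \<omega> in M. AE q in NN \<omega>. emeasure (NN \<omega>) {p. fst p < fst q \<and> \<phi> (fst q - fst p) \<noteq> 0} = 0"
proof -
  define b where "b x = (if \<phi> x \<noteq> 0 then 1 else 0 :: ennreal)" for x
  have [measurable]: "b \<in> borel_measurable borel" unfolding b_def by measurable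
  define Z where "Z x = (\<integral>\<^sup>+p. indicator {..<fst (snd x)} (fst p) * b (fst (snd x) - fst p) \<partial>NN (fst x))" for x :: "'a \<times> real \<times> real"
  have Zm[measurable]: "Z \<in> borel_measurable predictable"
  proof -
    have "(\<lambda>x. b (fst x - fst (snd (snd x)))) \<in> borel_measurable (borel \<Otimes>\<^sub>M predictable)" by measurable
    from integral_before_predictable[OF this] show ?thesis by (simp add: Z_def[abs_def])
  qed
  have EZ: "(\<integral>\<^sup>+\<omega>. Z (\<omega>, q) \<partial>M) = 0" for q
  proof -
    have "(\<lambda>z. indicator {..<fst q} (fst (snd z)) * b (fst q - fst (snd z))) \<in> borel_measurable predictable" by measurable
    from compensation(2)[OF this] have "(\<integral>\<^sup>+\<omega>. Z (\<omega>, q) \<partial>M)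
      = (\<integral>\<^sup>+\<omega>. \<integral>\<^sup>+p. indicator {..<fst q} (fst p) * b (fst q - fst p) \<partial>quadrant_lebesgue \<partial>M)"
      by (simp add: Z_def)
    also have "(\<integral>\<^sup>+p. indicator {..<fst q} (fst p) * b (fst q - fst p) \<partial>quadrant_lebesgue) = 0"
    proof -
      have "(\<integral>\<^sup>+v. indicator {..<fst q} v * b (fst q - v) \<partial>lborel) = 0"
      proof -
        have "(\<integral>\<^sup>+v. b (fst q - v) \<partial>lborel) = (\<integral>\<^sup>+v. b v \<partial>lborel)"
          by (subst nn_integral_real_affine[where c="-1" and t="fst q"]) auto
        also have "\<dots> = (\<integral>\<^sup>+(v::real). 0 \<partial>lborel)"
          using z by (intro nn_integral_cong_AE) (auto simp: b_def elim!: eventually_mono)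
        finally have "(\<integral>\<^sup>+v. b (fst q - v) \<partial>lborel) = 0" by simp
        moreover have "(\<integral>\<^sup>+v. indicator {..<fst q} v * b (fst q - v) \<partial>lborel) \<le> (\<integral>\<^sup>+v. b (fst q - v) \<partial>lborel)"
          by (intro nn_integral_mono) (simp add: indicator_def)
        ultimately show ?thesis by simp
      qed
      then have "AE v in lborel. indicator {..<fst q} v * b (fst q - v) = 0"
        by (subst (asm) nn_integral_0_iff_AE) auto
      then have ae: "AE v in pos_lebesgue. (\<integral>\<^sup>+\<theta>. indicator {..<fst q} v * b (fst q - v) * indicator {0..} \<theta> \<partial>lborel) = 0"
        unfolding pos_lebesgue_def by (subst AE_density) (auto elim!: eventually_mono)
      have "(\<integral>\<^sub>0v. (\<integral>\<^sup>+\<theta>. indicator {..<fst q} v * b (fst q - v) * indicator {0..} \<theta> \<partial>lborel)) = (\<integral>\<^sub>0v. 0)"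
        by (rule nn_integral_cong_AE[OF ae])
      then show ?thesis by (subst nn_integral_quadrant_pos_lebesgue) simp_all
    qed
    finally show ?thesis by simp
  qed
  have "(\<integral>\<^sup>+\<omega>. \<integral>\<^sup>+q. Z (\<omega>, q) \<partial>NN \<omega> \<partial>M) = (\<integral>\<^sup>+\<omega>. \<integral>\<^sup>+q. Z (\<omega>, q) \<partial>quadrant_lebesgue \<partial>M)"
    by (rule compensation(2)[OF Zm])
  also have "\<dots> = (\<integral>\<^sup>+q. \<integral>\<^sup>+\<omega>. Z (\<omega>, q) \<partial>M \<partial>quadrant_lebesgue)"
  proof -
    interpret Q: sigma_finite_measure quadrant_lebesgue by (rule sigma_finite_quadrant_lebesgue)
    interpret P: pair_sigma_finite M quadrant_lebesgue ..
    have "Z \<in> borel_measurable (M \<Otimes>\<^sub>M quadrant_lebesgue)"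
      using measurable_predictable_pair[OF Zm] by (simp cong: measurable_cong_sets)
    then show ?thesis by (intro P.Fubini'[symmetric]) simp
  qed
  finally have "(\<integral>\<^sup>+\<omega>. \<integral>\<^sup>+q. Z (\<omega>, q) \<partial>NN \<omega> \<partial>M) = 0" by (simp add: EZ)
  then have "AE \<omega> in M. (\<integral>\<^sup>+q. Z (\<omega>, q) \<partial>NN \<omega>) = 0"
    by (subst (asm) nn_integral_0_iff_AE) (auto intro: compensation(1)[OF Zm])
  then show ?thesis using AE_space
  proof eventually_elim
    case (elim \<omega>)
    have [measurable]: "(\<lambda>q. Z (\<omega>, q)) \<in> borel_measurable borel"
      using measurable_compose[OF Pair_predictable[OF elim(2)] Zm] by simp
    have "AE q in NN \<omega>. Z (\<omega>, q) = 0"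
      using elim(1) by (subst (asm) nn_integral_0_iff_AE) auto
    then show ?case
    proof eventually_elim
      case (elim q)
      have "{p \<in> space borel. fst p < fst q \<and> \<phi> (fst q - fst p) \<noteq> 0} \<in> sets (borel :: (real \<times> real) measure)" by measurable
      then have [measurable]: "{p. fst p < fst q \<and> \<phi> (fst q - fst p) \<noteq> 0} \<in> sets (borel :: (real \<times> real) measure)" by simp
      have "(\<lambda>p. indicator {..<fst q} (fst p) * b (fst q - fst p)) = (indicator {p. fst p < fst q \<and> \<phi> (fst q - fst p) \<noteq> 0} :: real \<times> real \<Rightarrow> ennreal)"
        by (auto simp: b_def indicator_def)
      then show ?case using elim by (simp add: Z_def)
    qed
  qed
qed

lemma AE_regular: "AE \<omega> in M. regular_at \<omega>"
proof (cases "AE x in lborel. \<phi> x = 0")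
  case True
  from AE_space AE_integer_valued AE_graph_null AE_no_null_offspring[OF True]
  show ?thesis by eventually_elim (simp add: regular_at_def)
next
  case False
  from AE_space AE_integer_valued AE_graph_null
  show ?thesis by eventually_elim (use False in \<open>simp add: regular_at_def\<close>)
qed

text \<open>Integrality is known inside boxes only, so it is applied to each box and the boxes are
  then exhausted.\<close>

lemma integer_valued_lt_1:
  assumes "integer_valued_at \<omega>" "A \<in> sets borel" "emeasure (NN \<omega>) A < 1"
  shows "emeasure (NN \<omega>) A = 0"
proof -
  have "emeasure (NN \<omega>) (box_upto k \<inter> A) = 0" for k
  proof -
    obtain j :: nat where j: "emeasure (NN \<omega>) (box_upto k \<inter> A) = of_nat j"
      using assms(1,2) unfolding integer_valued_at_def by blast
    have "emeasure (NN \<omega>) (box_upto k \<inter> A) \<le> emeasure (NN \<omega>) A"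
      using assms(2) by (intro emeasure_mono) auto
    then have lt: "of_nat j < (1 :: ennreal)" unfolding j using assms(3) by (rule le_less_trans)
    have "j = 0"
    proof (rule ccontr)
      assume "j \<noteq> 0"
      then have "(of_nat 1 :: ennreal) \<le> of_nat j" by (intro of_nat_mono) simp
      then show False using lt by (simp add: not_le[symmetric])
    qed
    then show ?thesis using j by simp
  qed
  then show ?thesis using SUP_box_upto[of "NN \<omega>" A] assms(2) by simp
qed

text \<open>If infinitely many accepted points lay before \<open>T\<close>, their kernels could not sum up to a
  finite function: on a set of times where the sum is bounded, which can be chosen to cover at least
  half of every translate of \<open>{x. x \<le> b \<and> c \<le> \<phi> x}\<close>, its integral would be infinite.\<close>

lemma finite_points_before:
  assumes nz: "\<not> (AE x in lborel. \<phi> x = 0)" and [measurable]: "D \<in> sets borel"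
    and fin: "\<And>t. 0 \<le> t \<Longrightarrow> (\<integral>\<^sup>+p. \<phi> (t - fst p) * indicator D p \<partial>NN \<omega>) < \<infinity>"
  shows "emeasure (NN \<omega>) (D \<inter> {..T} \<times> UNIV) < \<infinity>"
proof -
  obtain b c where c: "0 < c" and pos: "emeasure lborel {x. x \<le> b \<and> ennreal c \<le> \<phi> x} \<noteq> 0"
    using not_AE_zero_obtains[OF phi_measurable nz] by blast
  define K where "K = {x. x \<le> b \<and> ennreal c \<le> \<phi> x}"
  have "{x \<in> space borel. x \<le> b \<and> ennreal c \<le> \<phi> x} \<in> sets borel" by measurable
  then have [measurable]: "K \<in> sets borel" by (simp add: K_def)
  have K: "0 < x" "x \<le> b" "ennreal c \<le> \<phi> x" if "x \<in> K" for x
  proof -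
    show "x \<le> b" "ennreal c \<le> \<phi> x" using that by (auto simp: K_def)
    then have "\<phi> x \<noteq> 0" using c by auto
    then show "0 < x" using phi_nonpos[of x] by linarith
  qed
  have "K \<subseteq> {0..b}" using K by force
  then have "emeasure lborel K \<le> emeasure lborel {0..b}" by (intro emeasure_mono) auto
  also have "\<dots> < \<infinity>" by (cases "0 \<le> b") auto
  finally obtain r where r: "emeasure lborel K = ennreal r" "0 < r"
    using pos unfolding K_def[symmetric] by (cases "emeasure lborel K") (auto simp: less_le)
  define B where "B = D \<inter> {..T} \<times> UNIV"
  have [measurable]: "B \<in> sets borel" unfolding B_def by measurable
  interpret sigma_finite_measure "NN \<omega>" by (rule sigma_finite_NN)
  interpret P: pair_sigma_finite lborel "NN \<omega>" ..
  \<comment> \<open>\<open>F t\<close> counts the points of \<open>B\<close> whose gap to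
    \<open>t\<close> lies in \<open>K\<close>. Each contributes at least \<open>c\<close> to the
    finite kernel sum at \<open>t\<close>, so \<open>F t\<close> is finite.\<close>
  define F where "F t = (\<integral>\<^sup>+p. indicator K (t - fst p) * indicator B p \<partial>NN \<omega>)" for t
  have [measurable]: "F \<in> borel_measurable borel" unfolding F_def by measurable
  have Ffin: "F t < \<infinity>" if "0 \<le> t" for t
  proof -
    have "ennreal c * F t = (\<integral>\<^sup>+p. ennreal c * (indicator K (t - fst p) * indicator B p) \<partial>NN \<omega>)"
      unfolding F_def by (simp add: nn_integral_cmult)
    also have "\<dots> \<le> (\<integral>\<^sup>+p. \<phi> (t - fst p) * indicator D p \<partial>NN \<omega>)"
      by (intro nn_integral_mono) (auto simp: indicator_def B_def K)
    also have "\<dots> < \<infinity>" by (rule fin[OF that])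
    finally show ?thesis using c by (auto simp: ennreal_mult_less_top)
  qed
  \<comment> \<open>The window contains every translate of \<open>K\<close> by some s in (0, T], as
    \<open>K\<close> lies in (0, b]. The sets \<open>H k\<close> decrease to the empty set, so one
    of them has measure below r/2 and can remove at most half of a translate.\<close>
  define I where "I = {0..T + b}"
  define H where "H k = {t\<in>I. of_nat k < F t}" for k :: nat
  have Hm[measurable]: "H k \<in> sets borel" for k
  proof -
    have "{t\<in>space borel. t \<in> I \<and> of_nat k < F t} \<in> sets borel" unfolding I_def by measurable
    then show ?thesis by (simp add: H_def)
  qed
  have Ifin: "emeasure lborel I < \<infinity>" unfolding I_def by (cases "0 \<le> T + b") auto
  have Hfin: "emeasure lborel (H k) \<noteq> \<infinity>" for k
  proof -
    have "emeasure lborel (H k) \<le> emeasure lborel I" by (intro emeasure_mono) (auto simp: H_def I_def)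
    then show ?thesis using Ifin by (auto simp: top_unique)
  qed
  have "(INF k. emeasure lborel (H k)) = emeasure lborel (\<Inter>k. H k)"
  proof (rule INF_emeasure_decseq)
    show "decseq H"
    proof (rule decseq_SucI)
      fix k
      have "(of_nat k :: ennreal) \<le> of_nat (Suc k)" by (intro of_nat_mono) simp
      then show "H (Suc k) \<subseteq> H k" unfolding H_def by (blast intro: le_less_trans)
    qed
  qed (use Hfin in auto)
  also have "(\<Inter>k. H k) = {}"
  proof -
    have "\<exists>k. t \<notin> H k" for t
    proof (cases "t \<in> I")
      case True
      then have "F t < \<top>" using Ffin[of t] by (simp add: I_def)
      then obtain k where "F t < of_nat k" using ennreal_Ex_less_of_nat by blast
      then show ?thesis by (intro exI[of _ k]) (auto simp: H_def)
    qed (auto simp: H_def)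
    then show ?thesis by blast
  qed
  finally have "(INF k. emeasure lborel (H k)) < ennreal (r / 2)" using r by simp
  then obtain k where k: "emeasure lborel (H k) < ennreal (r / 2)" by (auto simp: INF_less_iff)
  define G where "G = {t\<in>I. F t \<le> of_nat k}"
  have "{t\<in>space borel. t \<in> I \<and> F t \<le> of_nat k} \<in> sets borel" unfolding I_def by measurable
  then have [measurable]: "G \<in> sets borel" by (simp add: G_def)
  have half: "ennreal (r / 2) \<le> (\<integral>\<^sup>+t. indicator G t * indicator K (t - s) \<partial>lborel)" if s: "0 < s" "s \<le> T" for s
  proof -
    have "ennreal (r / 2) + ennreal (r / 2) = (\<integral>\<^sup>+t. indicator K (t - s) \<partial>lborel)"
      using r by (simp add: nn_integral_shift ennreal_plus[symmetric] del: ennreal_plus)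
    also have "\<dots> \<le> (\<integral>\<^sup>+t. indicator G t * indicator K (t - s) + indicator (H k) t \<partial>lborel)"
    proof (rule nn_integral_mono)
      fix t
      have "t \<in> I" if "t - s \<in> K" using K[OF that] s by (auto simp: I_def)
      then show "indicator K (t - s) \<le> (indicator G t * indicator K (t - s) + indicator (H k) t :: ennreal)"
        by (auto simp: indicator_def G_def H_def not_le)
    qed
    also have "\<dots> = (\<integral>\<^sup>+t. indicator G t * indicator K (t - s) \<partial>lborel) + emeasure lborel (H k)"
      by (simp add: nn_integral_add)
    finally have le: "ennreal (r / 2) + ennreal (r / 2) \<le> (\<integral>\<^sup>+t. indicator G t * indicator K (t - s) \<partial>lborel) + emeasure lborel (H k)" .
    show ?thesis
    proof (rule ccontr)
      assume "\<not> ?thesis"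
      then have "(\<integral>\<^sup>+t. indicator G t * indicator K (t - s) \<partial>lborel) + emeasure lborel (H k) < ennreal (r / 2) + ennreal (r / 2)"
        using k by (intro add_strict_mono) auto
      then show False using le by (simp add: not_le[symmetric])
    qed
  qed
  have "ennreal (r / 2) * emeasure (NN \<omega>) B = (\<integral>\<^sup>+p. ennreal (r / 2) * indicator B p \<partial>NN \<omega>)"
    by (simp add: nn_integral_cmult)
  also have "\<dots> \<le> (\<integral>\<^sup>+p. (\<integral>\<^sup>+t. indicator G t * indicator K (t - fst p) \<partial>lborel) * indicator B p \<partial>NN \<omega>)"
  proof (rule nn_integral_mono_AE)
    show "AE p in NN \<omega>. ennreal (r / 2) * indicator B p \<le> (\<integral>\<^sup>+t. indicator G t * indicator K (t - fst p) \<partial>lborel) * indicator B p"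
      using AE_NN_quadrant
      by eventually_elim (auto simp: indicator_def B_def open_quadrant_def intro!: half[unfolded indicator_def])
  qed
  also have "\<dots> = (\<integral>\<^sup>+p. \<integral>\<^sup>+t. indicator G t * (indicator K (t - fst p) * indicator B p) \<partial>lborel \<partial>NN \<omega>)"
    by (intro nn_integral_cong) (simp add: nn_integral_multc[symmetric] mult.assoc)
  also have "\<dots> = (\<integral>\<^sup>+t. \<integral>\<^sup>+p. indicator G t * (indicator K (t - fst p) * indicator B p) \<partial>NN \<omega> \<partial>lborel)"
    by (rule P.Fubini') measurable
  also have "\<dots> = (\<integral>\<^sup>+t. indicator G t * F t \<partial>lborel)"
    unfolding F_def by (intro nn_integral_cong nn_integral_cmult) measurable
  also have "\<dots> \<le> (\<integral>\<^sup>+t. of_nat k * indicator I t \<partial>lborel)"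
    by (intro nn_integral_mono) (auto simp: indicator_def G_def)
  also have "\<dots> = of_nat k * emeasure lborel I" by (simp add: I_def nn_integral_cmult)
  also have "\<dots> < \<infinity>" using Ifin by (simp add: ennreal_mult_less_top of_nat_less_top)
  finally show ?thesis using r(2) unfolding B_def[symmetric] by (auto simp: ennreal_mult_less_top)
qed

lemma pathwise_uniqueness:
  fixes lam :: "real \<Rightarrow> real"
  assumes reg: "regular_at \<omega>" and mu: "0 < \<mu>"
    and lam_m: "(\<lambda>t. lam (max 0 t)) \<in> borel_measurable borel"
    and eq: "\<And>t. 0 \<le> t \<Longrightarrow> ennreal (lam t) = \<mu> + (\<integral>\<^sup>+p. \<phi> (t - fst p) * indicator {p. snd p \<le> lam (fst p)} p \<partial>NN \<omega>)"
  shows "AE p in NN \<omega>. snd p \<le> lam (fst p) \<longleftrightarrow> p \<in> accepted_lim \<omega>"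
proof -
  have w: "\<omega> \<in> space M" using reg by (simp add: regular_at_def)
  note [measurable] = lam_m accepted_sets[OF w] accepted_lim_sets[OF w] intensity_lim_path_measurable[OF w]
  \<comment> \<open>\<open>lam\<close> is given for nonnegative times; composing with
    \<open>max 0\<close> makes it Borel on the whole line and changes nothing at the points of
    \<open>NN \<omega>\<close>, whose times are positive.\<close>
  define D where "D = {p. snd p \<le> lam (max 0 (fst p))}"
  have "{p \<in> space borel. snd p \<le> (\<lambda>t. lam (max 0 t)) (fst p)} \<in> sets borel" by measurable
  then have [measurable]: "D \<in> sets borel" by (simp add: D_def)
  define G where "G = {p. ennreal (snd p) = intensity_lim \<omega> (fst p)}"
  have "{p \<in> space borel. ennreal (snd p) = intensity_lim \<omega> (fst p)} \<in> sets borel" by measurable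
  then have [measurable]: "G \<in> sets borel" by (simp add: G_def)
  have G0: "emeasure (NN \<omega>) G = 0" using reg by (simp add: regular_at_def G_def)
  have Q: "AE p in NN \<omega>. p \<in> open_quadrant" by (rule AE_NN_quadrant)
  have eqD: "ennreal (lam t) = \<mu> + (\<integral>\<^sup>+p. \<phi> (t - fst p) * indicator D p \<partial>NN \<omega>)" if "0 \<le> t" for t
    unfolding eq[OF that]
    using Q by (intro arg_cong[where f="(+) \<mu>"] nn_integral_cong_AE)
      (auto elim!: eventually_mono simp: D_def open_quadrant_def indicator_def max_def)
  \<comment> \<open>Passing to \<open>ennreal\<close> would hide a negative \<open>lam\<close>.
    Positivity, which comes from \<mu>, allows comparisons of marks to be pulled back to the
    reals.\<close>
  have lampos: "0 < lam t" if "0 \<le> t" for t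
  proof -
    have "0 < ennreal (lam t)" unfolding eqD[OF that] using mu by (metis add_pos_nonneg zero_le)
    then show ?thesis by simp
  qed
  \<comment> \<open>The limit is the minimal solution: the iteration starts below
    \<open>lam\<close>, and accepting fewer points gives a smaller intensity.\<close>
  have low: "intensity n \<omega> t \<le> ennreal (lam t)" if "0 \<le> t" for n t
    using that
  proof (induction n arbitrary: t)
    case 0
    then show ?case by (simp add: eqD)
  next
    case (Suc n)
    have "stochint n (\<lambda>u. \<phi> (t - u)) \<omega> \<le> (\<integral>\<^sup>+p. \<phi> (t - fst p) * indicator D p \<partial>NN \<omega>)"
      unfolding stochint_def
    proof (rule nn_integral_mono_AE)
      show "AE p in NN \<omega>. \<phi> (t - fst p) * indicator (accepted n \<omega>) p \<le> \<phi> (t - fst p) * indicator D p"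
        using Q
      proof eventually_elim
        case (elim p)
        then have p: "0 < fst p" by (auto simp: open_quadrant_def)
        have "p \<in> D" if "p \<in> accepted n \<omega>"
        proof -
          have "ennreal (snd p) \<le> ennreal (lam (fst p))"
            using that Suc.IH[of "fst p"] p by (auto simp: accepted_def intro: order_trans)
          then show ?thesis using lampos[of "fst p"] p by (simp add: D_def ennreal_le_iff2)
        qed
        then show ?case by (auto simp: indicator_def)
      qed
    qed
    then show ?case unfolding intensity_Suc eqD[OF Suc.prems] by (rule add_left_mono)
  qed
  have sub: "p \<in> D" if pA: "p \<in> accepted_lim \<omega>" "p \<in> open_quadrant" for p
  proof -
    obtain n where "ennreal (snd p) \<le> intensity n \<omega> (fst p)" using pA(1) unfolding accepted_lim_def accepted_def by blast
    also have p: "0 < fst p" using pA by (auto simp: open_quadrant_def)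
    then have "intensity n \<omega> (fst p) \<le> ennreal (lam (fst p))" by (intro low) simp
    finally show ?thesis using lampos[of "fst p"] p by (simp add: D_def ennreal_le_iff2)
  qed
  define E where "E = (D - accepted_lim \<omega>) \<inter> open_quadrant"
  have [measurable]: "E \<in> sets borel" unfolding E_def by measurable
  have Epos: "0 < fst p" if "p \<in> E" for p using that by (auto simp: E_def open_quadrant_def)
  \<comment> \<open>\<open>h t\<close> is the number of missed points before
    \<open>t\<close>.\<close>
  define h where "h t = emeasure (NN \<omega>) (E \<inter> {..<t} \<times> UNIV)" for t
  have h_mono: "h s \<le> h t" if "s \<le> t" for s t
    unfolding h_def using that by (intro emeasure_mono) auto
  \<comment> \<open>Without missed points before \<open>fst p\<close>, the equations for
    \<open>lam\<close> and for the limit agree at this time. The mark of \<open>p\<close> is at most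
    \<open>lam\<close> and at least every iterate, so it is squeezed onto the graph of
    \<open>intensity_lim\<close>.\<close>
  have inG: "p \<in> G" if p: "p \<in> E" and 0: "h (fst p) = 0" for p
  proof -
    have AEE: "AE x in NN \<omega>. x \<notin> E \<inter> {..<fst p} \<times> UNIV"
      using 0 by (intro AE_not_in) (auto simp: null_sets_def h_def)
    have "(\<integral>\<^sup>+x. \<phi> (fst p - fst x) * indicator D x \<partial>NN \<omega>) = stochint_lim (\<lambda>u. \<phi> (fst p - u)) \<omega>"
      unfolding stochint_lim_def
    proof (rule nn_integral_cong_AE)
      show "AE x in NN \<omega>. \<phi> (fst p - fst x) * indicator D x = \<phi> (fst p - fst x) * indicator (accepted_lim \<omega>) x"
        using AEE Q
      proof eventually_elim
        case (elim x)
        show ?case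
        proof (cases "fst x < fst p")
          case True
          then have "x \<notin> E" using elim(1) by (auto simp: mem_Times_iff)
          then have "x \<in> D \<longleftrightarrow> x \<in> accepted_lim \<omega>" using sub[of x] elim(2) by (auto simp: E_def)
          then show ?thesis by (simp add: indicator_def)
        qed (simp add: phi_nonpos)
      qed
    qed
    then have l: "ennreal (lam (fst p)) = intensity_lim \<omega> (fst p)"
      using Epos[OF p] by (simp add: eqD intensity_lim_eq[OF w])
    have "ennreal (snd p) \<le> ennreal (lam (fst p))"
      using p Epos[OF p] by (intro ennreal_leI) (simp add: E_def D_def)
    moreover have "intensity_lim \<omega> (fst p) \<le> ennreal (snd p)"
      unfolding intensity_lim_def
    proof (rule SUP_least)
      fix n
      have "p \<notin> accepted n \<omega>" using p by (auto simp: E_def accepted_lim_def)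
      then show "intensity n \<omega> (fst p) \<le> ennreal (snd p)" by (simp add: accepted_def)
    qed
    ultimately show ?thesis unfolding G_def using l by simp
  qed
  have "emeasure (NN \<omega>) E = 0"
  proof (cases "AE x in lborel. \<phi> x = 0")
    case True
    then have "AE q in NN \<omega>. emeasure (NN \<omega>) {p. fst p < fst q \<and> \<phi> (fst q - fst p) \<noteq> 0} = 0"
      using reg by (simp add: regular_at_def)
    \<comment> \<open>At such a \<open>q\<close> the kernel sum vanishes and the intensity is just
      \<mu>, so a point below \<open>lam\<close> is already accepted at index 0.\<close>
    then have "AE q in NN \<omega>. q \<notin> E"
    proof eventually_elim
      case (elim q)
      show ?case
      proof
        assume q: "q \<in> E"
        have "{p \<in> space borel. fst p < fst q \<and> \<phi> (fst q - fst p) \<noteq> 0} \<in> sets (borel :: (real \<times> real) measure)" by measurable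
        then have "AE p in NN \<omega>. p \<notin> {p. fst p < fst q \<and> \<phi> (fst q - fst p) \<noteq> 0}"
          using elim by (intro AE_not_in) (auto simp: null_sets_def)
        then have "AE p in NN \<omega>. \<phi> (fst q - fst p) * indicator D p = 0"
        proof eventually_elim
          case (elim p)
          then show ?case by (cases "fst p < fst q") (auto simp: phi_nonpos)
        qed
        then have "(\<integral>\<^sup>+p. \<phi> (fst q - fst p) * indicator D p \<partial>NN \<omega>) = (\<integral>\<^sup>+p. 0 \<partial>NN \<omega>)"
          by (rule nn_integral_cong_AE)
        then have "ennreal (lam (fst q)) = \<mu>" using Epos[OF q] by (simp add: eqD)
        moreover have "ennreal (snd q) \<le> ennreal (lam (fst q))"
          using q Epos[OF q] by (intro ennreal_leI) (simp add: E_def D_def)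
        ultimately have "q \<in> accepted 0 \<omega>" by (simp add: accepted_def)
        then show False using q by (auto simp: E_def accepted_lim_def)
      qed
    qed
    then show ?thesis using AE_iff_null_sets[of E "NN \<omega>"] by (auto simp: null_sets_def)
  next
    case False
    have fin: "(\<integral>\<^sup>+p. \<phi> (t - fst p) * indicator D p \<partial>NN \<omega>) < \<infinity>" if "0 \<le> t" for t
    proof -
      have "(\<integral>\<^sup>+p. \<phi> (t - fst p) * indicator D p \<partial>NN \<omega>) \<le> ennreal (lam t)"
        unfolding eqD[OF that] by simp
      then show ?thesis by (rule le_less_trans) simp
    qed
    have lf: "emeasure (NN \<omega>) (D \<inter> {..T} \<times> UNIV) < \<infinity>" for T
      by (rule finite_points_before[OF False _ fin]) auto
    show ?thesis
    proof (rule ccontr)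
      assume ne: "emeasure (NN \<omega>) E \<noteq> 0"
      have "\<exists>n::nat. h (real n) \<noteq> 0"
      proof (rule ccontr)
        assume "\<not> ?thesis"
        then have "emeasure (NN \<omega>) (\<Union>n. E \<inter> {..<real n} \<times> UNIV) = 0"
          unfolding h_def by (intro emeasure_UN_eq_0) auto
        also have "(\<Union>n. E \<inter> {..<real n} \<times> UNIV) = E"
          using reals_Archimedean2 by (auto simp: mem_Times_iff)
        finally show False using ne by simp
      qed
      then obtain T :: nat where T: "h (real T) \<noteq> 0" by blast
      \<comment> \<open>The supremum \<tau> of \<open>S\<close> stands for the time of the first
        missed point. No missed points lie before \<tau>, those at \<tau> lie on the null graph, and
        local finiteness pushes the count shortly after \<tau> below 1, hence to 0, against the
        choice of \<tau>.\<close>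
      define S where "S = {t. 0 \<le> t \<and> h t = 0}"
      have "E \<inter> {..<0} \<times> UNIV = {}" using Epos by fastforce
      then have S0: "0 \<in> S" by (simp add: S_def h_def)
      have bnd: "t \<le> real T" if "t \<in> S" for t
      proof (rule ccontr)
        assume "\<not> t \<le> real T"
        then have "h (real T) \<le> h t" by (intro h_mono) simp
        then show False using that T by (simp add: S_def)
      qed
      then have bdd: "bdd_above S" by (auto simp: bdd_above_def)
      define \<tau> where "\<tau> = Sup S"
      have \<tau>0: "0 \<le> \<tau>" unfolding \<tau>_def by (rule cSup_upper[OF S0 bdd])
      have before: "h t = 0" if tb: "t < \<tau>" for t
      proof -
        have "S \<noteq> {}" using S0 by blast
        then have "\<exists>s\<in>S. t < s" using tb unfolding \<tau>_def by (rule less_cSupD)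
        then obtain s where "s \<in> S" "t < s" by blast
        then show ?thesis using h_mono[of t s] by (simp add: S_def)
      qed
      have h\<tau>: "h \<tau> = 0"
      proof -
        have "E \<inter> {..<\<tau>} \<times> UNIV = (\<Union>n. E \<inter> {..\<tau> - inverse (real (Suc n))} \<times> UNIV)"
          by (subst lessThan_eq_UN_atMost) auto
        moreover have "emeasure (NN \<omega>) (\<Union>n. E \<inter> {..\<tau> - inverse (real (Suc n))} \<times> UNIV) = 0"
        proof (intro emeasure_UN_eq_0)
          fix n
          define r where "r = inverse (real (Suc n))"
          have "0 < r" by (simp add: r_def)
          then have "emeasure (NN \<omega>) (E \<inter> {..\<tau> - r} \<times> UNIV) \<le> h (\<tau> - r / 2)"
            unfolding h_def by (intro emeasure_mono) auto
          then show "emeasure (NN \<omega>) (E \<inter> {..\<tau> - inverse (real (Suc n))} \<times> UNIV) = 0"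
            using before[of "\<tau> - r / 2"] \<open>0 < r\<close> by (simp add: r_def)
        qed auto
        ultimately show ?thesis by (simp add: h_def)
      qed
      have "E \<inter> {..\<tau>} \<times> UNIV \<subseteq> G"
      proof
        fix p assume p: "p \<in> E \<inter> {..\<tau>} \<times> UNIV"
        then have "h (fst p) \<le> h \<tau>" by (intro h_mono) (auto simp: mem_Times_iff)
        then show "p \<in> G" using p h\<tau> by (intro inG) auto
      qed
      then have "emeasure (NN \<omega>) (E \<inter> {..\<tau>} \<times> UNIV) \<le> emeasure (NN \<omega>) G" by (intro emeasure_mono) auto
      then have at0: "emeasure (NN \<omega>) (E \<inter> {..\<tau>} \<times> UNIV) = 0" by (simp add: G0)
      define U where "U n = E \<inter> {..<\<tau> + inverse (real (Suc n))} \<times> UNIV" for n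
      have [measurable]: "U n \<in> sets borel" for n unfolding U_def by measurable
      have inv_le: "inverse (real (Suc n)) \<le> 1" for n by (simp add: inverse_le_1_iff)
      have Ufin: "emeasure (NN \<omega>) (U n) \<noteq> \<infinity>" for n
      proof -
        have "U n \<subseteq> D \<inter> {..\<tau> + 1} \<times> UNIV"
          using inv_le[of n] by (auto simp: U_def E_def)
        then have "emeasure (NN \<omega>) (U n) \<le> emeasure (NN \<omega>) (D \<inter> {..\<tau> + 1} \<times> UNIV)"
          by (intro emeasure_mono) auto
        then show ?thesis using lf[of "\<tau> + 1"] by (auto simp: top_unique)
      qed
      have "(INF n. emeasure (NN \<omega>) (U n)) = emeasure (NN \<omega>) (\<Inter>n. U n)"
      proof (rule INF_emeasure_decseq)
        show "decseq U"
        proof (rule decseq_SucI)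
          fix n
          have "inverse (real (Suc (Suc n))) \<le> inverse (real (Suc n))" by (intro le_imp_inverse_le) auto
          then show "U (Suc n) \<subseteq> U n" unfolding U_def by (intro Int_mono Sigma_mono order_refl) simp
        qed
      qed (use Ufin in auto)
      also have "(\<Inter>n. U n) = E \<inter> {..\<tau>} \<times> UNIV"
        unfolding U_def by (subst atMost_eq_INT_lessThan) auto
      finally have "(INF n. emeasure (NN \<omega>) (U n)) < 1" by (simp add: at0)
      then obtain n where "emeasure (NN \<omega>) (U n) < 1" by (auto simp: INF_less_iff)
      then have "emeasure (NN \<omega>) (U n) = 0"
        using reg by (intro integer_valued_lt_1) (auto simp: regular_at_def)
      then have "\<tau> + inverse (real (Suc n)) \<in> S" using \<tau>0 by (simp add: S_def h_def U_def)
      then have "\<tau> + inverse (real (Suc n)) \<le> \<tau>" unfolding \<tau>_def by (rule cSup_upper[OF _ bdd])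
      moreover have "0 < inverse (real (Suc n))" by simp
      ultimately show False by linarith
    qed
  qed
  then have "AE p in NN \<omega>. p \<notin> E" by (intro AE_not_in) (auto simp: null_sets_def)
  with Q show ?thesis
  proof eventually_elim
    case (elim p)
    then have "0 < fst p" by (auto simp: open_quadrant_def)
    then have "snd p \<le> lam (fst p) \<longleftrightarrow> p \<in> D" by (simp add: D_def)
    then show ?case using elim sub[of p] by (auto simp: E_def)
  qed
qed

end

section \<open>Identification with the convolution series\<close>

text \<open>The bridge to the closed-interval integrals of the theorem. \<open>k\<close> is compared
  with the measurable \<open>h\<close> on the open interval only, because \<open>Psi\<close> is
  identified with \<open>resolvent_lim\<close> at positive arguments; the end points are
  null.\<close>

lemma nn_integral_pos_lebesgue_interval:
  fixes h k :: "real \<Rightarrow> ennreal"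
  assumes [measurable]: "h \<in> borel_measurable borel" and "0 \<le> a"
    and eq: "\<And>v. a < v \<Longrightarrow> v < b \<Longrightarrow> h v = k v"
  shows "(\<integral>\<^sub>0v. indicator {..<b} v * (indicator {a<..} v * h v)) = (\<integral>\<^sup>+v\<in>{a..b}. k v \<partial>lborel)"
proof -
  have "(\<integral>\<^sub>0v. indicator {..<b} v * (indicator {a<..} v * h v))
    = (\<integral>\<^sup>+v. indicator {0<..} v * (indicator {..<b} v * (indicator {a<..} v * h v)) \<partial>lborel)"
    by (rule nn_integral_pos_lebesgue) measurable
  also have "\<dots> = (\<integral>\<^sup>+v\<in>{a..b}. k v \<partial>lborel)"
  proof (rule nn_integral_cong_AE)
    have "AE v in lborel. v \<noteq> a" "AE v in lborel. v \<noteq> b" by (rule AE_lborel_singleton)+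
    then show "AE v in lborel. indicator {0<..} v * (indicator {..<b} v * (indicator {a<..} v * h v)) = k v * indicator {a..b} v"
      by eventually_elim (use eq \<open>0 \<le> a\<close> in \<open>auto simp: indicator_def\<close>)
  qed
  finally show ?thesis .
qed

lemma nn_integral_pos_lebesgue_interval_0:
  fixes h k :: "real \<Rightarrow> ennreal"
  assumes [measurable]: "h \<in> borel_measurable borel"
    and eq: "\<And>v. 0 < v \<Longrightarrow> v < b \<Longrightarrow> h v = k v"
  shows "(\<integral>\<^sub>0v. indicator {..<b} v * h v) = (\<integral>\<^sup>+v\<in>{0..b}. k v \<partial>lborel)"
proof -
  have "(\<integral>\<^sub>0v. indicator {..<b} v * h v) = (\<integral>\<^sub>0v. indicator {..<b} v * (indicator {0<..} v * h v))"
    using AE_pos_lebesgue by (intro nn_integral_cong_AE) (auto elim!: eventually_mono)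
  then show ?thesis using nn_integral_pos_lebesgue_interval[OF assms(1) order_refl eq] by simp
qed

lemma nn_integral_pos_lebesgue_reflect:
  fixes h :: "real \<Rightarrow> ennreal"
  assumes [measurable]: "h \<in> borel_measurable borel" and h: "\<And>x. x \<le> 0 \<Longrightarrow> h x = 0"
  shows "(\<integral>\<^sub>0s. h (v - s)) = (\<integral>\<^sub>0x. indicator {..<v} x * h x)"
proof -
  have "(\<integral>\<^sub>0s. h (v - s)) = (\<integral>\<^sup>+s. indicator {0<..} s * h (v - s) \<partial>lborel)"
    by (rule nn_integral_pos_lebesgue) measurable
  also have "\<dots> = (\<integral>\<^sup>+x. indicator {0<..} (v + (-1) * x) * h (v - (v + (-1) * x)) \<partial>lborel)"
    by (subst nn_integral_real_affine[where c="-1" and t="v"]) auto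
  also have "\<dots> = (\<integral>\<^sup>+x. indicator {0<..} x * (indicator {..<v} x * h x) \<partial>lborel)"
    by (intro nn_integral_cong) (auto simp: indicator_def h)
  also have "\<dots> = (\<integral>\<^sub>0x. indicator {..<v} x * h x)"
    by (rule nn_integral_pos_lebesgue[symmetric]) measurable
  finally show ?thesis .
qed

context hawkes_iteration
begin

primrec conv_power :: "nat \<Rightarrow> real \<Rightarrow> ennreal" where
  "conv_power 0 x = \<phi> x"
| "conv_power (Suc k) x = (\<integral>\<^sub>0s. \<phi> (x - s) * conv_power k s)"

lemma conv_power_measurable[measurable]: "conv_power k \<in> borel_measurable borel"
proof (induction k)
  case (Suc k)
  note [measurable] = Suc
  show ?case unfolding conv_power.simps[abs_def] by measurable
qed (simp add: conv_power.simps[abs_def])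

lemma resolvent_sum: "resolvent n x = (\<Sum>k<n. conv_power k x)"
proof (induction n arbitrary: x)
  case (Suc n)
  have "resolvent (Suc n) x = conv_power 0 x + (\<Sum>k<n. conv_power (Suc k) x)"
    by (simp add: Suc sum_distrib_left nn_integral_sum)
  then show ?case by (simp only: sum.lessThan_Suc_shift)
qed simp

lemma resolvent_lim_suminf: "resolvent_lim x = (\<Sum>k. conv_power k x)"
  by (simp add: resolvent_lim_def resolvent_sum suminf_eq_SUP)

lemma resolvent_lim_convolution:
  assumes "0 < w"
  shows "\<phi> (v - w) + (\<integral>\<^sub>0u. \<phi> (v - u) * resolvent_lim (u - w)) = resolvent_lim (v - w)"
proof -
  have "\<phi> (v - w) + (\<integral>\<^sub>0u. \<phi> (v - u) * resolvent_lim (u - w)) = (SUP n. resolvent (Suc n) (v - w))"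
    using resolvent_integral_SUP[of "\<lambda>u. \<phi> (v - u)" w] by (simp add: resolvent_convolution[OF assms] del: resolvent.simps)
  also have "\<dots> = resolvent_lim (v - w)"
    unfolding resolvent_lim_def
  proof (rule antisym)
    show "(SUP n. resolvent n (v - w)) \<le> (SUP n. resolvent (Suc n) (v - w))"
      by (intro SUP_mono') (rule resolvent_mono, simp)
    show "(SUP n. resolvent (Suc n) (v - w)) \<le> (SUP n. resolvent n (v - w))"
      by (intro SUP_least SUP_upper) simp
  qed
  finally show ?thesis .
qed

text \<open>Convolution with \<phi> commutes with integration from 0: after a swap, the substitution
  s = v + w - x moves the running upper limit from one factor to the other.\<close>

lemma phi_convolution_integral:
  assumes [measurable]: "f \<in> borel_measurable borel"
  shows "(\<integral>\<^sub>0s. \<phi> (v - s) * (\<integral>\<^sub>0w. indicator {..<s} w * f w))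
    = (\<integral>\<^sub>0x. indicator {..<v} x * (\<integral>\<^sub>0s. \<phi> (x - s) * f s))"
proof -
  have inner: "(\<integral>\<^sub>0s. \<phi> (v - s) * indicator {..<s} w) = (\<integral>\<^sub>0x. indicator {..<v} x * \<phi> (x - w))"
    if w: "0 < w" for w
  proof -
    have "(\<integral>\<^sub>0s. \<phi> (v - s) * indicator {..<s} w) = (\<integral>\<^sup>+s. indicator {0<..} s * (\<phi> (v - s) * indicator {..<s} w) \<partial>lborel)"
      by (rule nn_integral_pos_lebesgue) measurable
    also have "\<dots> = (\<integral>\<^sup>+x. indicator {0<..} (v + w + (-1) * x) * (\<phi> (v - (v + w + (-1) * x)) * indicator {..<v + w + (-1) * x} w) \<partial>lborel)"
      by (subst nn_integral_real_affine[where c="-1" and t="v + w"]) auto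
    also have "\<dots> = (\<integral>\<^sup>+x. indicator {0<..} x * (indicator {..<v} x * \<phi> (x - w)) \<partial>lborel)"
      using w by (intro nn_integral_cong) (auto simp: indicator_def phi_nonpos)
    also have "\<dots> = (\<integral>\<^sub>0x. indicator {..<v} x * \<phi> (x - w))"
      by (rule nn_integral_pos_lebesgue[symmetric]) measurable
    finally show ?thesis .
  qed
  have "(\<integral>\<^sub>0s. \<phi> (v - s) * (\<integral>\<^sub>0w. indicator {..<s} w * f w))
    = (\<integral>\<^sub>0s. (\<integral>\<^sub>0w. f w * (\<phi> (v - s) * indicator {..<s} w)))"
    by (intro nn_integral_cong) (simp add: nn_integral_cmult[symmetric] ac_simps)
  also have "\<dots> = (\<integral>\<^sub>0w. (\<integral>\<^sub>0s. f w * (\<phi> (v - s) * indicator {..<s} w)))"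
    by (rule nn_integral_swap_pos_lebesgue) measurable
  also have "\<dots> = (\<integral>\<^sub>0w. (\<integral>\<^sub>0x. f w * (indicator {..<v} x * \<phi> (x - w))))"
  proof (rule nn_integral_cong_AE)
    show "AE w in pos_lebesgue. (\<integral>\<^sub>0s. f w * (\<phi> (v - s) * indicator {..<s} w))
      = (\<integral>\<^sub>0x. f w * (indicator {..<v} x * \<phi> (x - w)))"
      using AE_pos_lebesgue by eventually_elim (simp add: nn_integral_cmult inner)
  qed
  also have "\<dots> = (\<integral>\<^sub>0x. (\<integral>\<^sub>0w. f w * (indicator {..<v} x * \<phi> (x - w))))"
    by (rule nn_integral_swap_pos_lebesgue) measurable
  also have "\<dots> = (\<integral>\<^sub>0x. indicator {..<v} x * (\<integral>\<^sub>0s. \<phi> (x - s) * f s))"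
    by (intro nn_integral_cong) (simp add: nn_integral_cmult[symmetric] ac_simps)
  finally show ?thesis .
qed

text \<open>The formula for the mean intensity is a hypothesis so that the lemma can serve inside
  its inductive proof and, afterwards, for the mean of \<open>stochint_lim\<close>.\<close>

lemma mean_stochint_phi:
  assumes "\<And>v. mean_intensity n v = \<mu> * (1 + (\<integral>\<^sub>0x. indicator {..<v} x * resolvent n x))"
  shows "mean_stochint n (\<lambda>u. \<phi> (v - u)) = \<mu> * (\<integral>\<^sub>0x. indicator {..<v} x * resolvent (Suc n) x)"
proof -
  have "mean_stochint n (\<lambda>u. \<phi> (v - u))
    = (\<integral>\<^sub>0s. \<mu> * (\<phi> (v - s) + \<phi> (v - s) * (\<integral>\<^sub>0x. indicator {..<s} x * resolvent n x)))"
    unfolding mean_stochint_def assms by (intro nn_integral_cong) (simp add: distrib_left ac_simps)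
  also have "\<dots> = \<mu> * ((\<integral>\<^sub>0s. \<phi> (v - s))
      + (\<integral>\<^sub>0s. \<phi> (v - s) * (\<integral>\<^sub>0x. indicator {..<s} x * resolvent n x)))"
    by (simp add: nn_integral_cmult nn_integral_add)
  also have "\<dots> = \<mu> * (\<integral>\<^sub>0x. indicator {..<v} x * resolvent (Suc n) x)"
    by (simp add: phi_convolution_integral nn_integral_pos_lebesgue_reflect[OF phi_measurable phi_nonpos] distrib_left nn_integral_add)
  finally show ?thesis .
qed

lemma mean_intensity_resolvent:
  "mean_intensity n v = \<mu> * (1 + (\<integral>\<^sub>0x. indicator {..<v} x * resolvent n x))"
proof (induction n arbitrary: v)
  case 0
  then show ?case by (simp add: mean_intensity_0)
next
  case (Suc n)
  show ?case unfolding mean_intensity_Suc mean_stochint_phi[OF Suc] by (simp add: distrib_left)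
qed

lemma resolvent_integral_lim:
  "(SUP n. \<integral>\<^sub>0x. indicator {..<v} x * resolvent n x) = (\<integral>\<^sub>0x. indicator {..<v} x * resolvent_lim x)"
proof -
  have "(\<integral>\<^sub>0x. indicator {..<v} x * resolvent_lim x) = (\<integral>\<^sub>0x. (SUP n. indicator {..<v} x * resolvent n x))"
    by (simp add: resolvent_lim_def SUP_mult_left_ennreal)
  also have "\<dots> = (SUP n. \<integral>\<^sub>0x. indicator {..<v} x * resolvent n x)"
    by (intro nn_integral_monotone_convergence_SUP) (auto simp: incseq_def le_fun_def intro!: mult_left_mono resolvent_mono)
  finally show ?thesis ..
qed

lemma mean_intensity_lim_resolvent:
  "mean_intensity_lim v = \<mu> * (1 + (\<integral>\<^sub>0x. indicator {..<v} x * resolvent_lim x))"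
  unfolding mean_intensity_lim_SUP mean_intensity_resolvent resolvent_integral_lim[symmetric]
  by (simp add: SUP_mult_left_ennreal[symmetric] ennreal_SUP_add_right[symmetric])

lemma nn_integral_stochint_lim_phi:
  "(\<integral>\<^sup>+\<omega>. stochint_lim (\<lambda>u. \<phi> (s - u)) \<omega> \<partial>M) = \<mu> * (\<integral>\<^sub>0x. indicator {..<s} x * resolvent_lim x)"
proof -
  let ?R = "\<lambda>n. \<integral>\<^sub>0x. indicator {..<s} x * resolvent n x"
  have "(\<integral>\<^sup>+\<omega>. stochint_lim (\<lambda>u. \<phi> (s - u)) \<omega> \<partial>M) = (SUP n. \<mu> * ?R (Suc n))"
    by (simp add: nn_integral_stochint_lim mean_stochint_SUP[symmetric] mean_stochint_phi[OF mean_intensity_resolvent] del: resolvent.simps)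
  also have "\<dots> = \<mu> * (SUP n. ?R (Suc n))" by (simp only: SUP_mult_left_ennreal)
  also have "(SUP n. ?R (Suc n)) = (SUP n. ?R n)"
  proof (rule antisym)
    show "(SUP n. ?R n) \<le> (SUP n. ?R (Suc n))"
      by (intro SUP_mono' nn_integral_mono mult_left_mono resolvent_mono) auto
    show "(SUP n. ?R (Suc n)) \<le> (SUP n. ?R n)"
      by (intro SUP_least SUP_upper) simp
  qed
  finally show ?thesis by (simp add: resolvent_integral_lim)
qed

text \<open>\<open>k\<close> is the value of f + f * Psi before time \<open>s\<close>, known
  explicitly for the two choices of f. Only the factor of \<open>g\<close> is multiplied out; its
  summands give the single and the double integral. \<open>c\<close> is the mean intensity divided
  by \<mu>.\<close>

lemma second_moment_kernel:
  fixes s t :: real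
  assumes [measurable]: "f \<in> borel_measurable borel" "g \<in> borel_measurable borel" "k \<in> borel_measurable borel"
    and k: "\<And>w. 0 < w \<Longrightarrow> f w + (\<integral>\<^sub>0u. f u * resolvent_lim (u - w)) = indicator {..<s} w * k w"
    and g: "\<And>u. t \<le> u \<Longrightarrow> g u = 0"
  defines "c \<equiv> \<lambda>w. 1 + (\<integral>\<^sub>0x. indicator {..<w} x * resolvent_lim x)"
  shows "(\<integral>\<^sup>+\<omega>. stochint_lim f \<omega> * stochint_lim g \<omega> \<partial>M)
    = (\<integral>\<^sup>+\<omega>. stochint_lim f \<omega> \<partial>M) * (\<integral>\<^sup>+\<omega>. stochint_lim g \<omega> \<partial>M)
      + \<mu> * (\<integral>\<^sub>0w. indicator {..<s} w * (g w * k w * c w))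
      + \<mu> * (\<integral>\<^sub>0u. indicator {..<t} u * (\<integral>\<^sub>0w. indicator {..<min s u} w * (g u * resolvent_lim (u - w) * k w * c w)))"
proof -
  have [measurable]: "c \<in> borel_measurable borel" unfolding c_def by measurable
  have "(\<integral>\<^sub>0w. mean_intensity_lim w * ((f w + (\<integral>\<^sub>0u. f u * resolvent_lim (u - w)))
          * (g w + (\<integral>\<^sub>0v. g v * resolvent_lim (v - w)))))
    = (\<integral>\<^sub>0w. \<mu> * (indicator {..<s} w * (g w * k w * c w)
        + (\<integral>\<^sub>0u. indicator {..<t} u * (indicator {..<min s u} w * (g u * resolvent_lim (u - w) * k w * c w)))))"
  proof (rule nn_integral_cong_AE)
    show "AE w in pos_lebesgue. mean_intensity_lim w * ((f w + (\<integral>\<^sub>0u. f u * resolvent_lim (u - w)))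
          * (g w + (\<integral>\<^sub>0v. g v * resolvent_lim (v - w))))
      = \<mu> * (indicator {..<s} w * (g w * k w * c w)
        + (\<integral>\<^sub>0u. indicator {..<t} u * (indicator {..<min s u} w * (g u * resolvent_lim (u - w) * k w * c w))))"
      using AE_pos_lebesgue
    proof eventually_elim
      \<comment> \<open>The cut-offs at \<open>t\<close> and \<open>min s u\<close> can be inserted
        because \<open>g\<close> vanishes from \<open>t\<close> on and \<open>resolvent_lim\<close>
        at nonpositive arguments.\<close>
      case (elim w)
      have "(\<integral>\<^sub>0u. indicator {..<t} u * (indicator {..<min s u} w * (g u * resolvent_lim (u - w) * k w * c w)))
        = (\<integral>\<^sub>0u. indicator {..<s} w * k w * c w * (g u * resolvent_lim (u - w)))"
        by (intro nn_integral_cong) (auto simp: indicator_def g resolvent_lim_nonpos ac_simps not_less)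
      also have "\<dots> = indicator {..<s} w * k w * c w * (\<integral>\<^sub>0u. g u * resolvent_lim (u - w))"
        by (rule nn_integral_cmult) measurable
      finally show ?case
        unfolding k[OF elim] mean_intensity_lim_resolvent
        by (simp add: c_def distrib_left ac_simps)
    qed
  qed
  also have "\<dots> = \<mu> * ((\<integral>\<^sub>0w. indicator {..<s} w * (g w * k w * c w))
    + (\<integral>\<^sub>0w. (\<integral>\<^sub>0u. indicator {..<t} u * (indicator {..<min s u} w * (g u * resolvent_lim (u - w) * k w * c w)))))"
    by (subst nn_integral_cmult, measurable) (subst nn_integral_add, measurable)
  also have "(\<integral>\<^sub>0w. (\<integral>\<^sub>0u. indicator {..<t} u * (indicator {..<min s u} w * (g u * resolvent_lim (u - w) * k w * c w))))
    = (\<integral>\<^sub>0u. (\<integral>\<^sub>0w. indicator {..<t} u * (indicator {..<min s u} w * (g u * resolvent_lim (u - w) * k w * c w))))"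
    by (rule nn_integral_swap_pos_lebesgue) measurable
  also have "\<dots> = (\<integral>\<^sub>0u. indicator {..<t} u * (\<integral>\<^sub>0w. indicator {..<min s u} w * (g u * resolvent_lim (u - w) * k w * c w)))"
    by (intro nn_integral_cong nn_integral_cmult) measurable
  finally show ?thesis
    by (simp add: second_moment_lim distrib_left add.assoc)
qed

section \<open>The convolution series as a limit of resolvents\<close>

lemma Phi_n_conv_power:
  assumes phi: "\<And>x. 0 < x \<Longrightarrow> \<phi> x = ennreal (\<Phi> x)" and "0 < x"
  shows "Phi_n \<Phi> (Suc k) x = conv_power k x"
  using \<open>0 < x\<close>
proof (induction k arbitrary: x)
  case 0
  then show ?case by (simp add: phi)
next
  case (Suc k)
  have "conv_power (Suc k) x = (\<integral>\<^sub>0s. indicator {..<x} s * (\<phi> (x - s) * conv_power k s))"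
    unfolding conv_power.simps by (intro nn_integral_cong) (auto simp: indicator_def phi_nonpos)
  also have "\<dots> = (\<integral>\<^sup>+s\<in>{0..x}. ennreal (\<Phi> (x - s)) * Phi_n \<Phi> (Suc k) s \<partial>lborel)"
    by (rule nn_integral_pos_lebesgue_interval_0) (simp_all add: Suc.IH phi del: Phi_n.simps)
  finally show ?case by simp
qed

lemma Psi_resolvent_lim:
  assumes "\<And>x. 0 < x \<Longrightarrow> \<phi> x = ennreal (\<Phi> x)" and "0 < x"
  shows "resolvent_lim x = Psi \<Phi> x"
proof -
  have eq: "Phi_n \<Phi> (Suc k) x = conv_power k x" for k by (rule Phi_n_conv_power[OF assms])
  have "(\<lambda>k. Phi_n \<Phi> (Suc k) x) sums resolvent_lim x"
    unfolding eq resolvent_lim_suminf by (rule summable_sums) simp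
  \<comment> \<open>The series \<open>Psi\<close> begins with the dummy term
    \<open>Phi_n \<Phi> 0 x\<close>, which \<open>sums_Suc\<close> puts in front with value
    0.\<close>
  from sums_Suc[OF this] show ?thesis unfolding Psi_def by (simp add: sums_iff)
qed

end

text \<open>Moves the strict cut-off of \<open>hawkesX\<close> at time \<open>t\<close> into the
  kernel, which then has the form that \<open>hawkes_iteration\<close> expects.\<close>

definition positive_part_kernel :: "(real \<Rightarrow> real) \<Rightarrow> real \<Rightarrow> ennreal" where
  "positive_part_kernel \<zeta> x = (if 0 < x then ennreal (\<zeta> x) else 0)"

lemma (in poisson_prm) hawkesX_NN:
  assumes "locally_finite_at \<omega>" and z[measurable]: "positive_part_kernel \<zeta> \<in> borel_measurable borel"
    and lam[measurable]: "(\<lambda>t. lam (max 0 t) \<omega>) \<in> borel_measurable borel"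
  shows "hawkesX N lam \<zeta> t \<omega> = (\<integral>\<^sup>+p. positive_part_kernel \<zeta> (t - fst p) * indicator {p. snd p \<le> lam (fst p) \<omega>} p \<partial>NN \<omega>)"
proof -
  have [measurable_cong]: "sets (N \<omega>) = sets borel"
    using assms(1) by (simp add: locally_finite_at_def sets_N)
  define D where "D = {p. snd p \<le> lam (max 0 (fst p)) \<omega>}"
  have "{p \<in> space borel. snd p \<le> (\<lambda>t. lam (max 0 t) \<omega>) (fst p)} \<in> sets borel" by measurable
  then have [measurable]: "D \<in> sets borel" by (simp add: D_def)
  have "hawkesX N lam \<zeta> t \<omega> = (\<integral>\<^sup>+p. indicator open_quadrant p * (positive_part_kernel \<zeta> (t - fst p) * indicator D p) \<partial>N \<omega>)"
    unfolding hawkesX_def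
    by (intro nn_integral_cong) (auto simp: indicator_def open_quadrant_def positive_part_kernel_def D_def)
  also have "\<dots> = (\<integral>\<^sup>+p. positive_part_kernel \<zeta> (t - fst p) * indicator D p \<partial>NN \<omega>)"
    using assms(1) unfolding NN_def by (simp add: nn_integral_density)
  also have "\<dots> = (\<integral>\<^sup>+p. positive_part_kernel \<zeta> (t - fst p) * indicator {p. snd p \<le> lam (fst p) \<omega>} p \<partial>NN \<omega>)"
    using AE_NN_quadrant[of \<omega>]
    by (intro nn_integral_cong_AE) (auto elim!: eventually_mono simp: D_def open_quadrant_def indicator_def)
  finally show ?thesis .
qed

theorem theorem5p4:
  fixes M :: "'a measure" and N :: "'a \<Rightarrow> (real \<times> real) measure"
    and \<Phi> :: "real \<Rightarrow> real" and \<mu> :: real and lam :: "real \<Rightarrow> 'a \<Rightarrow> real"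
    and \<zeta> :: "real \<Rightarrow> real"
  assumes PRM: "poisson_random_measure M N"
    and mu_pos: "\<mu> > 0"
    and Phi_nonneg: "\<forall>t\<ge>0. \<Phi> t \<ge> 0"
    and Phi_int: "set_integrable lborel {0..} \<Phi>"
    and Phi_lt1: "(LBINT t:{0..}. \<Phi> t) < 1"
    and lam_meas: "\<forall>t\<ge>0. lam t \<in> borel_measurable M"
    and lam_path_meas: "\<forall>\<omega>\<in>space M. (\<lambda>t. lam t \<omega>) \<in> borel_measurable (restrict_space borel {0..})"
    and lam_eq: "AE \<omega> in M. \<forall>t\<ge>0. ennreal (lam t \<omega>) = ennreal \<mu> + hawkesX N lam \<Phi> t \<omega>"
    and zeta: "\<zeta> = \<Phi> \<or> \<zeta> = (\<lambda>_. 1)"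
  shows
   "(\<forall>s\<ge>0. (\<integral>\<^sup>+\<omega>. hawkesX N lam \<zeta> s \<omega> \<partial>M) =
       (if \<zeta> = (\<lambda>_. 1)
        then ennreal (\<mu> * s) + ennreal \<mu> *
               (\<integral>\<^sup>+u\<in>{0..s}. (\<integral>\<^sup>+r\<in>{0..u}. Psi \<Phi> r \<partial>lborel) \<partial>lborel)
        else ennreal \<mu> * (\<integral>\<^sup>+u\<in>{0..s}. Psi \<Phi> u \<partial>lborel)))
    \<and>
    (\<forall>s t. 0 \<le> s \<longrightarrow> s \<le> t \<longrightarrow>
       (\<integral>\<^sup>+\<omega>. hawkesX N lam \<Phi> s \<omega> * hawkesX N lam \<zeta> t \<omega> \<partial>M)
         = (\<integral>\<^sup>+\<omega>. hawkesX N lam \<Phi> s \<omega> \<partial>M) * (\<integral>\<^sup>+\<omega>. hawkesX N lam \<zeta> t \<omega> \<partial>M)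
           + ennreal \<mu> * (\<integral>\<^sup>+v\<in>{0..s}. ennreal (\<zeta> (t - v)) * Psi \<Phi> (s - v)
                 * (1 + (\<integral>\<^sup>+w\<in>{0..v}. Psi \<Phi> w \<partial>lborel)) \<partial>lborel)
           + ennreal \<mu> * (\<integral>\<^sup>+u\<in>{0..t}. (\<integral>\<^sup>+v\<in>{0..min s u}.
                 ennreal (\<zeta> (t - u)) * Psi \<Phi> (u - v) * Psi \<Phi> (s - v)
                 * (1 + (\<integral>\<^sup>+w\<in>{0..v}. Psi \<Phi> (v - w) \<partial>lborel)) \<partial>lborel) \<partial>lborel)
     \<and>
       (\<integral>\<^sup>+\<omega>. hawkesX N lam (\<lambda>_. 1) s \<omega> * hawkesX N lam \<zeta> t \<omega> \<partial>M)
         = (\<integral>\<^sup>+\<omega>. hawkesX N lam (\<lambda>_. 1) s \<omega> \<partial>M) * (\<integral>\<^sup>+\<omega>. hawkesX N lam \<zeta> t \<omega> \<partial>M)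
           + ennreal \<mu> * (\<integral>\<^sup>+u\<in>{0..s}. ennreal (\<zeta> (t - u))
                 * (1 + (\<integral>\<^sup>+y\<in>{u..s}. Psi \<Phi> (y - u) \<partial>lborel))
                 * (1 + (\<integral>\<^sup>+w\<in>{0..u}. Psi \<Phi> w \<partial>lborel)) \<partial>lborel)
           + ennreal \<mu> * (\<integral>\<^sup>+u\<in>{0..t}. (\<integral>\<^sup>+v\<in>{0..min s u}.
                 ennreal (\<zeta> (t - u)) * Psi \<Phi> (u - v)
                 * (1 + (\<integral>\<^sup>+w\<in>{0..v}. Psi \<Phi> w \<partial>lborel))
                 * (1 + (\<integral>\<^sup>+y\<in>{v..s}. Psi \<Phi> (y - v) \<partial>lborel)) \<partial>lborel) \<partial>lborel))"
proof -
  interpret P: poisson_prm M N by unfold_locales (rule PRM)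
  define \<phi> where "\<phi> = positive_part_kernel \<Phi>"
  have "(\<lambda>x. indicator {0..} x *\<^sub>R \<Phi> x) \<in> borel_measurable lborel"
    using Phi_int unfolding set_integrable_def by (rule borel_measurable_integrable)
  then have [measurable]: "(\<lambda>x. indicator {0..} x *\<^sub>R \<Phi> x) \<in> borel_measurable borel" by simp
  have phim[measurable]: "\<phi> \<in> borel_measurable borel"
  proof -
    \<comment> \<open>Integrability on the half-line gives measurability of \<Phi> only there, so
      \<phi> is rewritten through the restricted function.\<close>
    have "\<phi> = (\<lambda>x. ennreal (indicator {0..} x *\<^sub>R \<Phi> x) * indicator {0<..} x)"
      by (auto simp: fun_eq_iff \<phi>_def positive_part_kernel_def indicator_def)
    then show ?thesis by (rule ssubst) measurable
  qed
  interpret H: hawkes_iteration M N "ennreal \<mu>" \<phi>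
    by unfold_locales (auto simp: phim, simp add: \<phi>_def positive_part_kernel_def)
  have onem: "positive_part_kernel (\<lambda>_. 1) \<in> borel_measurable borel"
    unfolding positive_part_kernel_def[abs_def] by measurable
  have zm[measurable]: "positive_part_kernel \<zeta> \<in> borel_measurable borel"
    using zeta onem phim by (auto simp: \<phi>_def)
  have one: "positive_part_kernel (\<lambda>_. 1) (t - u) = indicator {..<t} u" for t u
    by (simp add: positive_part_kernel_def indicator_def)
  have psi: "H.resolvent_lim x = Psi \<Phi> x" if "0 < x" for x
    by (rule H.Psi_resolvent_lim[OF _ that]) (simp add: \<phi>_def positive_part_kernel_def)
  \<comment> \<open>Kernel and time are quantified inside the almost-sure statement, so one null set
    serves both factors of a product.\<close>
  have link: "AE \<omega> in M. \<forall>t \<xi>. positive_part_kernel \<xi> \<in> borel_measurable borel \<longrightarrow>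
      hawkesX N lam \<xi> t \<omega> = H.stochint_lim (\<lambda>u. positive_part_kernel \<xi> (t - u)) \<omega>"
    using AE_space P.AE_locally_finite H.AE_regular lam_eq
  proof eventually_elim
    case (elim \<omega>)
    have "(\<lambda>t. max 0 t) \<in> borel \<rightarrow>\<^sub>M restrict_space borel {0::real..}"
      by (intro measurable_restrict_space2) auto
    from measurable_compose[OF this lam_path_meas[rule_format, OF elim(1)]]
    have lam: "(\<lambda>t. lam (max 0 t) \<omega>) \<in> borel_measurable borel" .
    note hX = P.hawkesX_NN[where lam=lam, OF elim(2) _ lam]
    have "AE p in P.NN \<omega>. snd p \<le> lam (fst p) \<omega> \<longleftrightarrow> p \<in> H.accepted_lim \<omega>"
    proof (rule H.pathwise_uniqueness[OF elim(3) _ lam])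
      show "0 < ennreal \<mu>" using mu_pos by simp
      show "ennreal (lam t \<omega>) = ennreal \<mu> + (\<integral>\<^sup>+p. \<phi> (t - fst p) * indicator {p. snd p \<le> lam (fst p) \<omega>} p \<partial>P.NN \<omega>)"
        if "0 \<le> t" for t
        using elim(4) that hX[of \<Phi> t] phim by (simp add: \<phi>_def)
    qed
    then show ?case unfolding H.stochint_lim_def
      by (intro allI impI) (subst hX, assumption, intro nn_integral_cong_AE, auto elim!: eventually_mono simp: indicator_def)
  qed
  have link1: "(\<integral>\<^sup>+\<omega>. hawkesX N lam \<xi> t \<omega> \<partial>M) = (\<integral>\<^sup>+\<omega>. H.stochint_lim (\<lambda>u. positive_part_kernel \<xi> (t - u)) \<omega> \<partial>M)"
    if "positive_part_kernel \<xi> \<in> borel_measurable borel" for \<xi> t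
    using link that by (intro nn_integral_cong_AE) (auto elim!: eventually_mono)
  have link2: "(\<integral>\<^sup>+\<omega>. hawkesX N lam \<xi> s \<omega> * hawkesX N lam \<zeta> t \<omega> \<partial>M)
      = (\<integral>\<^sup>+\<omega>. H.stochint_lim (\<lambda>u. positive_part_kernel \<xi> (s - u)) \<omega> * H.stochint_lim (\<lambda>u. positive_part_kernel \<zeta> (t - u)) \<omega> \<partial>M)"
    if "positive_part_kernel \<xi> \<in> borel_measurable borel" for \<xi> s t
    using link that zm by (intro nn_integral_cong_AE) (auto elim!: eventually_mono)
  have cpsi: "(\<integral>\<^sub>0x. indicator {..<v} x * H.resolvent_lim x) = (\<integral>\<^sup>+w\<in>{0..v}. Psi \<Phi> w \<partial>lborel)" for v
    by (rule nn_integral_pos_lebesgue_interval_0) (auto simp: psi)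
  have crefl: "(\<integral>\<^sub>0x. indicator {..<v} x * H.resolvent_lim x) = (\<integral>\<^sup>+w\<in>{0..v}. Psi \<Phi> (v - w) \<partial>lborel)" for v
  proof -
    have "(\<integral>\<^sub>0x. indicator {..<v} x * H.resolvent_lim x) = (\<integral>\<^sub>0s. H.resolvent_lim (v - s))"
      by (rule nn_integral_pos_lebesgue_reflect[symmetric]) (auto simp: H.resolvent_lim_nonpos)
    also have "\<dots> = (\<integral>\<^sub>0s. indicator {..<v} s * H.resolvent_lim (v - s))"
      by (intro nn_integral_cong) (auto simp: indicator_def H.resolvent_lim_nonpos)
    also have "\<dots> = (\<integral>\<^sup>+w\<in>{0..v}. Psi \<Phi> (v - w) \<partial>lborel)"
      by (rule nn_integral_pos_lebesgue_interval_0) (auto simp: psi)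
    finally show ?thesis .
  qed
  have kpsi: "(\<integral>\<^sub>0y. indicator {..<s} y * H.resolvent_lim (y - v)) = (\<integral>\<^sup>+y\<in>{v..s}. Psi \<Phi> (y - v) \<partial>lborel)"
    if "0 < v" for v s
  proof -
    have "(\<integral>\<^sub>0y. indicator {..<s} y * H.resolvent_lim (y - v))
      = (\<integral>\<^sub>0y. indicator {..<s} y * (indicator {v<..} y * H.resolvent_lim (y - v)))"
      by (intro nn_integral_cong) (auto simp: indicator_def H.resolvent_lim_nonpos)
    also have "\<dots> = (\<integral>\<^sup>+y\<in>{v..s}. Psi \<Phi> (y - v) \<partial>lborel)"
      using that by (intro nn_integral_pos_lebesgue_interval) (auto simp: psi)
    finally show ?thesis .
  qed
  let ?C = "\<lambda>v. \<integral>\<^sub>0x. indicator {..<v} x * H.resolvent_lim x"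
  let ?g = "\<lambda>t u. positive_part_kernel \<zeta> (t - u)"
  have gz: "?g t u = ennreal (\<zeta> (t - u))" if "u < t" for t u
    using that by (simp add: positive_part_kernel_def)
  have g0: "?g t u = 0" if "t \<le> u" for t u
    using that by (simp add: positive_part_kernel_def)
  have mean_one: "(\<integral>\<^sup>+\<omega>. hawkesX N lam (\<lambda>_. 1) s \<omega> \<partial>M) = ennreal (\<mu> * s) + ennreal \<mu> *
      (\<integral>\<^sup>+u\<in>{0..s}. (\<integral>\<^sup>+r\<in>{0..u}. Psi \<Phi> r \<partial>lborel) \<partial>lborel)" if "0 \<le> s" for s
  proof -
    have "(\<integral>\<^sup>+\<omega>. hawkesX N lam (\<lambda>_. 1) s \<omega> \<partial>M) = (\<integral>\<^sub>0v. indicator {..<s} v * (ennreal \<mu> * (1 + ?C v)))"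
      by (simp add: link1[OF onem] one H.nn_integral_stochint_lim H.mean_intensity_lim_resolvent)
    also have "\<dots> = (\<integral>\<^sub>0v. ennreal \<mu> * (indicator {..<s} v * 1) + ennreal \<mu> * (indicator {..<s} v * ?C v))"
      by (intro nn_integral_cong) (simp add: distrib_left ac_simps)
    also have "\<dots> = ennreal \<mu> * (\<integral>\<^sub>0v. indicator {..<s} v * 1) + ennreal \<mu> * (\<integral>\<^sub>0v. indicator {..<s} v * ?C v)"
      by (subst nn_integral_add, measurable) (subst nn_integral_cmult, measurable)+
    also have "(\<integral>\<^sub>0v. indicator {..<s} v * 1) = (\<integral>\<^sup>+v\<in>{0..s}. 1 \<partial>lborel)"
      by (rule nn_integral_pos_lebesgue_interval_0) auto
    also have "(\<integral>\<^sub>0v. indicator {..<s} v * ?C v) = (\<integral>\<^sup>+u\<in>{0..s}. (\<integral>\<^sup>+r\<in>{0..u}. Psi \<Phi> r \<partial>lborel) \<partial>lborel)"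
      by (rule nn_integral_pos_lebesgue_interval_0) (measurable, simp add: cpsi)
    finally show ?thesis using that mu_pos by (simp add: ennreal_mult)
  qed
  have mean_phi: "(\<integral>\<^sup>+\<omega>. hawkesX N lam \<Phi> s \<omega> \<partial>M) = ennreal \<mu> * (\<integral>\<^sup>+u\<in>{0..s}. Psi \<Phi> u \<partial>lborel)" for s
    using H.nn_integral_stochint_lim_phi[of s] phim by (simp add: link1 \<phi>_def[symmetric] cpsi)
  \<comment> \<open>The inner integral occurs in the statement both with
    \<open>Psi \<Phi> (v - w)\<close> and with \<open>Psi \<Phi> w\<close>; a reflection of the
    interval identifies them.\<close>
  have refl: "(\<integral>\<^sup>+w\<in>{0..v}. Psi \<Phi> (v - w) \<partial>lborel) = (\<integral>\<^sup>+w\<in>{0..v}. Psi \<Phi> w \<partial>lborel)" for v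
    using crefl[of v] cpsi[of v] by simp
  \<comment> \<open>Both covariance formulas are instances: \<open>K v\<close> is
    \<open>Psi \<Phi> (s - v)\<close> for the kernel \<Phi>, and 1 plus the integral of
    \<open>Psi \<Phi> (y - v)\<close> over y from v to s for the constant kernel. \<open>k\<close>
    is a measurable version of \<open>K\<close>, and s \<le> t keeps the argument t - v positive for
    v < s.\<close>
  have cov: "(\<integral>\<^sup>+\<omega>. H.stochint_lim f \<omega> * H.stochint_lim (?g t) \<omega> \<partial>M)
      = (\<integral>\<^sup>+\<omega>. H.stochint_lim f \<omega> \<partial>M) * (\<integral>\<^sup>+\<omega>. H.stochint_lim (?g t) \<omega> \<partial>M)
        + ennreal \<mu> * (\<integral>\<^sup>+v\<in>{0..s}. ennreal (\<zeta> (t - v)) * K v * (1 + (\<integral>\<^sup>+w\<in>{0..v}. Psi \<Phi> w \<partial>lborel)) \<partial>lborel)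
        + ennreal \<mu> * (\<integral>\<^sup>+u\<in>{0..t}. (\<integral>\<^sup>+v\<in>{0..min s u}. ennreal (\<zeta> (t - u)) * Psi \<Phi> (u - v) * K v
            * (1 + (\<integral>\<^sup>+w\<in>{0..v}. Psi \<Phi> w \<partial>lborel)) \<partial>lborel) \<partial>lborel)"
    if "s \<le> t" and fk[measurable]: "f \<in> borel_measurable borel" "k \<in> borel_measurable borel"
      and k: "\<And>w. 0 < w \<Longrightarrow> f w + (\<integral>\<^sub>0u. f u * H.resolvent_lim (u - w)) = indicator {..<s} w * k w"
      and kK: "\<And>w. 0 < w \<Longrightarrow> w < s \<Longrightarrow> k w = K w" for s t f k K
  proof -
    have "(\<integral>\<^sub>0w. indicator {..<s} w * (?g t w * k w * (1 + ?C w)))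
      = (\<integral>\<^sup>+v\<in>{0..s}. ennreal (\<zeta> (t - v)) * K v * (1 + (\<integral>\<^sup>+w\<in>{0..v}. Psi \<Phi> w \<partial>lborel)) \<partial>lborel)"
      using that(1) by (intro nn_integral_pos_lebesgue_interval_0) (measurable, simp add: gz kK cpsi)
    moreover have "(\<integral>\<^sub>0u. indicator {..<t} u * (\<integral>\<^sub>0w. indicator {..<min s u} w
          * (?g t u * H.resolvent_lim (u - w) * k w * (1 + ?C w))))
      = (\<integral>\<^sup>+u\<in>{0..t}. (\<integral>\<^sup>+v\<in>{0..min s u}. ennreal (\<zeta> (t - u)) * Psi \<Phi> (u - v) * K v
            * (1 + (\<integral>\<^sup>+w\<in>{0..v}. Psi \<Phi> w \<partial>lborel)) \<partial>lborel) \<partial>lborel)"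
      by (intro nn_integral_pos_lebesgue_interval_0)
        (measurable, auto simp: gz psi kK cpsi intro!: nn_integral_pos_lebesgue_interval_0)
    ultimately show ?thesis
      using H.second_moment_kernel[OF fk(1) _ fk(2) k, of "?g t" t] g0 by simp
  qed
  show ?thesis
  proof (intro conjI allI impI, goal_cases)
    case (1 s)
    then show ?case using zeta mean_one[of s] mean_phi[of s] by auto
  next
    case (2 s t)
    have k: "\<phi> (s - w) + (\<integral>\<^sub>0u. \<phi> (s - u) * H.resolvent_lim (u - w)) = indicator {..<s} w * H.resolvent_lim (s - w)"
      if "0 < w" for w
      using that by (auto simp: H.resolvent_lim_convolution indicator_def H.resolvent_lim_nonpos)
    have kK: "H.resolvent_lim (s - w) = Psi \<Phi> (s - w)" if "0 < w" "w < s" for w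
      using that by (simp add: psi)
    note cov[OF 2(2) _ _ k kK]
    then show ?case using phim by (simp add: link1 link2 \<phi>_def[symmetric] zm refl)
  next
    case (3 s t)
    let ?k = "\<lambda>w. 1 + (\<integral>\<^sub>0y. indicator {..<s} y * H.resolvent_lim (y - w))"
    have "(\<integral>\<^sub>0u. indicator {..<s} u * H.resolvent_lim (u - w)) = (\<integral>\<^sub>0u. 0)" if "s \<le> w" for w
      using that by (intro nn_integral_cong) (auto simp: indicator_def H.resolvent_lim_nonpos)
    then have k: "indicator {..<s} w + (\<integral>\<^sub>0u. indicator {..<s} u * H.resolvent_lim (u - w)) = indicator {..<s} w * ?k w" for w
      by (cases "w < s") auto
    have kK: "?k w = 1 + (\<integral>\<^sup>+y\<in>{w..s}. Psi \<Phi> (y - w) \<partial>lborel)" if "0 < w" for w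
      using that by (simp add: kpsi)
    from cov[OF 3(2) _ _ k kK] show ?case unfolding link2[OF onem] link1[OF onem] link1[OF zm] one by (simp add: ac_simps)
  qed
qed

end
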